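(* The following are provable in $\mathbf{ZF}$ for every completely regular space $\mathbf{X}$: (i) If $A(\mathbf{X})=C(\mathbf{X})$, then $\mathbf{X}$ is strongly zero-dimensional. (ii) $\mathbf{CMC}$ implies that $\mathbf{X}$ is strongly zero-dimensional if and only if $A(\mathbf{X})=C(\mathbf{X})$. (iii) $\mathbf{CMC}$ implies that $\mathbf{X}$ is strongly zero-dimensional if and only if $U_{\aleph_0}(\mathbf{X})=C(\mathbf{X})$.
   Context: The base theory is $\mathbf{ZF}$ (no Axiom of Choice). A set is countable if it is equipotent to a subset of $\omega$, and denumerable if it is infinite and countable. A multiple choice function of a family $\{A_j:j\in J\}$ is a function assigning to each $j\in J$ a non-empty finite subset of $A_j$. $\mathbf{CMC}$: every denumerable family of non-empty sets has a multiple choice function. For a topological space $\mathbf{X}$ with underlying set $X$, $C(\mathbf{X})$ is the set of continuous functions $X\to\mathbb{R}$. A zero-set of $\mathbf{X}$ is a set $Z(f)=f^{-1}[\{0\}]$ with $f\in C(\mathbf{X})$; a co-zero set is the complement of a zero-set. $\mathbf{X}$ is completely regular if its co-zero sets form a base of $\mathbf{X}$. $\mathbf{X}$ is strongly zero-dimensional if it is completely regular and for every pair $Z_1,Z_2$ of disjoint zero-sets there is a clopen set $U$ with $Z_1\subseteq U\subseteq X\setminus Z_2$. $A(\mathbf{X})$ is the set of all $f\in C(\mathbf{X})$ such that for each open $O\subseteq\mathbb{R}$ the set $f^{-1}[O]$ is a countable union of clopen sets of $\mathbf{X}$. $U_{\aleph_0}(\mathbf{X})$ is the set of all $f\in C(\mathbf{X})$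 such that for each $\varepsilon>0$ there is a countable cover $\mathcal{A}$ of $X$ by clopen sets with $\mathrm{osc}_A(f)=\sup\{|f(x)-f(y)|:x,y\in A\}\le\varepsilon$ for all $A\in\mathcal{A}$. *)

theory Defs
  imports Main
begin

text \<open>
  HOL has a choice operator, so a theorem about HOL sets says nothing about ZF without choice.
  Provability in ZF is therefore rendered as truth in every model of first-order ZF (equivalent by
  the completeness theorem). A model is a type \<open>'m\<close> with a membership relation \<open>E\<close>. Separation and
  Replacement are imposed only for first-order formulas with parameters; hence a model need not
  satisfy any form of choice, although the metatheory does. All sets, functions, families and
  topologies below are elements of \<open>'m\<close>, and every quantifier in the set-theoretic notions
  ranges, directly or through a guard, over \<open>'m\<close>; HOL sets over \<open>'m\<close> only serve as notation for
  definable classes.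
\<close>

datatype fm = FMem nat nat | FEq nat nat | FNeg fm | FAnd fm fm | FAll fm

text \<open>De Bruijn indices: \<open>FAll\<close> binds index 0 and shifts the remaining ones.\<close>

primrec sat :: "('m \<Rightarrow> 'm \<Rightarrow> bool) \<Rightarrow> (nat \<Rightarrow> 'm) \<Rightarrow> fm \<Rightarrow> bool" where
  "sat E e (FMem i j) \<longleftrightarrow> E (e i) (e j)"
| "sat E e (FEq i j) \<longleftrightarrow> e i = e j"
| "sat E e (FNeg p) \<longleftrightarrow> \<not> sat E e p"
| "sat E e (FAnd p q) \<longleftrightarrow> sat E e p \<and> sat E e q"
| "sat E e (FAll p) \<longleftrightarrow> (\<forall>x. sat E (case_nat x e) p)"

text \<open>Carrier, operations, order (as sets of ordered pairs) and constants, all elements of the model.\<close>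

record 'm field_data =
  rcar :: 'm
  radd :: 'm
  rmul :: 'm
  rle :: 'm
  rzero :: 'm
  rone :: 'm

locale set_structure =
  fixes E :: "'m \<Rightarrow> 'm \<Rightarrow> bool"  (infix \<open>\<in>\<^sub>M\<close> 50)
begin

definition elts :: "'m \<Rightarrow> 'm set" where
  "elts a = {x. x \<in>\<^sub>M a}"

definition opair :: "'m \<Rightarrow> 'm \<Rightarrow> 'm" where
  "opair a b = (THE p. \<exists>s d. elts s = {a} \<and> elts d = {a, b} \<and> elts p = {s, d})"

definition app :: "'m \<Rightarrow> 'm \<Rightarrow> 'm" where
  "app f x = (THE y. opair x y \<in>\<^sub>M f)"

definition pairs :: "'m \<Rightarrow> 'm \<Rightarrow> 'm set" where
  "pairs A B = {opair x y | x y. x \<in>\<^sub>M A \<and> y \<in>\<^sub>M B}"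

definition funs :: "'m \<Rightarrow> 'm \<Rightarrow> 'm set" where
  "funs A B = {f. elts f \<subseteq> pairs A B \<and> (\<forall>x\<in>elts A. \<exists>!y. opair x y \<in>\<^sub>M f)}"

definition equipotent :: "'m \<Rightarrow> 'm \<Rightarrow> bool" where
  "equipotent A B \<longleftrightarrow> (\<exists>f\<in>funs A B. bij_betw (app f) (elts A) (elts B))"

definition is_inductive :: "'m \<Rightarrow> bool" where
  "is_inductive w \<longleftrightarrow>
     (\<exists>z\<in>elts w. elts z = {}) \<and> (\<forall>n\<in>elts w. \<exists>s\<in>elts w. elts s = insert n (elts n))"

text \<open>
  The model's own \<open>\<omega>\<close>, possibly non-standard when seen from HOL. Finiteness and countability are
  those of the model.
\<close>

definition is_omega :: "'m \<Rightarrow> bool" where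
  "is_omega w \<longleftrightarrow> is_inductive w \<and> (\<forall>v. is_inductive v \<longrightarrow> elts w \<subseteq> elts v)"

definition finite_set :: "'m \<Rightarrow> bool" where
  "finite_set A \<longleftrightarrow> (\<exists>w n. is_omega w \<and> n \<in>\<^sub>M w \<and> equipotent A n)"

definition countable_set :: "'m \<Rightarrow> bool" where
  "countable_set A \<longleftrightarrow> (\<exists>w B. is_omega w \<and> elts B \<subseteq> elts w \<and> equipotent A B)"

definition denumerable_set :: "'m \<Rightarrow> bool" where
  "denumerable_set A \<longleftrightarrow> \<not> finite_set A \<and> countable_set A"

definition multiple_choice_function :: "'m \<Rightarrow> 'm \<Rightarrow> 'm \<Rightarrow> bool" where
  "multiple_choice_function J A c \<longleftrightarrow>
     (\<exists>W. c \<in> funs J W) \<and>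
     (\<forall>j\<in>elts J. elts (app c j) \<noteq> {} \<and> finite_set (app c j) \<and>
        elts (app c j) \<subseteq> elts (app A j))"

text \<open>A family \<open>{A\<^sub>j : j \<in> J}\<close> is a function \<open>A\<close> of the model with domain \<open>J\<close>.\<close>

definition CMC :: bool where
  "CMC \<longleftrightarrow>
     (\<forall>J A V. denumerable_set J \<and> A \<in> funs J V \<and> (\<forall>j\<in>elts J. elts (app A j) \<noteq> {}) \<longrightarrow>
        (\<exists>c. multiple_choice_function J A c))"

definition add :: "'m field_data \<Rightarrow> 'm \<Rightarrow> 'm \<Rightarrow> 'm" where
  "add R x y = app (radd R) (opair x y)"

definition mul :: "'m field_data \<Rightarrow> 'm \<Rightarrow> 'm \<Rightarrow> 'm" where
  "mul R x y = app (rmul R) (opair x y)"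

definition le :: "'m field_data \<Rightarrow> 'm \<Rightarrow> 'm \<Rightarrow> bool" where
  "le R x y \<longleftrightarrow> opair x y \<in>\<^sub>M rle R"

definition less :: "'m field_data \<Rightarrow> 'm \<Rightarrow> 'm \<Rightarrow> bool" where
  "less R x y \<longleftrightarrow> le R x y \<and> x \<noteq> y"

definition ordered_field :: "'m field_data \<Rightarrow> bool" where
  "ordered_field R \<longleftrightarrow>
     (let K = elts (rcar R); z = rzero R; u = rone R in
       (\<exists>P. elts P = pairs (rcar R) (rcar R) \<and>
          radd R \<in> funs P (rcar R) \<and> rmul R \<in> funs P (rcar R)) \<and>
       elts (rle R) \<subseteq> pairs (rcar R) (rcar R) \<and>
       z \<in> K \<and> u \<in> K \<and> z \<noteq> u \<and>
       (\<forall>x\<in>K. \<forall>y\<in>K. add R x y = add R y x) \<and>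
       (\<forall>x\<in>K. \<forall>y\<in>K. mul R x y = mul R y x) \<and>
       (\<forall>x\<in>K. \<forall>y\<in>K. \<forall>t\<in>K. add R (add R x y) t = add R x (add R y t)) \<and>
       (\<forall>x\<in>K. \<forall>y\<in>K. \<forall>t\<in>K. mul R (mul R x y) t = mul R x (mul R y t)) \<and>
       (\<forall>x\<in>K. \<forall>y\<in>K. \<forall>t\<in>K. mul R x (add R y t) = add R (mul R x y) (mul R x t)) \<and>
       (\<forall>x\<in>K. add R x z = x) \<and>
       (\<forall>x\<in>K. mul R x u = x) \<and>
       (\<forall>x\<in>K. \<exists>y\<in>K. add R x y = z) \<and>
       (\<forall>x\<in>K. x \<noteq> z \<longrightarrow> (\<exists>y\<in>K. mul R x y = u)) \<and>
       (\<forall>x\<in>K. le R x x) \<and>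
       (\<forall>x\<in>K. \<forall>y\<in>K. le R x y \<and> le R y x \<longrightarrow> x = y) \<and>
       (\<forall>x\<in>K. \<forall>y\<in>K. \<forall>t\<in>K. le R x y \<and> le R y t \<longrightarrow> le R x t) \<and>
       (\<forall>x\<in>K. \<forall>y\<in>K. le R x y \<or> le R y x) \<and>
       (\<forall>x\<in>K. \<forall>y\<in>K. \<forall>t\<in>K. le R x y \<longrightarrow> le R (add R x t) (add R y t)) \<and>
       (\<forall>x\<in>K. \<forall>y\<in>K. le R z x \<and> le R z y \<longrightarrow> le R z (mul R x y)))"

definition upper_bound :: "'m field_data \<Rightarrow> 'm set \<Rightarrow> 'm \<Rightarrow> bool" where
  "upper_bound R S b \<longleftrightarrow> b \<in>\<^sub>M rcar R \<and> (\<forall>x\<in>S. le R x b)"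

text \<open>
  The real line of the model: an ordered field in which all non-empty bounded subsets that belong
  to the model have a supremum. ZF proves that it exists and is unique up to isomorphism.
\<close>

definition real_line :: "'m field_data \<Rightarrow> bool" where
  "real_line R \<longleftrightarrow> ordered_field R \<and>
     (\<forall>S. elts S \<subseteq> elts (rcar R) \<and> elts S \<noteq> {} \<and> (\<exists>b. upper_bound R (elts S) b) \<longrightarrow>
        (\<exists>s. upper_bound R (elts S) s \<and> (\<forall>b. upper_bound R (elts S) b \<longrightarrow> le R s b)))"

definition neg :: "'m field_data \<Rightarrow> 'm \<Rightarrow> 'm" where
  "neg R x = (THE y. y \<in>\<^sub>M rcar R \<and> add R x y = rzero R)"

definition absdiff :: "'m field_data \<Rightarrow> 'm \<Rightarrow> 'm \<Rightarrow> 'm" where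
  "absdiff R x y =
     (let d = add R x (neg R y) in if le R (rzero R) d then d else neg R d)"

definition open_real :: "'m field_data \<Rightarrow> 'm \<Rightarrow> bool" where
  "open_real R S \<longleftrightarrow> elts S \<subseteq> elts (rcar R) \<and>
     (\<forall>x\<in>elts S. \<exists>r\<in>elts (rcar R). less R (rzero R) r \<and>
        (\<forall>y\<in>elts (rcar R). less R (absdiff R x y) r \<longrightarrow> y \<in>\<^sub>M S))"

definition topological_space :: "'m \<Rightarrow> 'm \<Rightarrow> bool" where
  "topological_space X T \<longleftrightarrow>
     (\<forall>U\<in>elts T. elts U \<subseteq> elts X) \<and>
     X \<in>\<^sub>M T \<and>
     (\<forall>U\<in>elts T. \<forall>V\<in>elts T. \<exists>W\<in>elts T. elts W = elts U \<inter> elts V) \<and>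
     (\<forall>F. elts F \<subseteq> elts T \<longrightarrow> (\<exists>W\<in>elts T. elts W = \<Union> (elts ` elts F)))"

definition open_in :: "'m \<Rightarrow> 'm set \<Rightarrow> bool" where
  "open_in T A \<longleftrightarrow> (\<exists>U\<in>elts T. elts U = A)"

definition clopen_in :: "'m \<Rightarrow> 'm \<Rightarrow> 'm set \<Rightarrow> bool" where
  "clopen_in X T A \<longleftrightarrow> open_in T A \<and> open_in T (elts X - A)"

definition preimage :: "'m \<Rightarrow> 'm \<Rightarrow> 'm \<Rightarrow> 'm set" where
  "preimage X f S = {x \<in> elts X. app f x \<in>\<^sub>M S}"

definition C_fun :: "'m field_data \<Rightarrow> 'm \<Rightarrow> 'm \<Rightarrow> 'm set" where
  "C_fun R X T =
     {f \<in> funs X (rcar R). \<forall>S. open_real R S \<longrightarrow> open_in T (preimage X f S)}"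

definition zero_sets :: "'m field_data \<Rightarrow> 'm \<Rightarrow> 'm \<Rightarrow> 'm set set" where
  "zero_sets R X T = {{x \<in> elts X. app f x = rzero R} | f. f \<in> C_fun R X T}"

definition cozero_sets :: "'m field_data \<Rightarrow> 'm \<Rightarrow> 'm \<Rightarrow> 'm set set" where
  "cozero_sets R X T = {elts X - Z | Z. Z \<in> zero_sets R X T}"

definition completely_regular :: "'m field_data \<Rightarrow> 'm \<Rightarrow> 'm \<Rightarrow> bool" where
  "completely_regular R X T \<longleftrightarrow> topological_space X T \<and>
     (\<forall>B\<in>cozero_sets R X T. open_in T B) \<and>
     (\<forall>U\<in>elts T. \<forall>x\<in>elts U. \<exists>B\<in>cozero_sets R X T. x \<in> B \<and> B \<subseteq> elts U)"

definition strongly_zero_dimensional :: "'m field_data \<Rightarrow> 'm \<Rightarrow> 'm \<Rightarrow> bool" where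
  "strongly_zero_dimensional R X T \<longleftrightarrow> completely_regular R X T \<and>
     (\<forall>Z1\<in>zero_sets R X T. \<forall>Z2\<in>zero_sets R X T. Z1 \<inter> Z2 = {} \<longrightarrow>
        (\<exists>U. clopen_in X T U \<and> Z1 \<subseteq> U \<and> U \<subseteq> elts X - Z2))"

definition countable_clopen_family :: "'m \<Rightarrow> 'm \<Rightarrow> 'm \<Rightarrow> bool" where
  "countable_clopen_family X T F \<longleftrightarrow>
     countable_set F \<and> (\<forall>A\<in>elts F. clopen_in X T (elts A))"

definition A_fun :: "'m field_data \<Rightarrow> 'm \<Rightarrow> 'm \<Rightarrow> 'm set" where
  "A_fun R X T =
     {f \<in> C_fun R X T. \<forall>S. open_real R S \<longrightarrow>
        (\<exists>F. countable_clopen_family X T F \<and> preimage X f S = \<Union> (elts ` elts F))}"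

text \<open>
  \<open>is_osc R f A s\<close>: the oscillation of \<open>f\<close> on \<open>A\<close> is the real number \<open>s\<close>. The supremum is taken in
  \<open>[0, \<infinity>]\<close>, so it is 0 for empty \<open>A\<close>, and no such \<open>s\<close> exists when it is infinite.
\<close>

definition is_osc :: "'m field_data \<Rightarrow> 'm \<Rightarrow> 'm \<Rightarrow> 'm \<Rightarrow> bool" where
  "is_osc R f A s \<longleftrightarrow>
     (let D = {absdiff R (app f x) (app f y) | x y. x \<in>\<^sub>M A \<and> y \<in>\<^sub>M A} in
       upper_bound R D s \<and> le R (rzero R) s \<and>
       (\<forall>b. upper_bound R D b \<and> le R (rzero R) b \<longrightarrow> le R s b))"

definition U_fun :: "'m field_data \<Rightarrow> 'm \<Rightarrow> 'm \<Rightarrow> 'm set" where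
  "U_fun R X T =
     {f \<in> C_fun R X T. \<forall>r\<in>elts (rcar R). less R (rzero R) r \<longrightarrow>
        (\<exists>F. countable_clopen_family X T F \<and> \<Union> (elts ` elts F) = elts X \<and>
           (\<forall>A\<in>elts F. \<exists>s. is_osc R f A s \<and> le R s r))}"

end

text \<open>
  In the two schemas the environment \<open>e\<close> supplies arbitrary parameters; the bound variables are
  index 0 (and 1).
\<close>

locale ZF_model = set_structure E
  for E :: "'m \<Rightarrow> 'm \<Rightarrow> bool"  (infix \<open>\<in>\<^sub>M\<close> 50) +
  assumes extensionality: "elts a = elts b \<Longrightarrow> a = b"
    and foundation: "elts a \<noteq> {} \<Longrightarrow> \<exists>x\<in>elts a. elts x \<inter> elts a = {}"
    and pairing: "\<exists>c. elts c = {a, b}"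
    and union: "\<exists>u. elts u = \<Union> (elts ` elts a)"
    and powerset: "\<exists>p. elts p = {b. elts b \<subseteq> elts a}"
    and infinity: "\<exists>w. is_inductive w"
    and separation: "\<exists>b. elts b = {x \<in> elts a. sat (\<in>\<^sub>M) (case_nat x e) p}"
    and replacement:
      "(\<And>x. x \<in> elts a \<Longrightarrow> \<exists>!y. sat (\<in>\<^sub>M) (case_nat x (case_nat y e)) p) \<Longrightarrow>
         \<exists>b. elts b = {y. \<exists>x\<in>elts a. sat (\<in>\<^sub>M) (case_nat x (case_nat y e)) p}"

end

theory Submission
  imports Defs
begin

text \<open>
  Definability with parameters is closed under the usual constructions, so that inside a model
  separation, replacement, induction and recursion on \<open>\<omega>\<close> can be applied to ordinary HOL formulas.

  Without choice: if the co-zero sets of disjoint \<open>Z(f)\<close>, \<open>Z(g)\<close> are unions of enumerated clopen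
  families, the points that are caught by the second family first form a clopen set that separates
  \<open>Z(f)\<close> from \<open>Z(g)\<close>. This gives (i). For the backward half of (iii) the two families consist of the
  members of a cover with small oscillation for \<open>\<bar>f\<bar> / (\<bar>f\<bar> + \<bar>g\<bar>)\<close> that miss \<open>Z(g)\<close>,
  respectively \<open>Z(f)\<close>.

  With \<open>CMC\<close> and strong zero-dimensionality, preimages of closed sets are zero sets, and for
  countably many pairs of them one obtains a sequence of clopen separators: \<open>CMC\<close> supplies finite
  sets of separators, and the union of a finite set of separators is a separator. Separating
  \<open>{x. dist (f x) (- O) \<ge> \<epsilon>\<^sub>n}\<close> from \<open>{x. f x \<notin> O}\<close> gives (ii); separating the \<open>\<delta>\<close>-balls around the
  points of a countable \<open>\<delta>\<close>-net from the complements of the \<open>2\<delta>\<close>-balls, pulled back along \<open>f\<close>,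
  gives (iii).
\<close>

section \<open>Definability with parameters\<close>

text \<open>Two obstacles shape the proof. The metatheory has choice, but separation and replacement
  of the model speak only of first-order formulas, so whatever is used inside the model needs a
  proof that it is definable; objects are therefore given by descriptions with a fixed default, not
  by chosen witnesses. Moreover, the \<omega> of the model may be non-standard: a set that the model
  considers finite can be infinite from outside, so recursion, the pigeonhole principle and unions
  of finite families are handled by induction inside the model.

  The separation argument is free of choice because it fixes just two families and one enumeration
  of each. The forward directions ask for infinitely many separators at once. Their pairs of sets
  are described by one formula in n, so the set of all separators of the n-th pair is a definable
  function of n, hence a family of the model to which \<open>CMC\<close> applies. Strong
  zero-dimensionality separates only zero sets, which is why closed conditions on f x have to be
  converted into vanishing of an explicit distance.\<close>

primrec rename_fm :: "fm \<Rightarrow> (nat \<Rightarrow> nat) \<Rightarrow> fm" where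
  "rename_fm (FMem i j) g = FMem (g i) (g j)"
| "rename_fm (FEq i j) g = FEq (g i) (g j)"
| "rename_fm (FNeg p) g = FNeg (rename_fm p g)"
| "rename_fm (FAnd p q) g = FAnd (rename_fm p g) (rename_fm q g)"
| "rename_fm (FAll p) g = FAll (rename_fm p (case_nat 0 (\<lambda>i. Suc (g i))))"

text \<open>Each closure rule below compares two layouts of variables and parameters in an
  environment; renaming reduces such a comparison to an index map.\<close>

lemma sat_rename_fm: "sat E e (rename_fm p g) \<longleftrightarrow> sat E (\<lambda>i. e (g i)) p"
proof (induction p arbitrary: e g)
  case (FAll p)
  have "(\<lambda>i. case_nat x e (case_nat 0 (\<lambda>i. Suc (g i)) i)) = case_nat x (\<lambda>i. e (g i))" for x
    by (auto split: nat.split)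
  then show ?case by (simp add: FAll.IH)
qed auto

text \<open>Splitting by parity reserves infinitely many positions both for variables and for
  parameters, so no rule has to track which indices occur in a formula.\<close>

definition interleave :: "(nat \<Rightarrow> 'a) \<Rightarrow> (nat \<Rightarrow> 'a) \<Rightarrow> nat \<Rightarrow> 'a" where
  "interleave v c i = (if even i then v (i div 2) else c (i div 2))"

context set_structure
begin

text \<open>
  The variables of a definable predicate sit at the even positions of the environment, its
  parameters at the odd ones. Predicates are HOL functions of the whole assignment, so the
  closure rules below decompose an ordinary HOL formula by higher-order pattern unification.
\<close>

definition definable :: "((nat \<Rightarrow> 'm) \<Rightarrow> bool) \<Rightarrow> bool" where
  "definable P \<longleftrightarrow> (\<exists>p c. \<forall>v. sat (\<in>\<^sub>M) (interleave v c) p = P v)"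

text \<open>The language has no function symbols, so a term is definable through its graph; the
  value takes index 0 and the arguments move up as under a binder.\<close>

definition definable_fun :: "((nat \<Rightarrow> 'm) \<Rightarrow> 'm) \<Rightarrow> bool" where
  "definable_fun t \<longleftrightarrow> definable (\<lambda>e. e 0 = t (\<lambda>i. e (Suc i)))"

lemma definableI: "(\<And>v. sat (\<in>\<^sub>M) (interleave v c) p = P v) \<Longrightarrow> definable P"
  unfolding definable_def by blast

lemma definable_rename:
  assumes "definable P" shows "definable (\<lambda>e. P (\<lambda>i. e (g i)))"
proof -
  obtain p c where p: "\<And>v. sat (\<in>\<^sub>M) (interleave v c) p = P v"
    using assms unfolding definable_def by blast
  have "(\<lambda>i. interleave v c (if even i then 2 * g (i div 2) else i)) = interleave (\<lambda>i. v (g i)) c" for v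
    by (auto simp: interleave_def)
  then have "sat (\<in>\<^sub>M) (interleave v c)
      (rename_fm p (\<lambda>i. if even i then 2 * g (i div 2) else i)) = P (\<lambda>i. v (g i))" for v
    by (simp add: sat_rename_fm p)
  then show ?thesis by (rule definableI)
qed

lemma definable_mem_var: "definable (\<lambda>e. e i \<in>\<^sub>M e j)"
  by (rule definableI[of _ "FMem (2*i) (2*j)"]) (simp add: interleave_def)

lemma definable_eq_var: "definable (\<lambda>e. e i = e j)"
  by (rule definableI[of _ "FEq (2*i) (2*j)"]) (simp add: interleave_def)

lemma definable_eq_const: "definable (\<lambda>e. e i = a)"
  by (rule definableI[of "\<lambda>_. a" "FEq (2*i) 1"]) (simp add: interleave_def)

lemma definable_not: "definable P \<Longrightarrow> definable (\<lambda>e. \<not> P e)"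
  unfolding definable_def by (metis sat.simps(3))

lemma definable_conj:
  assumes "definable P" "definable Q" shows "definable (\<lambda>e. P e \<and> Q e)"
proof -
  obtain p c where p: "\<And>v. sat (\<in>\<^sub>M) (interleave v c) p = P v"
    using assms unfolding definable_def by blast
  obtain q d where q: "\<And>v. sat (\<in>\<^sub>M) (interleave v d) q = Q v"
    using assms unfolding definable_def by blast
  \<comment> \<open>Interleaving the two parameter sequences puts \<open>c j\<close> at position 4j
    + 1 and \<open>d j\<close> at position 4j + 3 of the joint environment.\<close>
  have 1: "(\<lambda>i. interleave v (interleave c d) (if even i then i else 4 * (i div 2) + 1)) =
      interleave v c" for v
    by (rule ext) (auto simp: interleave_def elim!: oddE)
  have div: "(4 * j + 3) div 2 = 2 * j + 1" for j :: nat by auto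
  have 2: "(\<lambda>i. interleave v (interleave c d) (if even i then i else 4 * (i div 2) + 3)) =
      interleave v d" for v
    by (rule ext) (auto simp: interleave_def div elim!: oddE)
  show ?thesis
    by (rule definableI[of "interleave c d"
          "FAnd (rename_fm p (\<lambda>i. if even i then i else 4 * (i div 2) + 1))
                (rename_fm q (\<lambda>i. if even i then i else 4 * (i div 2) + 3))"])
      (simp only: sat.simps sat_rename_fm 1 2 p q)
qed

lemma definable_all:
  assumes "definable (\<lambda>e. P (e 0) (\<lambda>i. e (Suc i)))"
  shows "definable (\<lambda>e. \<forall>x. P x e)"
proof -
  obtain p c where p: "\<And>v. sat (\<in>\<^sub>M) (interleave v c) p = P (v 0) (\<lambda>i. v (Suc i))"
    using assms unfolding definable_def by blast
  \<comment> \<open>Entering the quantifier shifts every position by one and so exchanges the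
    parities; \<open>g\<close> sends each variable and each parameter to its shifted place.\<close>
  define g :: "nat \<Rightarrow> nat" where "g i = (if i = 0 then 0 else if even i then i - 1 else i + 1)" for i
  have "(\<lambda>i. case_nat x (interleave v c) (g i)) = interleave (case_nat x v) c" for x v
    by (rule ext, auto simp: interleave_def g_def elim!: evenE oddE split: nat.split)
      (drule arg_cong[where f = even], simp)
  then have "sat (\<in>\<^sub>M) (interleave v c) (FAll (rename_fm p g)) = (\<forall>x. P x v)" for v
    by (simp add: sat_rename_fm p)
  then show ?thesis by (rule definableI)
qed

lemma definable_imp: "definable P \<Longrightarrow> definable Q \<Longrightarrow> definable (\<lambda>e. P e \<longrightarrow> Q e)"
  using definable_not[OF definable_conj[OF _ definable_not[of Q]]] by simp

lemma definable_disj: "definable P \<Longrightarrow> definable Q \<Longrightarrow> definable (\<lambda>e. P e \<or> Q e)"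
  using definable_imp[OF definable_not] by (simp add: disj_imp)

lemma definable_iff: "definable P \<Longrightarrow> definable Q \<Longrightarrow> definable (\<lambda>e. P e \<longleftrightarrow> Q e)"
  unfolding iff_conv_conj_imp by (intro definable_conj definable_imp)

lemma definable_ex:
  "definable (\<lambda>e. P (e 0) (\<lambda>i. e (Suc i))) \<Longrightarrow> definable (\<lambda>e. \<exists>x. P x e)"
  using definable_not[OF definable_all[of "\<lambda>x e. \<not> P x e"]] definable_not by simp

lemma definable_fun_rename: "definable_fun t \<Longrightarrow> definable_fun (\<lambda>e. t (\<lambda>i. e (g i)))"
  unfolding definable_fun_def by (drule definable_rename[where g = "case_nat 0 (\<lambda>i. Suc (g i))"]) simp

lemma definable_fun_var: "definable_fun (\<lambda>e. e i)"
  unfolding definable_fun_def by (rule definable_eq_var)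

lemma definable_fun_const: "definable_fun (\<lambda>e. a)"
  unfolding definable_fun_def by (rule definable_eq_const)

text \<open>In a language without terms, substituting \<open>t\<close> is expressed by a quantifier:
  some \<open>x\<close> equals \<open>t e\<close> and satisfies \<open>P\<close>.\<close>

lemma definable_subst:
  assumes "definable (\<lambda>e. P (e 0) (\<lambda>i. e (Suc i)))" "definable_fun t"
  shows "definable (\<lambda>e. P (t e) e)"
proof -
  have "definable (\<lambda>e. \<exists>x. x = t e \<and> P x e)"
    by (intro definable_ex definable_conj assms assms(2)[unfolded definable_fun_def])
  then show ?thesis by simp
qed

lemma definable_mem:
  assumes "definable_fun t" "definable_fun u" shows "definable (\<lambda>e. t e \<in>\<^sub>M u e)"
  by (rule definable_subst[of "\<lambda>x e. x \<in>\<^sub>M u e", OF _ assms(1)],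
      rule definable_subst[of "\<lambda>y e. e 0 \<in>\<^sub>M y", OF _ assms(2)[THEN definable_fun_rename]],
      rule definable_mem_var)

lemma definable_eq:
  assumes "definable_fun t" "definable_fun u" shows "definable (\<lambda>e. t e = u e)"
  by (rule definable_subst[of "\<lambda>x e. x = u e", OF _ assms(1)],
      rule definable_subst[of "\<lambda>y e. e 0 = y", OF _ assms(2)[THEN definable_fun_rename]],
      rule definable_eq_var)

lemma mem_elts [simp]: "x \<in> elts a \<longleftrightarrow> x \<in>\<^sub>M a"
  by (simp add: elts_def)

lemma definable_ball:
  assumes "definable_fun t" "definable (\<lambda>e. P (e 0) (\<lambda>i. e (Suc i)))"
  shows "definable (\<lambda>e. \<forall>x\<in>elts (t e). P x e)"
  unfolding Ball_def mem_elts
  by (intro definable_all definable_imp definable_mem definable_fun_var assms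
      assms(1)[THEN definable_fun_rename])

lemma definable_bex:
  assumes "definable_fun t" "definable (\<lambda>e. P (e 0) (\<lambda>i. e (Suc i)))"
  shows "definable (\<lambda>e. \<exists>x\<in>elts (t e). P x e)"
  unfolding Bex_def mem_elts
  by (intro definable_ex definable_conj definable_mem definable_fun_var assms
      assms(1)[THEN definable_fun_rename])

lemma definable_const: "definable (\<lambda>e. b)"
  by (cases b) (use definable_eq_var[of 0 0] definable_not[OF definable_eq_var[of 0 0]] in auto)

lemmas definable_intros =
  definable_not definable_conj definable_disj definable_imp definable_iff definable_ball
  definable_bex definable_all definable_ex definable_mem definable_eq definable_const
  definable_fun_var definable_fun_const

end

section \<open>Separation and replacement for definable predicates\<close>

context ZF_model
begin

lemma separation_definable:
  assumes "definable (\<lambda>e. P (e 0))" shows "\<exists>b. elts b = {x \<in> elts a. P x}"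
proof -
  obtain p c where p: "\<And>v. sat (\<in>\<^sub>M) (interleave v c) p = P (v 0)"
    using assms unfolding definable_def by blast
  have "case_nat x (\<lambda>i. interleave (case_nat a (\<lambda>_. a)) c (Suc i)) = interleave (case_nat x (\<lambda>_. a)) c" for x
    by (rule ext) (auto simp: interleave_def elim!: evenE oddE split: nat.split)
  then show ?thesis
    using separation[of a "\<lambda>i. interleave (case_nat a (\<lambda>_. a)) c (Suc i)" p] by (simp add: p)
qed

lemma replacement_definable:
  assumes "definable (\<lambda>e. P (e 0) (e (Suc 0)))" and ex1: "\<And>x. x \<in>\<^sub>M a \<Longrightarrow> \<exists>!y. P x y"
  shows "\<exists>b. elts b = {y. \<exists>x\<in>elts a. P x y}"
proof -
  obtain p c where p: "\<And>v. sat (\<in>\<^sub>M) (interleave v c) p = P (v 0) (v (Suc 0))"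
    using assms unfolding definable_def by blast
  \<comment> \<open>The schema expects \<open>y\<close> at position 1, which interleaving reserves
    for the first parameter; hence the exchange of positions 1 and 2.\<close>
  define g :: "nat \<Rightarrow> nat" where "g i = (if i = 1 then 2 else if i = 2 then 1 else i)" for i
  define e where "e i = (if i = 0 then c 0 else interleave (\<lambda>_. a) c (i + 2))" for i
  have "(\<lambda>i. case_nat x (case_nat y e) (g i)) = interleave (case_nat x (case_nat y (\<lambda>_. a))) c" for x y
  proof
    fix i :: nat
    consider "i = 0" | "i = 1" | "i = 2" | j where "i = Suc (Suc (Suc j))"
      by (metis One_nat_def Suc_1 not0_implies_Suc)
    then show "case_nat x (case_nat y e) (g i) = interleave (case_nat x (case_nat y (\<lambda>_. a))) c i"
      by cases (auto simp: g_def e_def interleave_def elim!: evenE oddE split: nat.split)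
  qed
  then have "sat (\<in>\<^sub>M) (case_nat x (case_nat y e)) (rename_fm p g) = P x y" for x y
    by (simp add: sat_rename_fm p)
  then show ?thesis
    using replacement[of a e "rename_fm p g"] ex1 by simp
qed

end

section \<open>Sets, pairs and functions of the model\<close>

context set_structure
begin

text \<open>
  \<open>THE\<close> without unique existence yields a value that depends on the predicate and need not be
  definable; \<open>the1\<close>, and \<open>ap\<close> below in place of \<open>app\<close>, have a fixed default instead.
\<close>

definition the1 :: "('m \<Rightarrow> bool) \<Rightarrow> 'm" where
  "the1 P = (if \<exists>!x. P x then THE x. P x else undefined)"

lemma the1_equality: "P a \<Longrightarrow> (\<And>y. P y \<Longrightarrow> y = a) \<Longrightarrow> the1 P = a"
  unfolding the1_def by (metis (mono_tags, lifting) the_equality)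

lemma the1I: "\<exists>!x. P x \<Longrightarrow> P (the1 P)"
  unfolding the1_def by (auto intro: theI')

lemma definable_rename_Suc:
  "definable (\<lambda>e. P (e 0) (\<lambda>i. e (Suc i))) \<Longrightarrow> definable (\<lambda>e. P (e k) (\<lambda>i. e (h i)))"
  by (drule definable_rename[where g = "case_nat k h"]) simp

lemma definable_the1:
  assumes "definable (\<lambda>e. P (e 0) (\<lambda>i. e (Suc i)))"
  shows "definable_fun (\<lambda>e. the1 (\<lambda>x. P x e))"
proof -
  have "z = the1 Q \<longleftrightarrow> (Q z \<and> (\<forall>y. Q y \<longrightarrow> y = z)) \<or>
      (\<not> (\<exists>x. Q x \<and> (\<forall>y. Q y \<longrightarrow> y = x)) \<and> z = undefined)" for z Q
  proof (cases "\<exists>!x. Q x")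
    case True
    then show ?thesis using the1I[OF True] by metis
  next
    case False
    then show ?thesis unfolding the1_def by metis
  qed
  then show ?thesis
    unfolding definable_fun_def
    by (simp only:) (intro definable_intros definable_rename_Suc[of P, OF assms])
qed

definition coll :: "'m \<Rightarrow> ('m \<Rightarrow> bool) \<Rightarrow> 'm" where
  "coll a P = the1 (\<lambda>b. \<forall>x. x \<in>\<^sub>M b \<longleftrightarrow> x \<in>\<^sub>M a \<and> P x)"

lemma definable_coll:
  assumes "definable_fun a" "definable (\<lambda>e. P (e 0) (\<lambda>i. e (Suc i)))"
  shows "definable_fun (\<lambda>e. coll (a e) (\<lambda>x. P x e))"
  unfolding coll_def
  by (intro definable_the1 definable_intros assms(1)[THEN definable_fun_rename]
      definable_rename_Suc[of P, OF assms(2)])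

definition ap :: "'m \<Rightarrow> 'm \<Rightarrow> 'm" where
  "ap f x = the1 (\<lambda>y. opair x y \<in>\<^sub>M f)"

lemma definable_if:
  assumes "definable b" "definable_fun t" "definable_fun u"
  shows "definable_fun (\<lambda>e. if b e then t e else u e)"
proof -
  have eq: "(z = (if c then x else y)) \<longleftrightarrow> (c \<and> z = x) \<or> (\<not> c \<and> z = y)" for z c and x y :: 'm
    by auto
  show ?thesis
    unfolding definable_fun_def eq
    by (intro definable_intros assms(1)[THEN definable_rename]
        assms(2,3)[THEN definable_fun_rename])
qed

end

context ZF_model
begin

lemma mem_extI: "(\<And>x. x \<in>\<^sub>M a \<longleftrightarrow> x \<in>\<^sub>M b) \<Longrightarrow> a = b"
  by (rule extensionality) auto

lemma elts_coll:
  assumes "definable (\<lambda>e. P (e 0))" shows "elts (coll a P) = {x \<in> elts a. P x}"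
proof -
  obtain b where "elts b = {x \<in> elts a. P x}"
    using separation_definable[OF assms] by blast
  then have b: "\<And>x. x \<in>\<^sub>M b \<longleftrightarrow> x \<in>\<^sub>M a \<and> P x" by (auto simp: set_eq_iff)
  have "coll a P = b" unfolding coll_def
  proof (rule the1_equality)
    show "y = b" if "\<forall>x. x \<in>\<^sub>M y \<longleftrightarrow> x \<in>\<^sub>M a \<and> P x" for y
      using that b by (intro mem_extI) blast
  qed (use b in blast)
  then show ?thesis using \<open>elts b = _\<close> by simp
qed

lemma mem_coll [simp]:
  assumes "definable (\<lambda>e. P (e 0))" shows "x \<in>\<^sub>M coll a P \<longleftrightarrow> x \<in>\<^sub>M a \<and> P x"
proof -
  have "x \<in> elts (coll a P) \<longleftrightarrow> x \<in> {x \<in> elts a. P x}" by (simp only: elts_coll[OF assms])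
  then show ?thesis by simp
qed

definition emp :: 'm where "emp = the1 (\<lambda>x. \<forall>y. \<not> y \<in>\<^sub>M x)"
definition upair :: "'m \<Rightarrow> 'm \<Rightarrow> 'm" where
  "upair a b = the1 (\<lambda>c. \<forall>x. x \<in>\<^sub>M c \<longleftrightarrow> x = a \<or> x = b)"
definition UnM :: "'m \<Rightarrow> 'm" where
  "UnM a = the1 (\<lambda>u. \<forall>x. x \<in>\<^sub>M u \<longleftrightarrow> (\<exists>y\<in>elts a. x \<in>\<^sub>M y))"
definition pow :: "'m \<Rightarrow> 'm" where
  "pow a = the1 (\<lambda>p. \<forall>b. b \<in>\<^sub>M p \<longleftrightarrow> (\<forall>x\<in>elts b. x \<in>\<^sub>M a))"
definition succ :: "'m \<Rightarrow> 'm" where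
  "succ n = the1 (\<lambda>s. \<forall>x. x \<in>\<^sub>M s \<longleftrightarrow> x = n \<or> x \<in>\<^sub>M n)"

lemma the1_mem:
  assumes "elts b = {x. P x}" shows "x \<in>\<^sub>M the1 (\<lambda>b. \<forall>x. x \<in>\<^sub>M b \<longleftrightarrow> P x) \<longleftrightarrow> P x"
proof -
  have "the1 (\<lambda>b. \<forall>x. x \<in>\<^sub>M b \<longleftrightarrow> P x) = b"
    using assms by (intro the1_equality) (simp_all add: set_eq_iff mem_extI)
  then show ?thesis using assms by (auto simp: set_eq_iff)
qed

lemma mem_emp [simp]: "\<not> x \<in>\<^sub>M emp"
proof -
  obtain b :: 'm where "elts b = {x \<in> elts undefined. False}"
    using separation_definable[of "\<lambda>_. False" undefined] definable_const by blast
  then show ?thesis unfolding emp_def using the1_mem[of b "\<lambda>_. False"] by simp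
qed

lemma mem_upair [simp]: "x \<in>\<^sub>M upair a b \<longleftrightarrow> x = a \<or> x = b"
proof -
  obtain c where "elts c = {a, b}" using pairing by blast
  then show ?thesis unfolding upair_def by (intro the1_mem[of c]) auto
qed

lemma elts_emp [simp]: "elts emp = {}" and elts_upair [simp]: "elts (upair a b) = {a, b}"
  by auto

lemma mem_UnM [simp]: "x \<in>\<^sub>M UnM a \<longleftrightarrow> (\<exists>y\<in>elts a. x \<in>\<^sub>M y)"
proof -
  obtain c where "elts c = \<Union> (elts ` elts a)" using union by blast
  then show ?thesis unfolding UnM_def by (intro the1_mem[of c]) auto
qed

lemma mem_pow [simp]: "x \<in>\<^sub>M pow a \<longleftrightarrow> elts x \<subseteq> elts a"
proof -
  obtain c where "elts c = {b. elts b \<subseteq> elts a}" using powerset by blast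
  then have "x \<in>\<^sub>M pow a \<longleftrightarrow> (\<forall>y\<in>elts x. y \<in>\<^sub>M a)"
    unfolding pow_def by (intro the1_mem[of c]) auto
  then show ?thesis by auto
qed

lemma mem_succ [simp]: "x \<in>\<^sub>M succ n \<longleftrightarrow> x = n \<or> x \<in>\<^sub>M n"
proof -
  have "elts (UnM (upair (upair n n) n)) = {x. x = n \<or> x \<in>\<^sub>M n}" by (auto simp del: elts_emp)
  then show ?thesis unfolding succ_def by (rule the1_mem)
qed

lemma elts_succ [simp]: "elts (succ n) = insert n (elts n)"
  by auto

lemma definable_upair:
  assumes "definable_fun t" "definable_fun u" shows "definable_fun (\<lambda>e. upair (t e) (u e))"
  unfolding upair_def
  by (intro definable_the1 definable_intros assms[THEN definable_fun_rename])

lemma definable_UnM: assumes "definable_fun t" shows "definable_fun (\<lambda>e. UnM (t e))"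
  unfolding UnM_def
  by (intro definable_the1 definable_intros assms[THEN definable_fun_rename])

lemma definable_pow: assumes "definable_fun t" shows "definable_fun (\<lambda>e. pow (t e))"
  unfolding pow_def
  by (intro definable_the1 definable_intros assms[THEN definable_fun_rename])

lemma definable_succ: assumes "definable_fun t" shows "definable_fun (\<lambda>e. succ (t e))"
  unfolding succ_def
  by (intro definable_the1 definable_intros assms[THEN definable_fun_rename])

text \<open>\<open>opair\<close> is a \<open>THE\<close> over a condition on HOL sets, to which no
  closure rule applies; the Kuratowski form makes it definable.\<close>

lemma opair_eq_upair: "opair a b = upair (upair a a) (upair a b)"
proof -
  have "elts d = {x, y} \<longleftrightarrow> d = upair x y" for d x y
    using extensionality[of d "upair x y"] by (metis elts_upair)
  from this[of _ a a] this[of _ a b] this show ?thesis unfolding opair_def by simp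
qed

lemma upair_eq_iff: "upair a b = upair c d \<longleftrightarrow> (a = c \<and> b = d) \<or> (a = d \<and> b = c)"
proof
  assume eq: "upair a b = upair c d"
  have "x = a \<or> x = b \<longleftrightarrow> x = c \<or> x = d" for x using mem_upair[of x a b] mem_upair[of x c d] eq by simp
  then show "(a = c \<and> b = d) \<or> (a = d \<and> b = c)" by metis
qed (metis mem_upair mem_extI)

lemma opair_eq_iff [simp]: "opair a b = opair c d \<longleftrightarrow> a = c \<and> b = d"
  by (auto simp: opair_eq_upair upair_eq_iff)

lemma definable_opair:
  "definable_fun t \<Longrightarrow> definable_fun u \<Longrightarrow> definable_fun (\<lambda>e. opair (t e) (u e))"
  unfolding opair_eq_upair by (intro definable_upair)

lemma definable_ap:
  assumes "definable_fun t" "definable_fun u" shows "definable_fun (\<lambda>e. ap (t e) (u e))"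
  unfolding ap_def
  by (intro definable_the1 definable_intros definable_opair assms[THEN definable_fun_rename])

lemmas definable_fun_intros =
  definable_if definable_the1 definable_coll definable_upair definable_UnM definable_pow
  definable_succ definable_opair definable_ap

lemma pairs_mem_iff [simp]: "opair x y \<in> pairs A B \<longleftrightarrow> x \<in>\<^sub>M A \<and> y \<in>\<^sub>M B"
  by (auto simp: pairs_def)

text \<open>Inside the domain the value is unique, so the default of \<open>ap\<close> is never
  taken and \<open>ap\<close> agrees with \<open>app\<close>.\<close>

lemma funs_ap:
  assumes "f \<in> funs A B" "x \<in>\<^sub>M A"
  shows "opair x y \<in>\<^sub>M f \<longleftrightarrow> y = ap f x" "ap f x \<in>\<^sub>M B" "app f x = ap f x"
proof -
  have ex1: "\<exists>!y. opair x y \<in>\<^sub>M f" using assms by (auto simp: funs_def)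
  then have mem: "opair x (ap f x) \<in>\<^sub>M f" unfolding ap_def by (rule the1I)
  then show *: "opair x y \<in>\<^sub>M f \<longleftrightarrow> y = ap f x" for y using ex1 by auto
  have "opair x (ap f x) \<in> pairs A B" using mem assms by (auto simp: funs_def)
  then show "ap f x \<in>\<^sub>M B" by simp
  show "app f x = ap f x" unfolding app_def using * by simp
qed

lemma image_definable:
  assumes "definable_fun (\<lambda>e. F (e 0))" shows "\<exists>b. elts b = F ` elts a"
proof -
  have "\<exists>b. elts b = {y. \<exists>x\<in>elts a. y = F x}"
    by (rule replacement_definable)
      (intro definable_eq definable_fun_var assms(1)[THEN definable_fun_rename], auto)
  then show ?thesis by (simp add: image_def)
qed

text \<open>The bridge from definable HOL functions to elements of the model: the graph is the image
  of \<open>A\<close> under x \<mapsto> (x, F x), a set by replacement.\<close>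

lemma funs_definable:
  assumes "definable_fun (\<lambda>e. F (e 0))" "\<And>x. x \<in>\<^sub>M A \<Longrightarrow> F x \<in>\<^sub>M B"
  shows "\<exists>f\<in>funs A B. \<forall>x\<in>elts A. ap f x = F x \<and> app f x = F x"
proof -
  have "definable_fun (\<lambda>e. opair (e 0) (F (e 0)))"
    by (intro definable_opair definable_fun_var assms)
  then obtain f where f: "elts f = (\<lambda>x. opair x (F x)) ` elts A"
    using image_definable[of "\<lambda>x. opair x (F x)" A] by blast
  then have mem: "p \<in>\<^sub>M f \<longleftrightarrow> (\<exists>x. x \<in>\<^sub>M A \<and> p = opair x (F x))" for p
    by (auto simp: set_eq_iff)
  have f_funs: "f \<in> funs A B" unfolding funs_def using assms(2) by (auto simp: mem)
  have "ap f x = F x" if "x \<in>\<^sub>M A" for x using funs_ap(1)[OF f_funs that, of "F x"] that mem by auto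
  with f_funs show ?thesis using funs_ap(3)[OF f_funs] by (intro bexI[of _ f]) simp_all
qed

lemma mem_not_sym: "a \<in>\<^sub>M b \<Longrightarrow> \<not> b \<in>\<^sub>M a"
  using foundation[of "upair a b"] by auto

lemma mem_irrefl [simp]: "\<not> a \<in>\<^sub>M a"
  using mem_not_sym by blast

section \<open>The natural numbers of the model\<close>

lemma is_inductive_iff: "is_inductive w \<longleftrightarrow> emp \<in>\<^sub>M w \<and> (\<forall>n\<in>elts w. succ n \<in>\<^sub>M w)"
proof -
  have "elts z = {} \<longleftrightarrow> z = emp" for z using extensionality[of z emp] by (metis elts_emp elts_upair elts_succ)
  moreover have "elts s = insert n (elts n) \<longleftrightarrow> s = succ n" for s n
    using extensionality[of s "succ n"] by (metis elts_emp elts_upair elts_succ)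
  ultimately show ?thesis unfolding is_inductive_def by auto
qed

definition \<omega> :: 'm where "\<omega> = (THE w. is_omega w)"

text \<open>The intersection of all inductive sets can be cut out of any one of them, which makes it
  an instance of separation.\<close>

lemma is_omega_iff: "is_omega w \<longleftrightarrow> w = \<omega>"
proof -
  obtain v where v: "is_inductive v" using infinity by blast
  have "definable (\<lambda>e. \<forall>u. is_inductive u \<longrightarrow> e 0 \<in>\<^sub>M u)"
    unfolding is_inductive_iff by (intro definable_intros definable_fun_intros)
  then have m: "x \<in>\<^sub>M coll v (\<lambda>x. \<forall>u. is_inductive u \<longrightarrow> x \<in>\<^sub>M u) \<longleftrightarrow>
      x \<in>\<^sub>M v \<and> (\<forall>u. is_inductive u \<longrightarrow> x \<in>\<^sub>M u)" for x by (rule mem_coll)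
  have "is_inductive (coll v (\<lambda>x. \<forall>u. is_inductive u \<longrightarrow> x \<in>\<^sub>M u))"
    unfolding is_inductive_iff[of "coll _ _"] Ball_def mem_elts m
    using v by (auto simp: is_inductive_iff)
  then have "is_omega (coll v (\<lambda>x. \<forall>u. is_inductive u \<longrightarrow> x \<in>\<^sub>M u))"
    by (auto simp: is_omega_def m)
  moreover have "w = u" if "is_omega w" "is_omega u" for w u
    using that by (intro extensionality) (auto simp: is_omega_def)
  ultimately show ?thesis unfolding \<omega>_def by (metis theI)
qed

lemma emp_omega [simp]: "emp \<in>\<^sub>M \<omega>" and succ_omega [simp]: "n \<in>\<^sub>M \<omega> \<Longrightarrow> succ n \<in>\<^sub>M \<omega>"
  using is_omega_iff[of \<omega>] by (auto simp: is_omega_def is_inductive_iff)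

text \<open>Minimality of \<omega> holds only among inductive sets of the model. Definability of
  \<open>P\<close> is what makes its extension such a set, and it is the price of induction on
  possibly non-standard numbers.\<close>

lemma omega_induct [consumes 1, case_names definable emp succ]:
  assumes "n \<in>\<^sub>M \<omega>" "definable (\<lambda>e. P (e 0))" "P emp" "\<And>n. n \<in>\<^sub>M \<omega> \<Longrightarrow> P n \<Longrightarrow> P (succ n)"
  shows "P n"
proof -
  have "is_inductive (coll \<omega> P)" using assms by (auto simp: is_inductive_iff)
  then have "elts \<omega> \<subseteq> elts (coll \<omega> P)" using is_omega_iff[of \<omega>] by (auto simp: is_omega_def)
  then show ?thesis using assms by auto
qed

lemma omega_trans: assumes "n \<in>\<^sub>M \<omega>" shows "m \<in>\<^sub>M n \<Longrightarrow> m \<in>\<^sub>M \<omega>"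
proof -
  have "\<forall>m\<in>elts n. m \<in>\<^sub>M \<omega>" using assms
    by (induction rule: omega_induct) (intro definable_intros, auto)
  then show "m \<in>\<^sub>M n \<Longrightarrow> m \<in>\<^sub>M \<omega>" by simp
qed

lemma omega_mem_trans: assumes "n \<in>\<^sub>M \<omega>" shows "k \<in>\<^sub>M m \<Longrightarrow> m \<in>\<^sub>M n \<Longrightarrow> k \<in>\<^sub>M n"
proof -
  have "\<forall>m\<in>elts n. \<forall>k\<in>elts m. k \<in>\<^sub>M n" using assms
    by (induction rule: omega_induct) (intro definable_intros, auto)
  then show "k \<in>\<^sub>M m \<Longrightarrow> m \<in>\<^sub>M n \<Longrightarrow> k \<in>\<^sub>M n" by auto
qed

lemma omega_emp_or_mem: assumes "n \<in>\<^sub>M \<omega>" shows "n = emp \<or> emp \<in>\<^sub>M n"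
  using assms by (induction rule: omega_induct) (intro definable_intros, auto)

lemma omega_succ_mem: assumes "n \<in>\<^sub>M \<omega>" shows "m \<in>\<^sub>M n \<Longrightarrow> succ m = n \<or> succ m \<in>\<^sub>M n"
proof -
  have "\<forall>m\<in>elts n. succ m = n \<or> succ m \<in>\<^sub>M n" using assms
    by (induction rule: omega_induct) (intro definable_intros definable_fun_intros, auto)
  then show "m \<in>\<^sub>M n \<Longrightarrow> succ m = n \<or> succ m \<in>\<^sub>M n" by auto
qed

lemma omega_linear:
  assumes "m \<in>\<^sub>M \<omega>" "n \<in>\<^sub>M \<omega>" shows "m \<in>\<^sub>M n \<or> m = n \<or> n \<in>\<^sub>M m"
  using assms(1)
proof (induction rule: omega_induct)
  case definable
  show ?case by (intro definable_intros)
next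
  case emp
  show ?case using omega_emp_or_mem[OF assms(2)] by auto
next
  case (succ m)
  then show ?case using omega_succ_mem[OF assms(2), of m] by auto
qed

text \<open>The order of \<omega> is membership, so a membership-minimal element from foundation is
  a least one.\<close>

lemma omega_least:
  assumes "definable (\<lambda>e. P (e 0))" "n \<in>\<^sub>M \<omega>" "P n"
  obtains m where "m \<in>\<^sub>M \<omega>" "P m" "\<And>k. k \<in>\<^sub>M m \<Longrightarrow> \<not> P k"
proof -
  have "elts (coll \<omega> P) \<noteq> {}" using assms by auto
  then obtain m where "m \<in>\<^sub>M coll \<omega> P" "elts m \<inter> elts (coll \<omega> P) = {}"
    using foundation[of "coll \<omega> P"] by auto
  then show ?thesis using that[of m] assms(1) omega_trans[of m] by (auto simp: disjoint_iff)
qed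

lemma succ_inject: "succ m = succ n \<Longrightarrow> m = n"
  using mem_succ[of m m] mem_succ[of n n] mem_not_sym[of m n] by (metis mem_succ)

lemma succ_neq_emp [simp]: "succ n \<noteq> emp" "emp \<noteq> succ n"
  using mem_succ[of n n] by (metis mem_emp)+

lemma definable_comp:
  "definable (\<lambda>e. P (e 0)) \<Longrightarrow> definable_fun t \<Longrightarrow> definable (\<lambda>e. P (t e))"
  by (rule definable_subst)

lemma definable_fun_comp:
  assumes "definable_fun (\<lambda>e. h (e 0))" "definable_fun t" shows "definable_fun (\<lambda>e. h (t e))"
proof -
  have "definable (\<lambda>e. e 0 = h (e (Suc 0)))" using assms(1) by (simp add: definable_fun_def)
  from definable_rename[OF this, of "case_nat (Suc 0) (\<lambda>_. 0)"]
  have h: "definable (\<lambda>e. e (Suc 0) = h (e 0))" by simp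
  have "definable (\<lambda>e. \<exists>x. x = t (\<lambda>i. e (Suc i)) \<and> e 0 = h x)"
    by (rule definable_ex, rule definable_conj[OF _ h])
      (intro definable_eq definable_fun_var definable_fun_rename[OF assms(2)])
  then show ?thesis by (simp add: definable_fun_def)
qed

text \<open>Kuratowski pairs over \<open>A\<close> and \<open>B\<close> lie in the double power set
  of the union of \<open>A\<close> and \<open>B\<close>, which bounds the separation.\<close>

definition cprod :: "'m \<Rightarrow> 'm \<Rightarrow> 'm" where
  "cprod A B = coll (pow (pow (UnM (upair A B)))) (\<lambda>p. \<exists>x\<in>elts A. \<exists>y\<in>elts B. p = opair x y)"

lemma elts_cprod: "elts (cprod A B) = pairs A B"
proof -
  have "definable (\<lambda>e. \<exists>x\<in>elts A. \<exists>y\<in>elts B. e 0 = opair x y)"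
    by (intro definable_intros definable_fun_intros)
  from mem_coll[OF this] have "p \<in>\<^sub>M cprod A B \<longleftrightarrow>
      p \<in>\<^sub>M pow (pow (UnM (upair A B))) \<and> (\<exists>x\<in>elts A. \<exists>y\<in>elts B. p = opair x y)" for p
    unfolding cprod_def .
  moreover have "opair x y \<in>\<^sub>M pow (pow (UnM (upair A B)))" if "x \<in>\<^sub>M A" "y \<in>\<^sub>M B" for x y
    using that by (simp add: opair_eq_upair)
  ultimately show ?thesis by (auto simp: pairs_def)
qed

text \<open>Iteration in HOL would not reach non-standard n. The graph is instead the least relation
  between \<omega> and \<open>K\<close> that is closed under the step, and it is functional because
  a surplus pair could be removed without destroying closure.\<close>

lemma omega_recursion:
  assumes t: "definable_fun (\<lambda>e. t (e 0))" and tK: "\<And>x. x \<in>\<^sub>M K \<Longrightarrow> t x \<in>\<^sub>M K" and a: "a \<in>\<^sub>M K"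
  obtains \<nu> where "definable_fun (\<lambda>e. \<nu> (e 0))" "\<nu> emp = a"
    "\<And>n. n \<in>\<^sub>M \<omega> \<Longrightarrow> \<nu> (succ n) = t (\<nu> n)" "\<And>n. n \<in>\<^sub>M \<omega> \<Longrightarrow> \<nu> n \<in>\<^sub>M K"
proof -
  define cl where "cl S \<longleftrightarrow> opair emp a \<in>\<^sub>M S \<and>
    (\<forall>n\<in>elts \<omega>. \<forall>x\<in>elts K. opair n x \<in>\<^sub>M S \<longrightarrow> opair (succ n) (t x) \<in>\<^sub>M S)" for S
  define G where "G = coll (cprod \<omega> K) (\<lambda>p. \<forall>S. cl S \<longrightarrow> p \<in>\<^sub>M S)"
  have "definable (\<lambda>e. \<forall>S. cl S \<longrightarrow> e 0 \<in>\<^sub>M S)"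
    unfolding cl_def by (intro definable_intros definable_fun_intros definable_fun_comp[OF t])
  then have G: "p \<in>\<^sub>M G \<longleftrightarrow> p \<in> pairs \<omega> K \<and> (\<forall>S. cl S \<longrightarrow> p \<in>\<^sub>M S)" for p
    unfolding G_def by (simp flip: elts_cprod)
  have clG: "cl G" unfolding cl_def using a tK by (auto simp: G) (auto simp: cl_def)
  have G0: "opair emp a \<in>\<^sub>M G" using clG by (simp add: cl_def)
  have GS: "opair (succ n) (t x) \<in>\<^sub>M G" if "opair n x \<in>\<^sub>M G" for n x
    using clG that G[of "opair n x"] by (auto simp: cl_def)
  \<comment> \<open>Each closed relation contains \<open>G\<close>, so what remains of
    \<open>G\<close> after removing one of its pairs cannot be closed.\<close>
  have minimal: "\<not> cl (coll G (\<lambda>p. p \<noteq> q))" if "q \<in>\<^sub>M G" for q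
  proof
    assume "cl (coll G (\<lambda>p. p \<noteq> q))"
    then have "q \<in>\<^sub>M coll G (\<lambda>p. p \<noteq> q)" using that by (auto simp: G)
    then show False by (subst (asm) mem_coll) (intro definable_intros, simp)
  qed
  have rem: "p \<in>\<^sub>M coll G (\<lambda>p. p \<noteq> q) \<longleftrightarrow> p \<in>\<^sub>M G \<and> p \<noteq> q" for p q
    by (rule mem_coll) (intro definable_intros)
  have unique: "\<exists>!x. opair n x \<in>\<^sub>M G" if "n \<in>\<^sub>M \<omega>" for n
  proof -
    have "\<exists>x. opair n x \<in>\<^sub>M G \<and> (\<forall>y. opair n y \<in>\<^sub>M G \<longrightarrow> y = x)" using that
    proof (induction rule: omega_induct)
      case definable
      show ?case by (intro definable_intros definable_fun_intros)
    next
      case emp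
      have "y = a" if "opair emp y \<in>\<^sub>M G" for y
        using minimal[OF that] G0 GS by (auto simp: cl_def rem)
      then show ?case using G0 by auto
    next
      case (succ n)
      then obtain x where x: "opair n x \<in>\<^sub>M G" "\<And>y. opair n y \<in>\<^sub>M G \<Longrightarrow> y = x" by blast
      have "y = t x" if "opair (succ n) y \<in>\<^sub>M G" for y
        using minimal[OF that] G0 GS x(2) by (auto simp: cl_def rem dest!: succ_inject)
      then show ?case using GS[OF x(1)] by auto
    qed
    then show ?thesis by auto
  qed
  have ap: "opair n (ap G n) \<in>\<^sub>M G" if "n \<in>\<^sub>M \<omega>" for n
    unfolding ap_def by (rule the1I[OF unique[OF that]])
  have eq: "ap G n = x" if "opair n x \<in>\<^sub>M G" for n x
    using unique[of n] ap[of n] that by (auto simp: G)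
  have K: "ap G n \<in>\<^sub>M K" if "n \<in>\<^sub>M \<omega>" for n using ap[OF that] by (auto simp: G)
  show ?thesis
  proof
    show "definable_fun (\<lambda>e. ap G (e 0))" by (intro definable_intros definable_fun_intros)
    show "ap G emp = a" by (rule eq[OF G0])
    show "ap G (succ n) = t (ap G n)" if "n \<in>\<^sub>M \<omega>" for n
      by (rule eq[OF GS[OF ap[OF that]]])
  qed (rule K)
qed

section \<open>Finite and countable sets of the model\<close>

text \<open>Equipotence has to be witnessed by an element of the model, so a HOL bijection counts
  only if it is definable.\<close>

lemma equipotentI:
  assumes "definable_fun (\<lambda>e. h (e 0))" "bij_betw h (elts A) (elts B)"
  shows "equipotent A B"
proof -
  obtain f where f: "f \<in> funs A B" "\<And>x. x \<in>\<^sub>M A \<Longrightarrow> app f x = h x"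
    using funs_definable[OF assms(1), of A B] bij_betwE[OF assms(2)] by auto
  then have "bij_betw (app f) (elts A) (elts B)" using assms(2) by (subst bij_betw_cong) auto
  then show ?thesis using f by (auto simp: equipotent_def)
qed

lemma equipotentE:
  assumes "equipotent A B"
  obtains h where "definable_fun (\<lambda>e. h (e 0))" "bij_betw h (elts A) (elts B)"
proof -
  obtain f where f: "f \<in> funs A B" "bij_betw (app f) (elts A) (elts B)"
    using assms by (auto simp: equipotent_def)
  have "bij_betw (ap f) (elts A) (elts B)"
    using f(2) funs_ap(3)[OF f(1)] by (subst bij_betw_cong[where g = "app f"]) auto
  moreover have "definable_fun (\<lambda>e. ap f (e 0))" by (intro definable_intros definable_fun_intros)
  ultimately show ?thesis using that by blast
qed

lemma countableI:
  assumes "definable_fun (\<lambda>e. h (e 0))" "inj_on h (elts A)" "\<And>a. a \<in>\<^sub>M A \<Longrightarrow> h a \<in>\<^sub>M \<omega>"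
  shows "countable_set A"
proof -
  obtain B where B: "elts B = h ` elts A" using image_definable[OF assms(1)] by blast
  then have "equipotent A B" using assms by (intro equipotentI) (auto simp: bij_betw_def)
  then show ?thesis unfolding countable_set_def is_omega_iff
    using B assms(3) by (intro exI[of _ \<omega>] exI[of _ B]) auto
qed

lemma countableE:
  assumes "countable_set A"
  obtains h where "definable_fun (\<lambda>e. h (e 0))" "inj_on h (elts A)" "\<And>a. a \<in>\<^sub>M A \<Longrightarrow> h a \<in>\<^sub>M \<omega>"
proof -
  obtain B where B: "elts B \<subseteq> elts \<omega>" "equipotent A B"
    using assms by (auto simp: countable_set_def is_omega_iff)
  then show ?thesis
    using that equipotentE[OF B(2)] by (metis bij_betwE bij_betw_imp_inj_on mem_elts subsetD)
qed

lemma countable_subset: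
  assumes "countable_set A" "elts B \<subseteq> elts A" shows "countable_set B"
  using assms(2) by (rule_tac countableE[OF assms(1)], rule_tac countableI) (auto intro: inj_on_subset)

lemma finiteE:
  assumes "finite_set A"
  obtains n h where "n \<in>\<^sub>M \<omega>" "definable_fun (\<lambda>e. h (e 0))" "inj_on h (elts A)"
    "\<And>a. a \<in>\<^sub>M A \<Longrightarrow> h a \<in>\<^sub>M n"
proof -
  obtain n where n: "n \<in>\<^sub>M \<omega>" "equipotent A n"
    using assms by (auto simp: finite_set_def is_omega_iff)
  then show ?thesis
    using that equipotentE[OF n(2)] by (metis bij_betwE bij_betw_imp_inj_on mem_elts)
qed

text \<open>Sending each value to its least index is a definable injection into \<omega>, so nothing
  has to be chosen from the fibres.\<close>

lemma countable_image_omega: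
  assumes F: "definable_fun (\<lambda>e. F (e 0))" and A: "elts A = F ` elts \<omega>"
  shows "countable_set A"
proof -
  define h where "h a = the1 (\<lambda>n. n \<in>\<^sub>M \<omega> \<and> F n = a \<and> (\<forall>m\<in>elts n. F m \<noteq> a))" for a
  have h: "h a \<in>\<^sub>M \<omega> \<and> F (h a) = a \<and> (\<forall>m\<in>elts (h a). F m \<noteq> a)" if "a \<in>\<^sub>M A" for a
    unfolding h_def
  proof (rule the1I, rule ex_ex1I)
    have "a \<in> F ` elts \<omega>" using that A by auto
    then obtain n where n: "n \<in>\<^sub>M \<omega>" "F n = a" by auto
    have "definable (\<lambda>e. F (e 0) = a)" by (intro definable_intros F)
    from omega_least[OF this n]
    show "\<exists>n. n \<in>\<^sub>M \<omega> \<and> F n = a \<and> (\<forall>m\<in>elts n. F m \<noteq> a)" by (metis mem_elts)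
  qed (use omega_linear in force)
  show ?thesis
  proof (rule countableI)
    show "definable_fun (\<lambda>e. h (e 0))"
      unfolding h_def by (intro definable_intros definable_fun_intros definable_fun_comp[OF F])
    show "inj_on h (elts A)" using h by (metis inj_onI mem_elts)
  qed (use h in blast)
qed

text \<open>The pigeonhole principle inside the model. The quantified \<open>f\<close> ranges over
  elements of the model, so that the induction statement is first-order.\<close>

lemma omega_no_injection:
  assumes "n \<in>\<^sub>M \<omega>"
  shows "\<not> (\<exists>f. (\<forall>i\<in>elts \<omega>. ap f i \<in>\<^sub>M n) \<and>
    (\<forall>i\<in>elts \<omega>. \<forall>j\<in>elts \<omega>. ap f i = ap f j \<longrightarrow> i = j))"
  using assms
proof (induction rule: omega_induct)
  case definable
  show ?case by (intro definable_intros definable_fun_intros)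
next
  case emp
  have "\<not> ap f emp \<in>\<^sub>M emp" for f by simp
  then show ?case using emp_omega by (metis mem_elts)
next
  case (succ n)
  show ?case
  proof (rule notI, elim exE conjE)
    fix f
    assume f: "\<forall>i\<in>elts \<omega>. ap f i \<in>\<^sub>M succ n"
      and inj: "\<forall>i\<in>elts \<omega>. \<forall>j\<in>elts \<omega>. ap f i = ap f j \<longrightarrow> i = j"
    \<comment> \<open>Index \<open>emp\<close> is dropped and its value handed to the index that
      \<open>f\<close> maps to n, if any; by injectivity that value differs from n.\<close>
    define F where "F i = (if ap f (succ i) = n then ap f emp else ap f (succ i))" for i
    have mem: "F i \<in>\<^sub>M n" if "i \<in>\<^sub>M \<omega>" for i
      using f[rule_format, of emp] f[rule_format, of "succ i"] inj[rule_format, of emp "succ i"] that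
      by (auto simp: F_def)
    have "definable_fun (\<lambda>e. F (e 0))"
      unfolding F_def by (intro definable_intros definable_fun_intros)
    then obtain g where g: "\<forall>i\<in>elts \<omega>. ap g i = F i"
      using funs_definable[of F \<omega> n, OF _ mem] by blast
    have F_inj: "i = j" if "i \<in>\<^sub>M \<omega>" "j \<in>\<^sub>M \<omega>" "F i = F j" for i j
      using that inj[rule_format, of emp "succ i"] inj[rule_format, of emp "succ j"]
        inj[rule_format, of "succ i" "succ j"]
      by (auto simp: F_def dest: succ_inject split: if_splits)
    have "(\<forall>i\<in>elts \<omega>. ap g i \<in>\<^sub>M n) \<and>
        (\<forall>i\<in>elts \<omega>. \<forall>j\<in>elts \<omega>. ap g i = ap g j \<longrightarrow> i = j)"
      using g mem F_inj by simp
    then show False using succ.IH by blast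
  qed
qed

text \<open>Allows \<open>CMC\<close> to be applied to families indexed by \<omega>.\<close>

lemma denumerable_omega: "denumerable_set \<omega>"
proof -
  have "\<not> finite_set \<omega>"
  proof
    assume "finite_set \<omega>"
    then obtain n h where h: "n \<in>\<^sub>M \<omega>" "definable_fun (\<lambda>e. h (e 0))" "inj_on h (elts \<omega>)"
      "\<And>a. a \<in>\<^sub>M \<omega> \<Longrightarrow> h a \<in>\<^sub>M n" by (rule finiteE) blast
    obtain g where "\<forall>i\<in>elts \<omega>. ap g i = h i" using funs_definable[OF h(2,4)] by blast
    then have "(\<forall>i\<in>elts \<omega>. ap g i \<in>\<^sub>M n) \<and>
        (\<forall>i\<in>elts \<omega>. \<forall>j\<in>elts \<omega>. ap g i = ap g j \<longrightarrow> i = j)"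
      using h(3,4) by (auto simp: inj_on_def)
    then show False using omega_no_injection[OF h(1)] by blast
  qed
  moreover have "countable_set \<omega>"
    by (rule countableI[of "\<lambda>x. x"]) (auto intro: definable_intros)
  ultimately show ?thesis by (simp add: denumerable_set_def)
qed

end

section \<open>Arithmetic of the real line of the model\<close>

locale real_line_model = ZF_model E for E :: "'m \<Rightarrow> 'm \<Rightarrow> bool"  (infix \<open>\<in>\<^sub>M\<close> 50) +
  fixes R :: "'m field_data"
  assumes real_line: "real_line R"
begin

abbreviation K where "K \<equiv> rcar R"
abbreviation zero_R (\<open>\<zero>\<close>) where "\<zero> \<equiv> rzero R"
abbreviation one_R (\<open>\<one>\<close>) where "\<one> \<equiv> rone R"
abbreviation le_R (infix \<open>\<preceq>\<close> 50) where "x \<preceq> y \<equiv> le R x y"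
abbreviation less_R (infix \<open>\<prec>\<close> 50) where "x \<prec> y \<equiv> less R x y"
text \<open>The given operations rest on \<open>app\<close>, a bare \<open>THE\<close>. The versions
  built from \<open>ap\<close> and \<open>the1\<close> are definable and agree with them where they
  are meaningful.\<close>

definition plus_R (infixl \<open>\<oplus>\<close> 65) where "x \<oplus> y = ap (radd R) (opair x y)"
definition times_R (infixl \<open>\<otimes>\<close> 70) where "x \<otimes> y = ap (rmul R) (opair x y)"
definition uminus_R (\<open>\<ominus> _\<close> [81] 80) where "\<ominus> x = the1 (\<lambda>y. y \<in>\<^sub>M K \<and> x \<oplus> y = \<zero>)"
definition inverse_R where "inverse_R x = the1 (\<lambda>y. y \<in>\<^sub>M K \<and> x \<otimes> y = \<one>)"
definition half where "half x = the1 (\<lambda>y. y \<in>\<^sub>M K \<and> y \<oplus> y = x)"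

lemma ordered_field: "ordered_field R"
  using real_line by (simp add: real_line_def)

lemma definable_plus:
  "definable_fun t \<Longrightarrow> definable_fun u \<Longrightarrow> definable_fun (\<lambda>e. t e \<oplus> u e)"
  unfolding plus_R_def by (intro definable_intros definable_fun_intros)

lemma definable_times:
  "definable_fun t \<Longrightarrow> definable_fun u \<Longrightarrow> definable_fun (\<lambda>e. t e \<otimes> u e)"
  unfolding times_R_def by (intro definable_intros definable_fun_intros)

lemma definable_le: "definable_fun t \<Longrightarrow> definable_fun u \<Longrightarrow> definable (\<lambda>e. t e \<preceq> u e)"
  unfolding le_def by (intro definable_intros definable_fun_intros)

lemma definable_less: "definable_fun t \<Longrightarrow> definable_fun u \<Longrightarrow> definable (\<lambda>e. t e \<prec> u e)"
  unfolding less_def by (intro definable_intros definable_le)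

lemma definable_uminus: assumes "definable_fun t" shows "definable_fun (\<lambda>e. \<ominus> (t e))"
  unfolding uminus_R_def
  by (intro definable_intros definable_fun_intros definable_plus assms[THEN definable_fun_rename])

lemma definable_inverse: assumes "definable_fun t" shows "definable_fun (\<lambda>e. inverse_R (t e))"
  unfolding inverse_R_def
  by (intro definable_intros definable_fun_intros definable_times assms[THEN definable_fun_rename])

lemma definable_half: assumes "definable_fun t" shows "definable_fun (\<lambda>e. half (t e))"
  unfolding half_def
  by (intro definable_intros definable_fun_intros definable_plus assms[THEN definable_fun_rename])

lemmas definable_R_intros =
  definable_intros definable_fun_intros definable_plus definable_times definable_le definable_less
  definable_uminus definable_inverse definable_half

lemma add_eq_plus: "x \<in>\<^sub>M K \<Longrightarrow> y \<in>\<^sub>M K \<Longrightarrow> add R x y = x \<oplus> y"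
  and mul_eq_times: "x \<in>\<^sub>M K \<Longrightarrow> y \<in>\<^sub>M K \<Longrightarrow> mul R x y = x \<otimes> y"
  and plus_closed [simp]: "x \<in>\<^sub>M K \<Longrightarrow> y \<in>\<^sub>M K \<Longrightarrow> x \<oplus> y \<in>\<^sub>M K"
  and times_closed [simp]: "x \<in>\<^sub>M K \<Longrightarrow> y \<in>\<^sub>M K \<Longrightarrow> x \<otimes> y \<in>\<^sub>M K"
proof -
  obtain P where P: "elts P = pairs K K" "radd R \<in> funs P K" "rmul R \<in> funs P K"
    using ordered_field[unfolded ordered_field_def Let_def, THEN conjunct1] by (elim exE conjE)
  have "opair x y \<in>\<^sub>M P" if "x \<in>\<^sub>M K" "y \<in>\<^sub>M K" for x y
    using that by (simp add: P(1) flip: mem_elts)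
  note this[THEN funs_ap(2)[OF P(2)]] this[THEN funs_ap(3)[OF P(2)]]
    this[THEN funs_ap(2)[OF P(3)]] this[THEN funs_ap(3)[OF P(3)]]
  then show "x \<in>\<^sub>M K \<Longrightarrow> y \<in>\<^sub>M K \<Longrightarrow> add R x y = x \<oplus> y" "x \<in>\<^sub>M K \<Longrightarrow> y \<in>\<^sub>M K \<Longrightarrow> mul R x y = x \<otimes> y"
    "x \<in>\<^sub>M K \<Longrightarrow> y \<in>\<^sub>M K \<Longrightarrow> x \<oplus> y \<in>\<^sub>M K" "x \<in>\<^sub>M K \<Longrightarrow> y \<in>\<^sub>M K \<Longrightarrow> x \<otimes> y \<in>\<^sub>M K"
    by (simp_all add: add_def mul_def plus_R_def times_R_def)
qed

lemma zero_closed [simp]: "\<zero> \<in>\<^sub>M K" and one_closed [simp]: "\<one> \<in>\<^sub>M K"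
  and zero_neq_one [simp]: "\<zero> \<noteq> \<one>"
  using ordered_field unfolding ordered_field_def Let_def mem_elts by - (elim conjE, assumption)+

lemma field_axioms_R:
  "\<forall>x\<in>elts K. \<forall>y\<in>elts K. add R x y = add R y x"
  "\<forall>x\<in>elts K. \<forall>y\<in>elts K. mul R x y = mul R y x"
  "\<forall>x\<in>elts K. \<forall>y\<in>elts K. \<forall>t\<in>elts K. add R (add R x y) t = add R x (add R y t)"
  "\<forall>x\<in>elts K. \<forall>y\<in>elts K. \<forall>t\<in>elts K. mul R (mul R x y) t = mul R x (mul R y t)"
  "\<forall>x\<in>elts K. \<forall>y\<in>elts K. \<forall>t\<in>elts K. mul R x (add R y t) = add R (mul R x y) (mul R x t)"
  "\<forall>x\<in>elts K. add R x \<zero> = x"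
  "\<forall>x\<in>elts K. mul R x \<one> = x"
  "\<forall>x\<in>elts K. \<exists>y\<in>elts K. add R x y = \<zero>"
  "\<forall>x\<in>elts K. x \<noteq> \<zero> \<longrightarrow> (\<exists>y\<in>elts K. mul R x y = \<one>)"
  "\<forall>x\<in>elts K. x \<preceq> x"
  "\<forall>x\<in>elts K. \<forall>y\<in>elts K. x \<preceq> y \<and> y \<preceq> x \<longrightarrow> x = y"
  "\<forall>x\<in>elts K. \<forall>y\<in>elts K. \<forall>t\<in>elts K. x \<preceq> y \<and> y \<preceq> t \<longrightarrow> x \<preceq> t"
  "\<forall>x\<in>elts K. \<forall>y\<in>elts K. x \<preceq> y \<or> y \<preceq> x"
  "\<forall>x\<in>elts K. \<forall>y\<in>elts K. \<forall>t\<in>elts K. x \<preceq> y \<longrightarrow> add R x t \<preceq> add R y t"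
  "\<forall>x\<in>elts K. \<forall>y\<in>elts K. \<zero> \<preceq> x \<and> \<zero> \<preceq> y \<longrightarrow> \<zero> \<preceq> mul R x y"
  using ordered_field unfolding ordered_field_def Let_def by - (elim conjE, assumption)+

lemma plus_comm: "x \<in>\<^sub>M K \<Longrightarrow> y \<in>\<^sub>M K \<Longrightarrow> x \<oplus> y = y \<oplus> x"
  and times_comm: "x \<in>\<^sub>M K \<Longrightarrow> y \<in>\<^sub>M K \<Longrightarrow> x \<otimes> y = y \<otimes> x"
  and plus_assoc: "x \<in>\<^sub>M K \<Longrightarrow> y \<in>\<^sub>M K \<Longrightarrow> t \<in>\<^sub>M K \<Longrightarrow> x \<oplus> y \<oplus> t = x \<oplus> (y \<oplus> t)"
  and times_assoc: "x \<in>\<^sub>M K \<Longrightarrow> y \<in>\<^sub>M K \<Longrightarrow> t \<in>\<^sub>M K \<Longrightarrow> x \<otimes> y \<otimes> t = x \<otimes> (y \<otimes> t)"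
  and distrib: "x \<in>\<^sub>M K \<Longrightarrow> y \<in>\<^sub>M K \<Longrightarrow> t \<in>\<^sub>M K \<Longrightarrow> x \<otimes> (y \<oplus> t) = x \<otimes> y \<oplus> x \<otimes> t"
  and plus_zero [simp]: "x \<in>\<^sub>M K \<Longrightarrow> x \<oplus> \<zero> = x"
  and times_one [simp]: "x \<in>\<^sub>M K \<Longrightarrow> x \<otimes> \<one> = x"
  and ex_uminus: "x \<in>\<^sub>M K \<Longrightarrow> \<exists>y\<in>elts K. x \<oplus> y = \<zero>"
  and ex_inverse: "x \<in>\<^sub>M K \<Longrightarrow> x \<noteq> \<zero> \<Longrightarrow> \<exists>y\<in>elts K. x \<otimes> y = \<one>"
  and le_refl [simp]: "x \<in>\<^sub>M K \<Longrightarrow> x \<preceq> x"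
  and le_antisym: "x \<preceq> y \<Longrightarrow> y \<preceq> x \<Longrightarrow> x \<in>\<^sub>M K \<Longrightarrow> y \<in>\<^sub>M K \<Longrightarrow> x = y"
  and le_trans: "x \<preceq> y \<Longrightarrow> y \<preceq> t \<Longrightarrow> x \<in>\<^sub>M K \<Longrightarrow> y \<in>\<^sub>M K \<Longrightarrow> t \<in>\<^sub>M K \<Longrightarrow> x \<preceq> t"
  and le_total: "x \<in>\<^sub>M K \<Longrightarrow> y \<in>\<^sub>M K \<Longrightarrow> x \<preceq> y \<or> y \<preceq> x"
  and plus_le_mono1: "x \<preceq> y \<Longrightarrow> x \<in>\<^sub>M K \<Longrightarrow> y \<in>\<^sub>M K \<Longrightarrow> t \<in>\<^sub>M K \<Longrightarrow> x \<oplus> t \<preceq> y \<oplus> t"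
  and times_nonneg: "\<zero> \<preceq> x \<Longrightarrow> \<zero> \<preceq> y \<Longrightarrow> x \<in>\<^sub>M K \<Longrightarrow> y \<in>\<^sub>M K \<Longrightarrow> \<zero> \<preceq> x \<otimes> y"
  subgoal using field_axioms_R(1)[THEN bspec, of x, THEN bspec, of y] by (auto simp: add_eq_plus mul_eq_times)
  subgoal using field_axioms_R(2)[THEN bspec, of x, THEN bspec, of y] by (auto simp: add_eq_plus mul_eq_times)
  subgoal using field_axioms_R(3)[THEN bspec, of x, THEN bspec, of y, THEN bspec, of t] by (auto simp: add_eq_plus mul_eq_times)
  subgoal using field_axioms_R(4)[THEN bspec, of x, THEN bspec, of y, THEN bspec, of t] by (auto simp: add_eq_plus mul_eq_times)
  subgoal using field_axioms_R(5)[THEN bspec, of x, THEN bspec, of y, THEN bspec, of t] by (auto simp: add_eq_plus mul_eq_times)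
  subgoal using field_axioms_R(6)[THEN bspec, of x] by (auto simp: add_eq_plus mul_eq_times)
  subgoal using field_axioms_R(7)[THEN bspec, of x] by (auto simp: add_eq_plus mul_eq_times)
  subgoal using field_axioms_R(8)[THEN bspec, of x] by (auto simp: add_eq_plus mul_eq_times)
  subgoal using field_axioms_R(9)[THEN bspec, of x] by (auto simp: add_eq_plus mul_eq_times)
  subgoal using field_axioms_R(10)[THEN bspec, of x] by (auto simp: add_eq_plus mul_eq_times)
  subgoal using field_axioms_R(11)[THEN bspec, of x, THEN bspec, of y] by (auto simp: add_eq_plus mul_eq_times)
  subgoal using field_axioms_R(12)[THEN bspec, of x, THEN bspec, of y, THEN bspec, of t] by (auto simp: add_eq_plus mul_eq_times)
  subgoal using field_axioms_R(13)[THEN bspec, of x, THEN bspec, of y] by (auto simp: add_eq_plus mul_eq_times)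
  subgoal using field_axioms_R(14)[THEN bspec, of x, THEN bspec, of y, THEN bspec, of t] by (auto simp: add_eq_plus mul_eq_times)
  subgoal using field_axioms_R(15)[THEN bspec, of x, THEN bspec, of y] by (auto simp: add_eq_plus mul_eq_times)
  done

section \<open>Consequences of the ordered field axioms\<close>

lemma zero_plus [simp]: "x \<in>\<^sub>M K \<Longrightarrow> \<zero> \<oplus> x = x"
  by (simp add: plus_comm[of \<zero>])

lemma plus_left_comm:
  "x \<in>\<^sub>M K \<Longrightarrow> y \<in>\<^sub>M K \<Longrightarrow> t \<in>\<^sub>M K \<Longrightarrow> x \<oplus> (y \<oplus> t) = y \<oplus> (x \<oplus> t)"
  by (metis plus_assoc plus_comm)

lemmas plus_ac = plus_assoc plus_comm plus_left_comm

lemma plus_right_cancel [simp]: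
  assumes "x \<in>\<^sub>M K" "y \<in>\<^sub>M K" "t \<in>\<^sub>M K" shows "x \<oplus> t = y \<oplus> t \<longleftrightarrow> x = y"
proof -
  obtain s where s: "s \<in>\<^sub>M K" "t \<oplus> s = \<zero>" using ex_uminus[OF assms(3)] by auto
  have "x \<oplus> t \<oplus> s = x" "y \<oplus> t \<oplus> s = y" using s assms by (simp_all add: plus_assoc)
  then show ?thesis by metis
qed

lemma plus_left_cancel [simp]:
  "x \<in>\<^sub>M K \<Longrightarrow> y \<in>\<^sub>M K \<Longrightarrow> t \<in>\<^sub>M K \<Longrightarrow> t \<oplus> x = t \<oplus> y \<longleftrightarrow> x = y"
  by (simp add: plus_comm[of t])

lemma plus_le_right_cancel [simp]:
  assumes "x \<in>\<^sub>M K" "y \<in>\<^sub>M K" "t \<in>\<^sub>M K" shows "x \<oplus> t \<preceq> y \<oplus> t \<longleftrightarrow> x \<preceq> y"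
proof -
  obtain s where s: "s \<in>\<^sub>M K" "t \<oplus> s = \<zero>" using ex_uminus[OF assms(3)] by auto
  have "x \<oplus> t \<oplus> s = x" "y \<oplus> t \<oplus> s = y" using s assms by (simp_all add: plus_assoc)
  then show ?thesis using assms s by (metis plus_le_mono1 plus_closed)
qed

lemma plus_le_left_cancel [simp]:
  "x \<in>\<^sub>M K \<Longrightarrow> y \<in>\<^sub>M K \<Longrightarrow> t \<in>\<^sub>M K \<Longrightarrow> t \<oplus> x \<preceq> t \<oplus> y \<longleftrightarrow> x \<preceq> y"
  by (simp add: plus_comm[of t])

lemma plus_less_cancel [simp]:
  "x \<in>\<^sub>M K \<Longrightarrow> y \<in>\<^sub>M K \<Longrightarrow> t \<in>\<^sub>M K \<Longrightarrow> x \<oplus> t \<prec> y \<oplus> t \<longleftrightarrow> x \<prec> y"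
  "x \<in>\<^sub>M K \<Longrightarrow> y \<in>\<^sub>M K \<Longrightarrow> t \<in>\<^sub>M K \<Longrightarrow> t \<oplus> x \<prec> t \<oplus> y \<longleftrightarrow> x \<prec> y"
  by (simp_all add: less_def)

lemma less_irrefl [simp]: "\<not> x \<prec> x"
  by (simp add: less_def)

lemma less_imp_le: "x \<prec> y \<Longrightarrow> x \<preceq> y"
  by (simp add: less_def)

lemma not_le: "x \<in>\<^sub>M K \<Longrightarrow> y \<in>\<^sub>M K \<Longrightarrow> \<not> x \<preceq> y \<longleftrightarrow> y \<prec> x"
  using le_total le_antisym by (auto simp: less_def)

lemma not_less: "x \<in>\<^sub>M K \<Longrightarrow> y \<in>\<^sub>M K \<Longrightarrow> \<not> x \<prec> y \<longleftrightarrow> y \<preceq> x"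
  using not_le by blast

lemma less_le_trans: "x \<prec> y \<Longrightarrow> y \<preceq> t \<Longrightarrow> x \<in>\<^sub>M K \<Longrightarrow> y \<in>\<^sub>M K \<Longrightarrow> t \<in>\<^sub>M K \<Longrightarrow> x \<prec> t"
  unfolding less_def using le_trans le_antisym by blast

lemma le_less_trans: "x \<preceq> y \<Longrightarrow> y \<prec> t \<Longrightarrow> x \<in>\<^sub>M K \<Longrightarrow> y \<in>\<^sub>M K \<Longrightarrow> t \<in>\<^sub>M K \<Longrightarrow> x \<prec> t"
  unfolding less_def using le_trans le_antisym by blast

lemma less_trans: "x \<prec> y \<Longrightarrow> y \<prec> t \<Longrightarrow> x \<in>\<^sub>M K \<Longrightarrow> y \<in>\<^sub>M K \<Longrightarrow> t \<in>\<^sub>M K \<Longrightarrow> x \<prec> t"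
  using less_le_trans less_imp_le by blast

lemma plus_le_mono:
  "x \<preceq> y \<Longrightarrow> s \<preceq> t \<Longrightarrow> x \<in>\<^sub>M K \<Longrightarrow> y \<in>\<^sub>M K \<Longrightarrow> s \<in>\<^sub>M K \<Longrightarrow> t \<in>\<^sub>M K \<Longrightarrow> x \<oplus> s \<preceq> y \<oplus> t"
  by (rule le_trans[of _ "y \<oplus> s"]) simp_all

lemma plus_less_mono:
  "x \<prec> y \<Longrightarrow> s \<prec> t \<Longrightarrow> x \<in>\<^sub>M K \<Longrightarrow> y \<in>\<^sub>M K \<Longrightarrow> s \<in>\<^sub>M K \<Longrightarrow> t \<in>\<^sub>M K \<Longrightarrow> x \<oplus> s \<prec> y \<oplus> t"
  by (rule less_trans[of _ "y \<oplus> s"]) simp_all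

lemma plus_less_le_mono:
  "x \<prec> y \<Longrightarrow> s \<preceq> t \<Longrightarrow> x \<in>\<^sub>M K \<Longrightarrow> y \<in>\<^sub>M K \<Longrightarrow> s \<in>\<^sub>M K \<Longrightarrow> t \<in>\<^sub>M K \<Longrightarrow> x \<oplus> s \<prec> y \<oplus> t"
  by (rule less_le_trans[of _ "y \<oplus> s"]) simp_all

lemma less_plus_iff [simp]: "x \<in>\<^sub>M K \<Longrightarrow> y \<in>\<^sub>M K \<Longrightarrow> x \<prec> x \<oplus> y \<longleftrightarrow> \<zero> \<prec> y"
  using plus_less_cancel(2)[of \<zero> y x] by simp

lemma le_plus_iff [simp]: "x \<in>\<^sub>M K \<Longrightarrow> y \<in>\<^sub>M K \<Longrightarrow> x \<preceq> x \<oplus> y \<longleftrightarrow> \<zero> \<preceq> y"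
  using plus_le_left_cancel[of \<zero> y x] by simp

lemma uminus_closed [simp]: "x \<in>\<^sub>M K \<Longrightarrow> \<ominus> x \<in>\<^sub>M K"
  and plus_uminus [simp]: "x \<in>\<^sub>M K \<Longrightarrow> x \<oplus> \<ominus> x = \<zero>"
proof -
  assume x: "x \<in>\<^sub>M K"
  have "\<exists>!y. y \<in>\<^sub>M K \<and> x \<oplus> y = \<zero>"
    using ex_uminus[OF x] plus_left_cancel[OF _ _ x] by (metis mem_elts)
  from the1I[OF this] show "\<ominus> x \<in>\<^sub>M K" "x \<oplus> \<ominus> x = \<zero>" unfolding uminus_R_def by auto
qed

lemma uminus_plus [simp]: "x \<in>\<^sub>M K \<Longrightarrow> \<ominus> x \<oplus> x = \<zero>"
  by (simp add: plus_comm[of "\<ominus> x"])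

lemma uminus_unique: "x \<in>\<^sub>M K \<Longrightarrow> y \<in>\<^sub>M K \<Longrightarrow> x \<oplus> y = \<zero> \<Longrightarrow> y = \<ominus> x"
  by (metis plus_left_cancel plus_uminus uminus_closed)

lemma uminus_uminus [simp]: "x \<in>\<^sub>M K \<Longrightarrow> \<ominus> (\<ominus> x) = x"
  by (rule uminus_unique[symmetric]) simp_all

lemma uminus_zero [simp]: "\<ominus> \<zero> = \<zero>"
  by (rule uminus_unique[symmetric]) simp_all

lemma ex_diff: "x \<in>\<^sub>M K \<Longrightarrow> y \<in>\<^sub>M K \<Longrightarrow> \<exists>d. d \<in>\<^sub>M K \<and> y = x \<oplus> d"
  by (rule exI[of _ "\<ominus> x \<oplus> y"]) (simp flip: plus_assoc)

lemma ex_diff': "x \<in>\<^sub>M K \<Longrightarrow> y \<in>\<^sub>M K \<Longrightarrow> \<exists>d. d \<in>\<^sub>M K \<and> y = d \<oplus> x"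
  by (metis ex_diff plus_comm)

lemma ex_diff_pos: "x \<prec> y \<Longrightarrow> x \<in>\<^sub>M K \<Longrightarrow> y \<in>\<^sub>M K \<Longrightarrow> \<exists>d. d \<in>\<^sub>M K \<and> \<zero> \<prec> d \<and> y = x \<oplus> d"
  by (metis ex_diff less_plus_iff)

lemma uminus_le_uminus [simp]:
  "x \<in>\<^sub>M K \<Longrightarrow> y \<in>\<^sub>M K \<Longrightarrow> \<ominus> x \<preceq> \<ominus> y \<longleftrightarrow> y \<preceq> x"
proof -
  assume x: "x \<in>\<^sub>M K" and y: "y \<in>\<^sub>M K"
  have "\<ominus> x \<preceq> \<ominus> y \<longleftrightarrow> \<ominus> x \<oplus> (x \<oplus> y) \<preceq> \<ominus> y \<oplus> (x \<oplus> y)" using x y by simp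
  also have "\<ominus> x \<oplus> (x \<oplus> y) = y" using x y by (simp flip: plus_assoc)
  also have "\<ominus> y \<oplus> (x \<oplus> y) = x" using x y by (simp add: plus_left_comm[of "\<ominus> y"])
  finally show ?thesis .
qed

lemma uminus_less_uminus [simp]:
  "x \<in>\<^sub>M K \<Longrightarrow> y \<in>\<^sub>M K \<Longrightarrow> \<ominus> x \<prec> \<ominus> y \<longleftrightarrow> y \<prec> x"
  unfolding less_def by (metis uminus_le_uminus uminus_uminus)

lemma uminus_less_iff: "x \<in>\<^sub>M K \<Longrightarrow> y \<in>\<^sub>M K \<Longrightarrow> \<ominus> x \<prec> y \<longleftrightarrow> \<ominus> y \<prec> x"
  and less_uminus_iff: "x \<in>\<^sub>M K \<Longrightarrow> y \<in>\<^sub>M K \<Longrightarrow> x \<prec> \<ominus> y \<longleftrightarrow> y \<prec> \<ominus> x"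
  by (metis uminus_less_uminus uminus_uminus uminus_closed)+

lemma times_zero [simp]: "x \<in>\<^sub>M K \<Longrightarrow> x \<otimes> \<zero> = \<zero>" "x \<in>\<^sub>M K \<Longrightarrow> \<zero> \<otimes> x = \<zero>"
proof -
  assume x: "x \<in>\<^sub>M K"
  have "x \<otimes> \<zero> \<oplus> x \<otimes> \<zero> = x \<otimes> \<zero> \<oplus> \<zero>" using x distrib[of x \<zero> \<zero>] by simp
  then show "x \<otimes> \<zero> = \<zero>" using x by (subst (asm) plus_left_cancel) auto
  then show "\<zero> \<otimes> x = \<zero>" using x by (simp add: times_comm)
qed

lemma one_times [simp]: "x \<in>\<^sub>M K \<Longrightarrow> \<one> \<otimes> x = x"
  by (simp add: times_comm[of \<one>])

lemma times_uminus: "x \<in>\<^sub>M K \<Longrightarrow> y \<in>\<^sub>M K \<Longrightarrow> x \<otimes> \<ominus> y = \<ominus> (x \<otimes> y)"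
  by (rule uminus_unique) (simp_all flip: distrib)

lemma uminus_times: "x \<in>\<^sub>M K \<Longrightarrow> y \<in>\<^sub>M K \<Longrightarrow> \<ominus> x \<otimes> y = \<ominus> (x \<otimes> y)"
  by (simp add: times_comm[of _ y] times_uminus)

lemma zero_less_one [simp]: "\<zero> \<prec> \<one>"
proof (rule ccontr)
  assume "\<not> \<zero> \<prec> \<one>"
  then have "\<one> \<preceq> \<zero>" by (simp add: not_less)
  then have "\<zero> \<preceq> \<ominus> \<one>" using uminus_le_uminus[of \<zero> \<one>] by simp
  then have "\<zero> \<preceq> \<ominus> \<one> \<otimes> \<ominus> \<one>" by (intro times_nonneg) simp_all
  then have "\<zero> \<preceq> \<one>" by (simp add: times_uminus uminus_times)
  with \<open>\<one> \<preceq> \<zero>\<close> have "\<zero> = \<one>" by (intro le_antisym) simp_all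
  then show False by simp
qed

lemma inverse_closed: "x \<in>\<^sub>M K \<Longrightarrow> x \<noteq> \<zero> \<Longrightarrow> inverse_R x \<in>\<^sub>M K"
  and times_inverse: "x \<in>\<^sub>M K \<Longrightarrow> x \<noteq> \<zero> \<Longrightarrow> x \<otimes> inverse_R x = \<one>"
proof -
  assume x: "x \<in>\<^sub>M K" "x \<noteq> \<zero>"
  have "\<exists>!y. y \<in>\<^sub>M K \<and> x \<otimes> y = \<one>"
  proof (rule ex_ex1I)
    show "\<exists>y. y \<in>\<^sub>M K \<and> x \<otimes> y = \<one>" using ex_inverse[OF x] by auto
    show "y = z" if "y \<in>\<^sub>M K \<and> x \<otimes> y = \<one>" "z \<in>\<^sub>M K \<and> x \<otimes> z = \<one>" for y z
    proof -
      have "z \<otimes> (x \<otimes> y) = y \<otimes> (x \<otimes> z)"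
        using that x(1) by (metis times_assoc times_comm)
      then show ?thesis using that by simp
    qed
  qed
  from the1I[OF this] show "inverse_R x \<in>\<^sub>M K" "x \<otimes> inverse_R x = \<one>"
    unfolding inverse_R_def by auto
qed

lemma times_eq_zero: "x \<in>\<^sub>M K \<Longrightarrow> y \<in>\<^sub>M K \<Longrightarrow> x \<otimes> y = \<zero> \<Longrightarrow> x = \<zero> \<or> y = \<zero>"
proof (rule ccontr)
  assume *: "x \<in>\<^sub>M K" "y \<in>\<^sub>M K" "x \<otimes> y = \<zero>" "\<not> (x = \<zero> \<or> y = \<zero>)"
  then have x: "inverse_R x \<in>\<^sub>M K" "inverse_R x \<otimes> x = \<one>"
    using times_inverse[of x] inverse_closed[of x] times_comm[of "inverse_R x" x] by simp_all
  then have "inverse_R x \<otimes> (x \<otimes> y) = y"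
    using * times_assoc[of "inverse_R x" x y] by simp
  then show False using * inverse_closed[of x] by simp
qed

lemma times_pos: "\<zero> \<prec> x \<Longrightarrow> \<zero> \<prec> y \<Longrightarrow> x \<in>\<^sub>M K \<Longrightarrow> y \<in>\<^sub>M K \<Longrightarrow> \<zero> \<prec> x \<otimes> y"
  unfolding less_def using times_nonneg times_eq_zero by metis

lemma times_less_mono: "\<zero> \<prec> t \<Longrightarrow> x \<prec> y \<Longrightarrow> t \<in>\<^sub>M K \<Longrightarrow> x \<in>\<^sub>M K \<Longrightarrow> y \<in>\<^sub>M K \<Longrightarrow> t \<otimes> x \<prec> t \<otimes> y"
  using ex_diff_pos[of x y] times_pos[of t] by (auto simp: distrib)

lemma times_less_cancel:
  "\<zero> \<prec> t \<Longrightarrow> t \<in>\<^sub>M K \<Longrightarrow> x \<in>\<^sub>M K \<Longrightarrow> y \<in>\<^sub>M K \<Longrightarrow> t \<otimes> x \<prec> t \<otimes> y \<longleftrightarrow> x \<prec> y"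
  by (metis less_irrefl less_trans not_less less_def times_closed times_less_mono)

lemma half_unique:
  assumes "x \<in>\<^sub>M K" "y \<in>\<^sub>M K" "x \<oplus> x = y \<oplus> y" shows "x = y"
proof (rule ccontr)
  assume "x \<noteq> y"
  then have "x \<prec> y \<or> y \<prec> x" using assms not_le[of x y] by (auto simp: less_def)
  then have "x \<oplus> x \<prec> y \<oplus> y \<or> y \<oplus> y \<prec> x \<oplus> x"
    using assms(1,2) plus_less_mono[of x y x y] plus_less_mono[of y x y x] by auto
  then show False using assms(3) by simp
qed

text \<open>Existence comes from the inverse of 1 + 1, which is positive and hence non-zero;
  uniqueness from strict monotonicity of doubling.\<close>

lemma half_closed [simp]: "x \<in>\<^sub>M K \<Longrightarrow> half x \<in>\<^sub>M K"
  and half_plus_half [simp]: "x \<in>\<^sub>M K \<Longrightarrow> half x \<oplus> half x = x"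
proof -
  assume x: "x \<in>\<^sub>M K"
  have 2: "\<one> \<oplus> \<one> \<noteq> \<zero>"
    using less_trans[OF zero_less_one, of "\<one> \<oplus> \<one>"] by auto
  let ?i = "inverse_R (\<one> \<oplus> \<one>)"
  have i: "?i \<in>\<^sub>M K" using inverse_closed[OF _ 2] by simp
  then have i2: "?i \<oplus> ?i = \<one>"
    using times_inverse[OF _ 2] distrib[of ?i \<one> \<one>] times_comm[of ?i "\<one> \<oplus> \<one>"] by simp
  have "\<exists>!y. y \<in>\<^sub>M K \<and> y \<oplus> y = x"
  proof (rule ex_ex1I)
    show "\<exists>y. y \<in>\<^sub>M K \<and> y \<oplus> y = x"
      using i i2 x distrib[of x ?i ?i] by (intro exI[of _ "x \<otimes> ?i"]) simp
  qed (use half_unique in blast)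
  from the1I[OF this] show "half x \<in>\<^sub>M K" "half x \<oplus> half x = x" unfolding half_def by auto
qed

lemma half_pos: "\<zero> \<prec> x \<Longrightarrow> x \<in>\<^sub>M K \<Longrightarrow> \<zero> \<prec> half x"
proof (rule ccontr)
  assume *: "\<zero> \<prec> x" "x \<in>\<^sub>M K" "\<not> \<zero> \<prec> half x"
  then have "half x \<oplus> half x \<preceq> \<zero> \<oplus> \<zero>" by (intro plus_le_mono) (simp_all add: not_less)
  then show False using * not_less[of \<zero> x] by simp
qed

lemma ex_greater: "x \<in>\<^sub>M K \<Longrightarrow> \<exists>y. y \<in>\<^sub>M K \<and> x \<prec> y"
  by (rule exI[of _ "x \<oplus> \<one>"]) simp

lemma ex_less: "x \<in>\<^sub>M K \<Longrightarrow> \<exists>y. y \<in>\<^sub>M K \<and> y \<prec> x"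
  using ex_diff'[of \<one> x] by (metis less_plus_iff one_closed zero_less_one)

text \<open>The line is complete only for subsets that belong to the model, and separation provides
  these for definable predicates.\<close>

lemma sup_exists:
  assumes "definable (\<lambda>e. P (e 0))" "x0 \<in>\<^sub>M K" "P x0" "b \<in>\<^sub>M K" "\<And>x. x \<in>\<^sub>M K \<Longrightarrow> P x \<Longrightarrow> x \<preceq> b"
  obtains s where "s \<in>\<^sub>M K" "\<And>x. x \<in>\<^sub>M K \<Longrightarrow> P x \<Longrightarrow> x \<preceq> s"
    "\<And>b. b \<in>\<^sub>M K \<Longrightarrow> (\<And>x. x \<in>\<^sub>M K \<Longrightarrow> P x \<Longrightarrow> x \<preceq> b) \<Longrightarrow> s \<preceq> b"
proof -
  have ub: "upper_bound R (elts (coll K P)) c \<longleftrightarrow> c \<in>\<^sub>M K \<and> (\<forall>x. x \<in>\<^sub>M K \<longrightarrow> P x \<longrightarrow> x \<preceq> c)" for c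
    using assms(1) by (auto simp: upper_bound_def)
  have "elts (coll K P) \<subseteq> elts K" "elts (coll K P) \<noteq> {}" using assms(1-3) by auto
  moreover have "upper_bound R (elts (coll K P)) b" using assms(4,5) by (simp add: ub)
  ultimately obtain s where "upper_bound R (elts (coll K P)) s"
    "\<And>b. upper_bound R (elts (coll K P)) b \<Longrightarrow> s \<preceq> b"
    using real_line unfolding real_line_def by metis
  then show ?thesis using that[of s] by (auto simp: ub)
qed

text \<open>\<open>absdiff\<close> goes through \<open>neg\<close>, a \<open>THE\<close>; this
  variant is composed of definable operations.\<close>

definition dist_R where
  "dist_R x y = (if \<zero> \<preceq> x \<oplus> \<ominus> y then x \<oplus> \<ominus> y else \<ominus> (x \<oplus> \<ominus> y))"

lemma absdiff_eq_dist: assumes "x \<in>\<^sub>M K" "y \<in>\<^sub>M K" shows "absdiff R x y = dist_R x y"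
proof -
  have "neg R u = \<ominus> u" if "u \<in>\<^sub>M K" for u
    unfolding neg_def using that
    by (intro the_equality) (simp_all add: add_eq_plus, metis add_eq_plus uminus_unique)
  then show ?thesis using assms by (simp add: absdiff_def dist_R_def add_eq_plus)
qed

lemma dist_closed [simp]: "x \<in>\<^sub>M K \<Longrightarrow> y \<in>\<^sub>M K \<Longrightarrow> dist_R x y \<in>\<^sub>M K"
  by (simp add: dist_R_def)

lemma dist_nonneg: assumes "x \<in>\<^sub>M K" "y \<in>\<^sub>M K" shows "\<zero> \<preceq> dist_R x y"
  using assms uminus_le_uminus[of \<zero> "x \<oplus> \<ominus> y"] le_total[of \<zero> "x \<oplus> \<ominus> y"] by (auto simp: dist_R_def)

text \<open>With x = y + d the two inequalities become d \<le> r and -d \<le> r. Later estimates use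
  this form because it is free of subtraction.\<close>

lemma dist_le_iff:
  assumes "x \<in>\<^sub>M K" "y \<in>\<^sub>M K" "r \<in>\<^sub>M K"
  shows "dist_R x y \<preceq> r \<longleftrightarrow> x \<preceq> y \<oplus> r \<and> y \<preceq> x \<oplus> r"
proof -
  obtain d where d: "d \<in>\<^sub>M K" "x = y \<oplus> d" using ex_diff assms by metis
  have xy: "x \<oplus> \<ominus> y = d" using d assms by (simp add: plus_comm[of y] plus_assoc)
  have y: "y \<preceq> x \<oplus> r \<longleftrightarrow> \<zero> \<preceq> d \<oplus> r" using d assms by (simp add: plus_assoc)
  also have "\<dots> \<longleftrightarrow> \<ominus> d \<preceq> r"
    using plus_le_left_cancel[of "\<ominus> d" r d] d assms by simp
  finally have 2: "y \<preceq> x \<oplus> r \<longleftrightarrow> \<ominus> d \<preceq> r" .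
  have 1: "x \<preceq> y \<oplus> r \<longleftrightarrow> d \<preceq> r" using d assms by simp
  have "\<ominus> d \<preceq> \<zero> \<longleftrightarrow> \<zero> \<preceq> d" using uminus_le_uminus[of d \<zero>] d by simp
  then show ?thesis unfolding 1 2 dist_R_def xy
    using d assms le_total[of \<zero> d] le_trans[of "\<ominus> d" \<zero> d] le_trans[of d \<zero> "\<ominus> d"]
      uminus_le_uminus[of \<zero> d] le_trans[of d "\<ominus> d" r] le_trans[of "\<ominus> d" d r] by auto
qed

lemma dist_less_iff:
  assumes "x \<in>\<^sub>M K" "y \<in>\<^sub>M K" "r \<in>\<^sub>M K"
  shows "dist_R x y \<prec> r \<longleftrightarrow> x \<prec> y \<oplus> r \<and> y \<prec> x \<oplus> r"
proof
  assume "dist_R x y \<prec> r"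
  then have "x \<oplus> dist_R x y \<prec> x \<oplus> r" "y \<oplus> dist_R x y \<prec> y \<oplus> r" using assms by simp_all
  moreover have "x \<preceq> y \<oplus> dist_R x y" "y \<preceq> x \<oplus> dist_R x y"
    using dist_le_iff[of x y "dist_R x y"] assms by simp_all
  ultimately show "x \<prec> y \<oplus> r \<and> y \<prec> x \<oplus> r"
    using assms le_less_trans[of x "y \<oplus> dist_R x y"] le_less_trans[of y "x \<oplus> dist_R x y"] by simp
next
  assume *: "x \<prec> y \<oplus> r \<and> y \<prec> x \<oplus> r"
  then have le: "dist_R x y \<preceq> r" using dist_le_iff[of x y r] assms less_imp_le by blast
  have "x = y \<oplus> dist_R x y \<or> y = x \<oplus> dist_R x y"
  proof -
    obtain d where d: "d \<in>\<^sub>M K" "x = y \<oplus> d" using ex_diff assms by metis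
    have "x \<oplus> \<ominus> y = d" using d assms by (simp add: plus_comm[of y] plus_assoc)
    then show ?thesis using d assms by (auto simp: dist_R_def plus_assoc)
  qed
  then show "dist_R x y \<prec> r" using * le unfolding less_def by metis
qed

end

section \<open>Clopen sets and separation\<close>

locale space_model = ZF_model E for E :: "'m \<Rightarrow> 'm \<Rightarrow> bool"  (infix \<open>\<in>\<^sub>M\<close> 50) +
  fixes X T :: 'm
  assumes topological_space: "topological_space X T"
begin

lemma open_in_subset: "open_in T A \<Longrightarrow> A \<subseteq> elts X"
  using topological_space by (auto simp: topological_space_def open_in_def)

lemma open_in_space: "open_in T (elts X)"
  using topological_space by (auto simp: topological_space_def open_in_def)

lemma open_in_Union:
  assumes "elts F \<subseteq> elts T" shows "open_in T (\<Union> (elts ` elts F))"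
  using topological_space assms unfolding topological_space_def open_in_def by metis

lemma open_in_empty: "open_in T {}"
  using open_in_Union[of emp] by simp

lemma open_in_Int: "open_in T A \<Longrightarrow> open_in T B \<Longrightarrow> open_in T (A \<inter> B)"
  using topological_space unfolding topological_space_def open_in_def by metis

lemma open_in_Un:
  assumes "open_in T A" "open_in T B" shows "open_in T (A \<union> B)"
proof -
  obtain U V where "U \<in>\<^sub>M T" "V \<in>\<^sub>M T" "A = elts U" "B = elts V"
    using assms by (auto simp: open_in_def)
  then show ?thesis using open_in_Union[of "upair U V"] by simp
qed

text \<open>No neighbourhoods are chosen: the set is the union of all open sets on which
  \<open>P\<close> holds, and definability of \<open>P\<close> makes these a family of the model,
  the only kind whose union the topology contains.\<close>

lemma open_in_local:
  assumes P: "definable (\<lambda>e. P (e 0))"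
    and nb: "\<And>x. x \<in>\<^sub>M X \<Longrightarrow> P x \<Longrightarrow> \<exists>U. open_in T U \<and> x \<in> U \<and> (\<forall>y\<in>U. P y)"
  shows "open_in T {x \<in> elts X. P x}"
proof -
  have "definable (\<lambda>e. \<forall>y\<in>elts (e 0). P y)" by (intro definable_intros definable_comp[OF P])
  from separation_definable[OF this]
  obtain F where F: "elts F = {U \<in> elts T. \<forall>y\<in>elts U. P y}" by metis
  have "x \<in> \<Union> (elts ` elts F) \<longleftrightarrow> x \<in>\<^sub>M X \<and> P x" for x
  proof
    assume "x \<in> \<Union> (elts ` elts F)"
    then obtain U where "U \<in>\<^sub>M T" "x \<in>\<^sub>M U" "\<forall>y\<in>elts U. P y" unfolding F by auto
    moreover have "open_in T (elts U)" using \<open>U \<in>\<^sub>M T\<close> unfolding open_in_def by auto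
    ultimately show "x \<in>\<^sub>M X \<and> P x" using open_in_subset[of "elts U"] by auto
  next
    assume "x \<in>\<^sub>M X \<and> P x"
    then obtain U where "U \<in>\<^sub>M T" "x \<in> elts U" "\<forall>y\<in>elts U. P y"
      using nb[of x] by (auto simp: open_in_def)
    then show "x \<in> \<Union> (elts ` elts F)" unfolding F by auto
  qed
  then have "\<Union> (elts ` elts F) = {x \<in> elts X. P x}" by (simp add: set_eq_iff)
  moreover have "elts F \<subseteq> elts T" unfolding F by auto
  ultimately show ?thesis using open_in_Union by metis
qed

lemma clopen_in_empty: "clopen_in X T {}"
  by (simp add: clopen_in_def open_in_empty open_in_space)

lemma clopen_in_subset: "clopen_in X T A \<Longrightarrow> A \<subseteq> elts X"
  using open_in_subset by (auto simp: clopen_in_def)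

lemma clopen_in_Un: "clopen_in X T A \<Longrightarrow> clopen_in X T B \<Longrightarrow> clopen_in X T (A \<union> B)"
  by (simp add: clopen_in_def open_in_Un Diff_Un open_in_Int)

lemma open_in_Diff_clopen: "open_in T A \<Longrightarrow> clopen_in X T B \<Longrightarrow> open_in T (A - B)"
proof -
  assume A: "open_in T A" and "clopen_in X T B"
  then have "open_in T (A \<inter> (elts X - B))" by (intro open_in_Int) (simp_all add: clopen_in_def)
  moreover have "A \<inter> (elts X - B) = A - B" using open_in_subset[OF A] by auto
  ultimately show ?thesis by simp
qed

text \<open>Replaces HOL sets by quantifiers over the model, the form that the definability rules
  can process.\<close>

lemma open_in_Collect:
  "open_in T {x \<in> elts X. P x} \<longleftrightarrow> (\<exists>U\<in>elts T. \<forall>x. x \<in>\<^sub>M U \<longleftrightarrow> x \<in>\<^sub>M X \<and> P x)"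
  by (simp add: open_in_def set_eq_iff)

lemma clopen_in_Collect:
  "clopen_in X T {x \<in> elts X. P x} \<longleftrightarrow>
    open_in T {x \<in> elts X. P x} \<and> open_in T {x \<in> elts X. \<not> P x}"
proof -
  have "elts X - {x \<in> elts X. P x} = {x \<in> elts X. \<not> P x}" by auto
  then show ?thesis by (simp add: clopen_in_def)
qed

text \<open>Members with index below a possibly non-standard m are finitely many only in the sense
  of the model, so the union is built by internal induction, which adds at most one member at a
  time.\<close>

lemma clopen_in_initial_union:
  assumes h: "definable_fun (\<lambda>e. h (e 0))" and inj: "inj_on h (elts A)"
    and clopen: "\<And>a. a \<in>\<^sub>M A \<Longrightarrow> clopen_in X T (elts a)"
    and "m \<in>\<^sub>M \<omega>"
  shows "clopen_in X T {x \<in> elts X. \<exists>a\<in>elts A. h a \<in>\<^sub>M m \<and> x \<in>\<^sub>M a}"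
  using assms(4)
proof (induction rule: omega_induct)
  case definable
  show ?case
    unfolding clopen_in_Collect open_in_Collect
    by (intro definable_intros definable_fun_comp[OF h])
next
  case emp
  show ?case using clopen_in_empty by simp
next
  case (succ m)
  \<comment> \<open>By injectivity of \<open>h\<close> at most one member carries the index m, so
    this set is that member or empty.\<close>
  have "clopen_in X T {x \<in> elts X. \<exists>a\<in>elts A. h a = m \<and> x \<in>\<^sub>M a}"
  proof (cases "\<exists>a\<in>elts A. h a = m")
    case True
    then obtain a where a: "a \<in>\<^sub>M A" "h a = m" by auto
    have "b = a" if "b \<in>\<^sub>M A" "h b = m" for b using inj a that by (auto simp: inj_on_def)
    then have "x \<in>\<^sub>M X \<and> (\<exists>b\<in>elts A. h b = m \<and> x \<in>\<^sub>M b) \<longleftrightarrow> x \<in>\<^sub>M a" for x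
      using clopen_in_subset[OF clopen[OF a(1)]] a by (metis mem_elts subsetD)
    then have "{x \<in> elts X. \<exists>a\<in>elts A. h a = m \<and> x \<in>\<^sub>M a} = elts a" by (simp add: set_eq_iff)
    then show ?thesis using clopen[OF a(1)] by simp
  next
    case False
    then have "{x \<in> elts X. \<exists>a\<in>elts A. h a = m \<and> x \<in>\<^sub>M a} = {}" by auto
    then show ?thesis using clopen_in_empty by metis
  qed
  from clopen_in_Un[OF succ.IH this] show ?case
    by (rule back_subst[of "clopen_in X T"]) (simp add: set_eq_iff, blast)
qed

lemma clopen_in_finite_union:
  assumes "finite_set A" and clopen: "\<And>a. a \<in>\<^sub>M A \<Longrightarrow> clopen_in X T (elts a)"
  shows "clopen_in X T (elts (UnM A))"
proof (rule finiteE[OF assms(1)])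
  fix n h
  assume n: "n \<in>\<^sub>M \<omega>" and h: "definable_fun (\<lambda>e. h (e 0))" "inj_on h (elts A)"
    and hn: "\<And>a. a \<in>\<^sub>M A \<Longrightarrow> h a \<in>\<^sub>M n"
  have "x \<in>\<^sub>M X" if "a \<in>\<^sub>M A" "x \<in>\<^sub>M a" for a x
    using clopen_in_subset[OF clopen[OF that(1)]] that(2) by auto
  then have "{x \<in> elts X. \<exists>a\<in>elts A. h a \<in>\<^sub>M n \<and> x \<in>\<^sub>M a} = elts (UnM A)"
    using hn by (simp add: set_eq_iff) (metis mem_elts)
  then show ?thesis using clopen_in_initial_union[OF h clopen n] by simp
qed

text \<open>
  Enumerate both families along \<open>\<omega>\<close>; a point belongs to the separating set if some member of \<open>F\<close>
  contains it before any member of \<open>G\<close> does.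
\<close>

lemma clopen_separation:
  assumes "countable_clopen_family X T F" "countable_clopen_family X T G"
    and F_disj: "\<And>a. a \<in>\<^sub>M F \<Longrightarrow> elts a \<inter> Z2 = {}" and G_disj: "\<And>b. b \<in>\<^sub>M G \<Longrightarrow> elts b \<inter> Z1 = {}"
    and cover: "\<And>x. x \<in>\<^sub>M X \<Longrightarrow> (\<exists>a\<in>elts F. x \<in>\<^sub>M a) \<or> (\<exists>b\<in>elts G. x \<in>\<^sub>M b)"
    and "Z1 \<subseteq> elts X"
  shows "\<exists>U. clopen_in X T U \<and> Z1 \<subseteq> U \<and> U \<subseteq> elts X - Z2"
proof -
  have F: "countable_set F" "\<And>a. a \<in>\<^sub>M F \<Longrightarrow> clopen_in X T (elts a)"
    and G: "countable_set G" "\<And>b. b \<in>\<^sub>M G \<Longrightarrow> clopen_in X T (elts b)"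
    using assms(1,2) by (auto simp: countable_clopen_family_def)
  obtain f where f: "definable_fun (\<lambda>e. f (e 0))" "inj_on f (elts F)" "\<And>a. a \<in>\<^sub>M F \<Longrightarrow> f a \<in>\<^sub>M \<omega>"
    using countableE[OF F(1)] by metis
  obtain g where g: "definable_fun (\<lambda>e. g (e 0))" "inj_on g (elts G)" "\<And>b. b \<in>\<^sub>M G \<Longrightarrow> g b \<in>\<^sub>M \<omega>"
    using countableE[OF G(1)] by metis
  \<comment> \<open>The comparison \<open>g b \<in>\<^sub>M f a\<close> is strict, so a tie between
    indices is decided in favour of \<open>F\<close>.\<close>
  define W where "W x \<longleftrightarrow> (\<exists>a\<in>elts F. x \<in>\<^sub>M a \<and> \<not> (\<exists>b\<in>elts G. g b \<in>\<^sub>M f a \<and> x \<in>\<^sub>M b))" for x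
  have W: "definable (\<lambda>e. W (e 0))"
    unfolding W_def by (intro definable_intros definable_fun_comp[OF f(1)] definable_fun_comp[OF g(1)])
  have "open_in T {x \<in> elts X. W x}"
  proof (rule open_in_local[OF W])
    fix x assume "x \<in>\<^sub>M X" "W x"
    then obtain a where a: "a \<in>\<^sub>M F" "x \<in>\<^sub>M a" "\<not> (\<exists>b\<in>elts G. g b \<in>\<^sub>M f a \<and> x \<in>\<^sub>M b)"
      by (auto simp: W_def)
    have "open_in T (elts a - {x \<in> elts X. \<exists>b\<in>elts G. g b \<in>\<^sub>M f a \<and> x \<in>\<^sub>M b})"
      using F(2)[OF a(1)] clopen_in_initial_union[OF g(1,2) G(2) f(3)[OF a(1)]]
      by (intro open_in_Diff_clopen) (simp_all add: clopen_in_def)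
    then show "\<exists>U. open_in T U \<and> x \<in> U \<and> (\<forall>y\<in>U. W y)"
      using a clopen_in_subset[OF F(2)[OF a(1)]] by (intro exI conjI) (auto simp: W_def)
  qed
  moreover have "open_in T {x \<in> elts X. \<not> W x}"
  proof (rule open_in_local[OF definable_not[OF W]])
    fix x assume x: "x \<in>\<^sub>M X" "\<not> W x"
    \<comment> \<open>Since ties favour \<open>F\<close>, a point outside \<open>W\<close> has a
      member of \<open>G\<close> strictly before all members of \<open>F\<close> that contain it;
      this is what \<open>succ (g b)\<close> expresses. The member \<open>b\<close> is found by
      comparison with the first such member of \<open>F\<close>.\<close>
    have "\<exists>b\<in>elts G. x \<in>\<^sub>M b \<and> (\<forall>a\<in>elts F. x \<in>\<^sub>M a \<longrightarrow> \<not> f a \<in>\<^sub>M succ (g b))"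
    proof (cases "\<exists>a\<in>elts F. x \<in>\<^sub>M a")
      case True
      then obtain a0 where a0: "a0 \<in>\<^sub>M F" "x \<in>\<^sub>M a0" by auto
      have "definable (\<lambda>e. \<exists>a\<in>elts F. x \<in>\<^sub>M a \<and> f a = e 0)"
        by (intro definable_intros definable_fun_comp[OF f(1)])
      from omega_least[OF this f(3)[OF a0(1)]] a0 obtain n where
        "n \<in>\<^sub>M \<omega>" "\<exists>a\<in>elts F. x \<in>\<^sub>M a \<and> f a = n" "\<And>k. k \<in>\<^sub>M n \<Longrightarrow> \<not> (\<exists>a\<in>elts F. x \<in>\<^sub>M a \<and> f a = k)"
        by (metis mem_elts)
      then obtain a where a: "a \<in>\<^sub>M F" "x \<in>\<^sub>M a" "\<And>a'. a' \<in>\<^sub>M F \<Longrightarrow> x \<in>\<^sub>M a' \<Longrightarrow> \<not> f a' \<in>\<^sub>M f a"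
        by (metis mem_elts)
      then obtain b where b: "b \<in>\<^sub>M G" "g b \<in>\<^sub>M f a" "x \<in>\<^sub>M b" using x by (auto simp: W_def)
      have "\<not> f a' \<in>\<^sub>M succ (g b)" if "a' \<in>\<^sub>M F" "x \<in>\<^sub>M a'" for a'
        using a(3)[OF that] b(2) omega_mem_trans[OF f(3)[OF a(1)], of "f a'" "g b"] by auto
      then show ?thesis using b by auto
    next
      case False
      then show ?thesis using cover[OF x(1)] by auto
    qed
    then obtain b where b: "b \<in>\<^sub>M G" "x \<in>\<^sub>M b" "\<forall>a\<in>elts F. x \<in>\<^sub>M a \<longrightarrow> \<not> f a \<in>\<^sub>M succ (g b)"
      by auto
    \<comment> \<open>Removing the members of \<open>F\<close> with index up to that of
      \<open>b\<close> leaves points for which \<open>b\<close> precedes every possible witness of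
      \<open>W\<close>.\<close>
    let ?U = "elts b - {x \<in> elts X. \<exists>a\<in>elts F. f a \<in>\<^sub>M succ (g b) \<and> x \<in>\<^sub>M a}"
    have "open_in T ?U"
      using G(2)[OF b(1)] clopen_in_initial_union[OF f(1,2) F(2) succ_omega[OF g(3)[OF b(1)]]]
      by (intro open_in_Diff_clopen) (simp_all add: clopen_in_def)
    moreover have "\<not> W y" if "y \<in> ?U" for y
    proof
      assume "W y"
      then obtain a where a: "a \<in>\<^sub>M F" "y \<in>\<^sub>M a" "\<not> (\<exists>b\<in>elts G. g b \<in>\<^sub>M f a \<and> y \<in>\<^sub>M b)"
        by (auto simp: W_def)
      then have "\<not> f a \<in>\<^sub>M succ (g b)"
        using that clopen_in_subset[OF G(2)[OF b(1)]] by auto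
      then have "g b \<in>\<^sub>M f a" using omega_linear[OF f(3)[OF a(1)] g(3)[OF b(1)]] by auto
      then show False using a(3) b(1) that by auto
    qed
    ultimately show "\<exists>U. open_in T U \<and> x \<in> U \<and> (\<forall>y\<in>U. \<not> W y)" using b by (intro exI[of _ ?U]) auto
  qed
  ultimately have "clopen_in X T {x \<in> elts X. W x}" by (simp only: clopen_in_Collect)
  moreover have "W x" if "x \<in> Z1" for x
    using that cover[of x] G_disj \<open>Z1 \<subseteq> elts X\<close> by (fastforce simp: W_def)
  moreover have "\<not> W x" if "x \<in> Z2" for x using that F_disj by (fastforce simp: W_def)
  ultimately show ?thesis using \<open>Z1 \<subseteq> elts X\<close> by (intro exI[of _ "{x \<in> elts X. W x}"]) auto
qed

end

section \<open>Continuous real functions\<close>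

locale real_space_model = real_line_model E R + space_model E X T
  for E :: "'m \<Rightarrow> 'm \<Rightarrow> bool"  (infix \<open>\<in>\<^sub>M\<close> 50) and R and X T
begin

text \<open>Open sets of reals as predicates, with end points of intervals in place of distances:
  the closure properties then need only the order.\<close>

definition openR :: "('m \<Rightarrow> bool) \<Rightarrow> bool" where
  "openR P \<longleftrightarrow> (\<forall>x\<in>elts K. P x \<longrightarrow> (\<exists>a\<in>elts K. \<exists>b\<in>elts K.
     a \<prec> x \<and> x \<prec> b \<and> (\<forall>y\<in>elts K. a \<prec> y \<and> y \<prec> b \<longrightarrow> P y)))"

lemma openRI:
  "(\<And>x. x \<in>\<^sub>M K \<Longrightarrow> P x \<Longrightarrow> \<exists>a b. a \<in>\<^sub>M K \<and> b \<in>\<^sub>M K \<and> a \<prec> x \<and> x \<prec> b \<and>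
     (\<forall>y. y \<in>\<^sub>M K \<longrightarrow> a \<prec> y \<longrightarrow> y \<prec> b \<longrightarrow> P y)) \<Longrightarrow> openR P"
  unfolding openR_def Ball_def Bex_def mem_elts by metis

lemma openRE:
  assumes "openR P" "x \<in>\<^sub>M K" "P x"
  obtains a b where "a \<in>\<^sub>M K" "b \<in>\<^sub>M K" "a \<prec> x" "x \<prec> b" "\<And>y. y \<in>\<^sub>M K \<Longrightarrow> a \<prec> y \<Longrightarrow> y \<prec> b \<Longrightarrow> P y"
  using assms unfolding openR_def Ball_def Bex_def mem_elts by metis

lemma openR_greater: "c \<in>\<^sub>M K \<Longrightarrow> openR (\<lambda>t. c \<prec> t)"
  by (rule openRI) (metis ex_greater)

lemma openR_less: "c \<in>\<^sub>M K \<Longrightarrow> openR (\<lambda>t. t \<prec> c)"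
  by (rule openRI) (metis ex_less)

lemma openR_disj: "openR P \<Longrightarrow> openR Q \<Longrightarrow> openR (\<lambda>t. P t \<or> Q t)"
  by (rule openRI) (metis openRE)

lemma openR_conj:
  assumes "openR P" "openR Q" shows "openR (\<lambda>t. P t \<and> Q t)"
proof (rule openRI)
  fix x assume x: "x \<in>\<^sub>M K" "P x \<and> Q x"
  obtain a b where ab: "a \<in>\<^sub>M K" "b \<in>\<^sub>M K" "a \<prec> x" "x \<prec> b" "\<And>y. y \<in>\<^sub>M K \<Longrightarrow> a \<prec> y \<Longrightarrow> y \<prec> b \<Longrightarrow> P y"
    using openRE[OF assms(1) x(1)] x(2) by metis
  obtain c d where cd: "c \<in>\<^sub>M K" "d \<in>\<^sub>M K" "c \<prec> x" "x \<prec> d" "\<And>y. y \<in>\<^sub>M K \<Longrightarrow> c \<prec> y \<Longrightarrow> y \<prec> d \<Longrightarrow> Q y"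
    using openRE[OF assms(2) x(1)] x(2) by metis
  obtain l where l: "l \<in>\<^sub>M K" "l \<prec> x" "a \<preceq> l" "c \<preceq> l"
    using ab(1,3) cd(1,3) le_total[of a c] le_refl[of a] le_refl[of c] by metis
  obtain u where u: "u \<in>\<^sub>M K" "x \<prec> u" "u \<preceq> b" "u \<preceq> d"
    using ab(2,4) cd(2,4) le_total[of b d] le_refl[of b] le_refl[of d] by metis
  have "P y \<and> Q y" if y: "y \<in>\<^sub>M K" "l \<prec> y" "y \<prec> u" for y
    using ab(5)[OF y(1)] cd(5)[OF y(1)] le_less_trans[OF l(3) y(2)] le_less_trans[OF l(4) y(2)]
      less_le_trans[OF y(3) u(3)] less_le_trans[OF y(3) u(4)] ab(1,2) cd(1,2) l(1) u(1) y(1) by blast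
  then show "\<exists>l u. l \<in>\<^sub>M K \<and> u \<in>\<^sub>M K \<and> l \<prec> x \<and> x \<prec> u \<and>
     (\<forall>y. y \<in>\<^sub>M K \<longrightarrow> l \<prec> y \<longrightarrow> y \<prec> u \<longrightarrow> P y \<and> Q y)"
    using l(1,2) u(1,2) by blast
qed

lemma openR_bex: "(\<And>z. z \<in> A \<Longrightarrow> openR (P z)) \<Longrightarrow> openR (\<lambda>t. \<exists>z\<in>A. P z t)"
  by (rule openRI) (metis openRE)

lemma openR_cong: "(\<And>t. t \<in>\<^sub>M K \<Longrightarrow> P t \<longleftrightarrow> Q t) \<Longrightarrow> openR P \<longleftrightarrow> openR Q"
  by (simp add: openR_def cong: conj_cong)

lemma openR_less_plus:
  assumes "a \<in>\<^sub>M K" "d \<in>\<^sub>M K" shows "openR (\<lambda>t. a \<prec> t \<oplus> d)" "openR (\<lambda>t. t \<oplus> d \<prec> a)"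
proof -
  obtain c where c: "c \<in>\<^sub>M K" "a = c \<oplus> d" using ex_diff'[OF assms(2,1)] by auto
  have "openR (\<lambda>t. a \<prec> t \<oplus> d) \<longleftrightarrow> openR (\<lambda>t. c \<prec> t)" "openR (\<lambda>t. t \<oplus> d \<prec> a) \<longleftrightarrow> openR (\<lambda>t. t \<prec> c)"
    using c assms by (intro openR_cong; simp)+
  then show "openR (\<lambda>t. a \<prec> t \<oplus> d)" "openR (\<lambda>t. t \<oplus> d \<prec> a)"
    using openR_greater[OF c(1)] openR_less[OF c(1)] by simp_all
qed

text \<open>Returns from end points to a symmetric radius, the smaller of the two gaps.\<close>

lemma openR_ball:
  assumes "openR P" and x: "x \<in>\<^sub>M K" and "P x"
  shows "\<exists>r. r \<in>\<^sub>M K \<and> \<zero> \<prec> r \<and> (\<forall>y. y \<in>\<^sub>M K \<longrightarrow> x \<prec> y \<oplus> r \<longrightarrow> y \<prec> x \<oplus> r \<longrightarrow> P y)"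
proof -
  obtain a b where ab: "a \<in>\<^sub>M K" "b \<in>\<^sub>M K" "a \<prec> x" "x \<prec> b"
    "\<And>y. y \<in>\<^sub>M K \<Longrightarrow> a \<prec> y \<Longrightarrow> y \<prec> b \<Longrightarrow> P y" using openRE[OF assms] by metis
  obtain p where p: "p \<in>\<^sub>M K" "\<zero> \<prec> p" "x = a \<oplus> p" using ex_diff_pos[of a x] ab x by auto
  obtain q where q: "q \<in>\<^sub>M K" "\<zero> \<prec> q" "b = x \<oplus> q" using ex_diff_pos[of x b] ab x by auto
  obtain r where r: "r \<in>\<^sub>M K" "\<zero> \<prec> r" "r \<preceq> p" "r \<preceq> q"
    using p q le_total[of p q] le_refl by metis
  have "P y" if y: "y \<in>\<^sub>M K" "x \<prec> y \<oplus> r" "y \<prec> x \<oplus> r" for y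
  proof (rule ab(5)[OF y(1)])
    have "x \<prec> y \<oplus> p" by (rule less_le_trans[OF y(2)]) (use y r p x in simp_all)
    then show "a \<prec> y" using p ab(1) y(1) by simp
    show "y \<prec> b" by (rule less_le_trans[OF y(3)]) (use y r q x in simp_all)
  qed
  then show ?thesis using r(1,2) by blast
qed

lemma open_real_iff: "open_real R S \<longleftrightarrow> elts S \<subseteq> elts K \<and> openR (\<lambda>t. t \<in>\<^sub>M S)"
proof
  assume S: "open_real R S"
  have "openR (\<lambda>t. t \<in>\<^sub>M S)"
  proof (rule openRI)
    fix x assume x: "x \<in>\<^sub>M K" "x \<in>\<^sub>M S"
    then obtain r where "r \<in> elts K" "\<zero> \<prec> r" "\<forall>y\<in>elts K. absdiff R x y \<prec> r \<longrightarrow> y \<in>\<^sub>M S"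
      using S unfolding open_real_def by (metis mem_elts)
    then have r: "r \<in>\<^sub>M K" "\<zero> \<prec> r"
      "\<And>y. y \<in>\<^sub>M K \<Longrightarrow> x \<prec> y \<oplus> r \<Longrightarrow> y \<prec> x \<oplus> r \<Longrightarrow> y \<in>\<^sub>M S"
      using x by (auto simp: absdiff_eq_dist dist_less_iff)
    obtain a where a: "a \<in>\<^sub>M K" "x = a \<oplus> r" using ex_diff'[OF r(1) x(1)] by auto
    show "\<exists>a b. a \<in>\<^sub>M K \<and> b \<in>\<^sub>M K \<and> a \<prec> x \<and> x \<prec> b \<and>
        (\<forall>y. y \<in>\<^sub>M K \<longrightarrow> a \<prec> y \<longrightarrow> y \<prec> b \<longrightarrow> y \<in>\<^sub>M S)"
      using x r(1,2) a
      by (intro exI[of _ a] exI[of _ "x \<oplus> r"] conjI allI impI r(3)) simp_all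
  qed
  then show "elts S \<subseteq> elts K \<and> openR (\<lambda>t. t \<in>\<^sub>M S)" using S by (simp add: open_real_def)
next
  assume S: "elts S \<subseteq> elts K \<and> openR (\<lambda>t. t \<in>\<^sub>M S)"
  have "\<exists>r\<in>elts K. \<zero> \<prec> r \<and> (\<forall>y\<in>elts K. absdiff R x y \<prec> r \<longrightarrow> y \<in>\<^sub>M S)"
    if mem: "x \<in>\<^sub>M S" for x
  proof -
    have x: "x \<in>\<^sub>M K" using S mem by auto
    obtain r where r: "r \<in>\<^sub>M K" "\<zero> \<prec> r"
      "\<forall>y. y \<in>\<^sub>M K \<longrightarrow> x \<prec> y \<oplus> r \<longrightarrow> y \<prec> x \<oplus> r \<longrightarrow> y \<in>\<^sub>M S"
      using openR_ball[of "\<lambda>t. t \<in>\<^sub>M S" x] S x mem by blast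
    show ?thesis
    proof (intro bexI[of _ r] conjI ballI impI)
      fix y assume y: "y \<in> elts K" "absdiff R x y \<prec> r"
      then have "dist_R x y \<prec> r" using x by (simp add: absdiff_eq_dist)
      then show "y \<in>\<^sub>M S" using r(3)[rule_format, of y] x y(1) r(1) by (simp add: dist_less_iff)
    qed (use r in simp_all)
  qed
  then show "open_real R S" using S by (simp add: open_real_def)
qed

text \<open>Continuity is tested on open rays, a subbase of the line. Taking a definable HOL
  function instead of an element of the model lets functions be combined as HOL terms.\<close>

definition cts :: "('m \<Rightarrow> 'm) \<Rightarrow> bool" where
  "cts \<phi> \<longleftrightarrow> definable_fun (\<lambda>e. \<phi> (e 0)) \<and> (\<forall>x\<in>elts X. \<phi> x \<in>\<^sub>M K) \<and>
     (\<forall>c\<in>elts K. open_in T {x \<in> elts X. c \<prec> \<phi> x} \<and> open_in T {x \<in> elts X. \<phi> x \<prec> c})"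

lemma ctsD:
  assumes "cts \<phi>"
  shows "definable_fun (\<lambda>e. \<phi> (e 0))" "x \<in>\<^sub>M X \<Longrightarrow> \<phi> x \<in>\<^sub>M K"
    "c \<in>\<^sub>M K \<Longrightarrow> open_in T {x \<in> elts X. c \<prec> \<phi> x}" "c \<in>\<^sub>M K \<Longrightarrow> open_in T {x \<in> elts X. \<phi> x \<prec> c}"
  using assms by (auto simp: cts_def)

text \<open>Around each point the preimage contains the intersection of two preimages of rays, and
  \<open>open_in_local\<close> assembles these neighbourhoods.\<close>

lemma cts_open:
  assumes \<phi>: "cts \<phi>" and P: "openR P" "definable (\<lambda>e. P (e 0))"
  shows "open_in T {x \<in> elts X. P (\<phi> x)}"
proof (rule open_in_local)
  show "definable (\<lambda>e. P (\<phi> (e 0)))" by (rule definable_comp[OF P(2) ctsD(1)[OF \<phi>]])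
  fix x assume x: "x \<in>\<^sub>M X" "P (\<phi> x)"
  obtain a b where ab: "a \<in>\<^sub>M K" "b \<in>\<^sub>M K" "a \<prec> \<phi> x" "\<phi> x \<prec> b"
    "\<And>y. y \<in>\<^sub>M K \<Longrightarrow> a \<prec> y \<Longrightarrow> y \<prec> b \<Longrightarrow> P y"
    using openRE[OF P(1) ctsD(2)[OF \<phi> x(1)] x(2)] by metis
  have "open_in T ({x \<in> elts X. a \<prec> \<phi> x} \<inter> {x \<in> elts X. \<phi> x \<prec> b})"
    using ctsD(3,4)[OF \<phi>] ab(1,2) by (intro open_in_Int)
  then show "\<exists>U. open_in T U \<and> x \<in> U \<and> (\<forall>y\<in>U. P (\<phi> y))"
    using x(1) ab ctsD(2)[OF \<phi>] by (intro exI conjI) auto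
qed

lemma C_fun_cts:
  assumes f: "f \<in> C_fun R X T" shows "cts (ap f)"
proof -
  have f_funs: "f \<in> funs X K" and pre: "\<And>S. open_real R S \<Longrightarrow> open_in T (preimage X f S)"
    using f by (auto simp: C_fun_def)
  have *: "open_in T {x \<in> elts X. P (ap f x)}" if P: "openR P" "definable (\<lambda>e. P (e 0))" for P
  proof -
    obtain S where S: "elts S = {t \<in> elts K. P t}" using separation_definable[OF P(2)] by metis
    then have mem: "t \<in>\<^sub>M S \<longleftrightarrow> t \<in>\<^sub>M K \<and> P t" for t by (simp add: set_eq_iff)
    have "open_real R S" using P(1) by (auto simp: open_real_iff openR_def mem)
    from pre[OF this] show ?thesis
      using funs_ap[OF f_funs] by (simp add: preimage_def mem cong: conj_cong)
  qed
  show ?thesis unfolding cts_def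
  proof (intro conjI ballI)
    show "definable_fun (\<lambda>e. ap f (e 0))" by (intro definable_R_intros)
    show "ap f x \<in>\<^sub>M K" if "x \<in> elts X" for x using funs_ap[OF f_funs] that by simp
    show "open_in T {x \<in> elts X. c \<prec> ap f x}" if "c \<in> elts K" for c
      using that by (intro *) (auto intro: openR_greater definable_R_intros)
    show "open_in T {x \<in> elts X. ap f x \<prec> c}" if "c \<in> elts K" for c
      using that by (intro *) (auto intro: openR_less definable_R_intros)
  qed
qed

lemma cts_C_fun:
  assumes \<phi>: "cts \<phi>" shows "\<exists>f\<in>C_fun R X T. \<forall>x\<in>elts X. ap f x = \<phi> x \<and> app f x = \<phi> x"
proof -
  obtain f where f: "f \<in> funs X K" "\<forall>x\<in>elts X. ap f x = \<phi> x \<and> app f x = \<phi> x"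
    using funs_definable[of \<phi> X K] ctsD(1,2)[OF \<phi>] by blast
  have "open_in T (preimage X f S)" if "open_real R S" for S
  proof -
    have "open_in T {x \<in> elts X. \<phi> x \<in>\<^sub>M S}"
      using that by (intro cts_open[OF \<phi>] definable_intros) (simp add: open_real_iff)
    then show ?thesis using f(2) by (simp add: preimage_def cong: conj_cong)
  qed
  then show ?thesis using f by (intro bexI[of _ f]) (auto simp: C_fun_def)
qed

lemma zero_sets_iff: "Z \<in> zero_sets R X T \<longleftrightarrow> (\<exists>\<phi>. cts \<phi> \<and> Z = {x \<in> elts X. \<phi> x = \<zero>})"
proof
  assume "Z \<in> zero_sets R X T"
  then obtain f where f: "f \<in> C_fun R X T" "Z = {x \<in> elts X. app f x = \<zero>}"
    by (auto simp: zero_sets_def)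
  then have "f \<in> funs X K" by (simp add: C_fun_def)
  then have "Z = {x \<in> elts X. ap f x = \<zero>}" using f(2) funs_ap(3) by auto
  then show "\<exists>\<phi>. cts \<phi> \<and> Z = {x \<in> elts X. \<phi> x = \<zero>}" using C_fun_cts[OF f(1)] by blast
next
  assume "\<exists>\<phi>. cts \<phi> \<and> Z = {x \<in> elts X. \<phi> x = \<zero>}"
  then obtain \<phi> where \<phi>: "cts \<phi>" "Z = {x \<in> elts X. \<phi> x = \<zero>}" by blast
  then obtain f where f: "f \<in> C_fun R X T" "\<forall>x\<in>elts X. app f x = \<phi> x" using cts_C_fun by blast
  then have "Z = {x \<in> elts X. app f x = \<zero>}" using \<phi> by auto
  then show "Z \<in> zero_sets R X T" using f(1) by (auto simp: zero_sets_def)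
qed

section \<open>Arithmetic of continuous functions\<close>

lemma cts_const: assumes "a \<in>\<^sub>M K" shows "cts (\<lambda>x. a)"
proof -
  have "open_in T {x \<in> elts X. b}" for b
    using open_in_empty open_in_space by (cases b) (simp_all add: elts_def)
  then show ?thesis unfolding cts_def using assms by (auto intro: definable_intros)
qed

lemma cts_uminus: assumes \<phi>: "cts \<phi>" shows "cts (\<lambda>x. \<ominus> (\<phi> x))"
  unfolding cts_def
proof (intro conjI ballI)
  show "definable_fun (\<lambda>e. \<ominus> (\<phi> (e 0)))" by (intro definable_R_intros ctsD(1)[OF \<phi>])
  fix c assume c: "c \<in> elts K"
  have "{x \<in> elts X. c \<prec> \<ominus> (\<phi> x)} = {x \<in> elts X. \<phi> x \<prec> \<ominus> c}"
    using c ctsD(2)[OF \<phi>] less_uminus_iff by auto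
  then show "open_in T {x \<in> elts X. c \<prec> \<ominus> (\<phi> x)}" using ctsD(4)[OF \<phi>, of "\<ominus> c"] c by simp
  have "{x \<in> elts X. \<ominus> (\<phi> x) \<prec> c} = {x \<in> elts X. \<ominus> c \<prec> \<phi> x}"
    using c ctsD(2)[OF \<phi>] uminus_less_iff by auto
  then show "open_in T {x \<in> elts X. \<ominus> (\<phi> x) \<prec> c}" using ctsD(3)[OF \<phi>, of "\<ominus> c"] c by simp
qed (use ctsD(2)[OF \<phi>] in simp)

lemma uminus_plus_distrib:
  assumes "x \<in>\<^sub>M K" "y \<in>\<^sub>M K" shows "\<ominus> (x \<oplus> y) = \<ominus> x \<oplus> \<ominus> y"
proof (rule uminus_unique[symmetric])
  have "x \<oplus> y \<oplus> (\<ominus> x \<oplus> \<ominus> y) = (x \<oplus> \<ominus> x) \<oplus> (y \<oplus> \<ominus> y)"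
    using assms by (simp only: plus_ac uminus_closed plus_closed)
  then show "x \<oplus> y \<oplus> (\<ominus> x \<oplus> \<ominus> y) = \<zero>" using assms by simp
qed (use assms in simp_all)

lemma cts_plus: assumes \<phi>: "cts \<phi>" and \<psi>: "cts \<psi>" shows "cts (\<lambda>x. \<phi> x \<oplus> \<psi> x)"
proof -
  \<comment> \<open>Stated for arbitrary summands, so that the opposite rays follow by applying it
    to the negatives.\<close>
  have above: "open_in T {x \<in> elts X. c \<prec> \<phi> x \<oplus> \<psi> x}"
    if \<phi>: "cts \<phi>" and \<psi>: "cts \<psi>" and c: "c \<in>\<^sub>M K" for \<phi> \<psi> c
  proof (rule open_in_local)
    show "definable (\<lambda>e. c \<prec> \<phi> (e 0) \<oplus> \<psi> (e 0))"
      by (intro definable_R_intros ctsD(1)[OF \<phi>] ctsD(1)[OF \<psi>])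
    fix x assume x: "x \<in>\<^sub>M X" "c \<prec> \<phi> x \<oplus> \<psi> x"
    note K = ctsD(2)[OF \<phi>] ctsD(2)[OF \<psi>]
    \<comment> \<open>The excess r of the sum over c is split evenly: lowering both values by h =
      r/2 gives bounds a and b with a + b = c.\<close>
    obtain r where r: "r \<in>\<^sub>M K" "\<zero> \<prec> r" "\<phi> x \<oplus> \<psi> x = c \<oplus> r"
      using ex_diff_pos[OF x(2)] K x c by auto
    define h where "h = half r"
    have h: "h \<in>\<^sub>M K" "\<zero> \<prec> h" "h \<oplus> h = r" using r half_pos by (auto simp: h_def)
    obtain a where a: "a \<in>\<^sub>M K" "\<phi> x = a \<oplus> h" using ex_diff'[OF h(1) K(1)[OF x(1)]] by auto
    obtain b where b: "b \<in>\<^sub>M K" "\<psi> x = b \<oplus> h" using ex_diff'[OF h(1) K(2)[OF x(1)]] by auto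
    have "a \<oplus> b \<oplus> (h \<oplus> h) = (a \<oplus> h) \<oplus> (b \<oplus> h)"
      using a(1) b(1) h(1) by (simp only: plus_ac plus_closed)
    then have "a \<oplus> b \<oplus> r = c \<oplus> r" using a(2) b(2) h(3) r(3) by metis
    then have c_eq: "c = a \<oplus> b" using a b c r by simp
    have "open_in T ({x \<in> elts X. a \<prec> \<phi> x} \<inter> {x \<in> elts X. b \<prec> \<psi> x})"
      using ctsD(3)[OF \<phi> a(1)] ctsD(3)[OF \<psi> b(1)] by (rule open_in_Int)
    moreover have "a \<prec> \<phi> x" "b \<prec> \<psi> x" unfolding a(2) b(2) using a(1) b(1) h by simp_all
    moreover have "c \<prec> \<phi> y \<oplus> \<psi> y" if "y \<in>\<^sub>M X" "a \<prec> \<phi> y" "b \<prec> \<psi> y" for y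
      unfolding c_eq using that a(1) b(1) K by (intro plus_less_mono) simp_all
    ultimately show "\<exists>U. open_in T U \<and> x \<in> U \<and> (\<forall>y\<in>U. c \<prec> \<phi> y \<oplus> \<psi> y)"
      using x(1) by (intro exI conjI) auto
  qed
  show ?thesis unfolding cts_def
  proof (intro conjI ballI)
    show "definable_fun (\<lambda>e. \<phi> (e 0) \<oplus> \<psi> (e 0))"
      by (intro definable_R_intros ctsD(1)[OF \<phi>] ctsD(1)[OF \<psi>])
    show "\<phi> x \<oplus> \<psi> x \<in>\<^sub>M K" if "x \<in> elts X" for x using that ctsD(2)[OF \<phi>] ctsD(2)[OF \<psi>] by simp
    fix c assume c: "c \<in> elts K"
    then show "open_in T {x \<in> elts X. c \<prec> \<phi> x \<oplus> \<psi> x}" using above[OF \<phi> \<psi>] by simp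
    have "{x \<in> elts X. \<phi> x \<oplus> \<psi> x \<prec> c} = {x \<in> elts X. \<ominus> c \<prec> \<ominus> (\<phi> x) \<oplus> \<ominus> (\<psi> x)}"
      using c ctsD(2)[OF \<phi>] ctsD(2)[OF \<psi>] by (auto simp flip: uminus_plus_distrib)
    then show "open_in T {x \<in> elts X. \<phi> x \<oplus> \<psi> x \<prec> c}"
      using above[OF cts_uminus[OF \<phi>] cts_uminus[OF \<psi>], of "\<ominus> c"] c by simp
  qed
qed

lemma cts_times_const: assumes \<phi>: "cts \<phi>" and a: "a \<in>\<^sub>M K" shows "cts (\<lambda>x. a \<otimes> \<phi> x)"
proof -
  have pos: "cts (\<lambda>x. a \<otimes> \<phi> x)" if a: "a \<in>\<^sub>M K" "\<zero> \<prec> a" for a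
    unfolding cts_def
  proof (intro conjI ballI)
    show "definable_fun (\<lambda>e. a \<otimes> \<phi> (e 0))" by (intro definable_R_intros ctsD(1)[OF \<phi>])
    fix c assume c: "c \<in> elts K"
    have nz: "a \<noteq> \<zero>" using a by auto
    define d where "d = inverse_R a \<otimes> c"
    have d: "d \<in>\<^sub>M K" using a c nz inverse_closed by (simp add: d_def)
    have ad: "a \<otimes> d = c"
      using a c nz inverse_closed times_inverse by (simp add: d_def flip: times_assoc)
    have "{x \<in> elts X. c \<prec> a \<otimes> \<phi> x} = {x \<in> elts X. d \<prec> \<phi> x}"
      "{x \<in> elts X. a \<otimes> \<phi> x \<prec> c} = {x \<in> elts X. \<phi> x \<prec> d}"
      using times_less_cancel[OF a(2,1)] d ctsD(2)[OF \<phi>] by (auto simp flip: ad)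
    then show "open_in T {x \<in> elts X. c \<prec> a \<otimes> \<phi> x}" "open_in T {x \<in> elts X. a \<otimes> \<phi> x \<prec> c}"
      using ctsD(3,4)[OF \<phi> d] by simp_all
  qed (use a ctsD(2)[OF \<phi>] in simp)
  have "a = \<zero> \<or> \<zero> \<prec> a \<or> \<zero> \<prec> \<ominus> a"
    using a not_le[of \<zero> a] uminus_less_uminus[of \<zero> a] by (auto simp: less_def)
  \<comment> \<open>Laws such as 0 * t = 0 hold for t in the carrier, and values of
    \<open>\<phi>\<close> outside \<open>X\<close> may lie elsewhere; so functions are compared on
    \<open>X\<close> only.\<close>
  moreover have cong: "cts \<psi>" if "cts \<chi>" "definable_fun (\<lambda>e. \<psi> (e 0))" "\<And>x. x \<in>\<^sub>M X \<Longrightarrow> \<psi> x = \<chi> x" for \<psi> \<chi>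
    using that unfolding cts_def by (simp cong: conj_cong)
  have "definable_fun (\<lambda>e. a \<otimes> \<phi> (e 0))" by (intro definable_R_intros ctsD(1)[OF \<phi>])
  note cong = cong[OF _ this]
  show ?thesis
    using calculation
  proof (elim disjE)
    assume "a = \<zero>"
    then show ?thesis using ctsD(2)[OF \<phi>] by (intro cong[OF cts_const[of \<zero>]]) simp_all
  next
    assume "\<zero> \<prec> \<ominus> a"
    from pos[OF _ this] have "cts (\<lambda>x. \<ominus> a \<otimes> \<phi> x)" using a by simp
    from cong[OF cts_uminus[OF this]] show ?thesis
      using a ctsD(2)[OF \<phi>] by (simp add: uminus_times)
  qed (rule pos[OF a])
qed

lemma cts_abs: assumes \<phi>: "cts \<phi>" shows "cts (\<lambda>x. dist_R (\<phi> x) \<zero>)"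
  unfolding cts_def
proof (intro conjI ballI)
  show "definable_fun (\<lambda>e. dist_R (\<phi> (e 0)) \<zero>)"
    unfolding dist_R_def by (intro definable_R_intros ctsD(1)[OF \<phi>])
  fix c assume c: "c \<in> elts K"
  have "{x \<in> elts X. c \<prec> dist_R (\<phi> x) \<zero>} = {x \<in> elts X. c \<prec> \<phi> x} \<union> {x \<in> elts X. \<phi> x \<prec> \<ominus> c}"
  proof -
    have "c \<prec> dist_R t \<zero> \<longleftrightarrow> c \<prec> t \<or> t \<prec> \<ominus> c" if t: "t \<in>\<^sub>M K" for t
    proof -
      have "\<zero> \<preceq> t \<oplus> c \<longleftrightarrow> \<ominus> c \<preceq> t" using plus_le_right_cancel[of "\<ominus> c" t c] t c by simp
      then have "dist_R t \<zero> \<preceq> c \<longleftrightarrow> t \<preceq> c \<and> \<ominus> c \<preceq> t" using t c by (simp add: dist_le_iff)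
      then show ?thesis using t c not_le by (metis dist_closed mem_elts uminus_closed zero_closed)
    qed
    then show ?thesis using ctsD(2)[OF \<phi>] by auto
  qed
  then show "open_in T {x \<in> elts X. c \<prec> dist_R (\<phi> x) \<zero>}"
    using ctsD(3)[OF \<phi>, of c] ctsD(4)[OF \<phi>, of "\<ominus> c"] c by (simp add: open_in_Un)
  have "{x \<in> elts X. dist_R (\<phi> x) \<zero> \<prec> c} = {x \<in> elts X. \<phi> x \<prec> c} \<inter> {x \<in> elts X. \<ominus> c \<prec> \<phi> x}"
  proof -
    have "\<zero> \<prec> t \<oplus> c \<longleftrightarrow> \<ominus> c \<prec> t" if "t \<in>\<^sub>M K" for t
      using plus_less_cancel(1)[of "\<ominus> c" t c] that c by simp
    then show ?thesis using c ctsD(2)[OF \<phi>] by (auto simp: dist_less_iff)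
  qed
  then show "open_in T {x \<in> elts X. dist_R (\<phi> x) \<zero> \<prec> c}"
    using ctsD(4)[OF \<phi>, of c] ctsD(3)[OF \<phi>, of "\<ominus> c"] c by (simp add: open_in_Int)
qed (use ctsD(2)[OF \<phi>] in simp)

text \<open>As v > 0, the condition c < u/v is equivalent to 0 < u - c v, which reduces quotients to
  sums and constant multiples.\<close>

lemma cts_divide:
  assumes u: "cts u" and v: "cts v" and pos: "\<And>x. x \<in>\<^sub>M X \<Longrightarrow> \<zero> \<prec> v x"
  shows "cts (\<lambda>x. inverse_R (v x) \<otimes> u x)"
proof -
  note K = ctsD(2)[OF u] ctsD(2)[OF v]
  have inv: "inverse_R (v x) \<in>\<^sub>M K" "v x \<otimes> inverse_R (v x) = \<one>" if "x \<in>\<^sub>M X" for x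
    using inverse_closed[of "v x"] times_inverse[of "v x"] pos[OF that] K(2)[OF that] by force+
  have vq: "v x \<otimes> (inverse_R (v x) \<otimes> u x) = u x" if "x \<in>\<^sub>M X" for x
    using inv[OF that] K[OF that] by (simp flip: times_assoc)
  show ?thesis unfolding cts_def
  proof (intro conjI ballI)
    show "definable_fun (\<lambda>e. inverse_R (v (e 0)) \<otimes> u (e 0))"
      by (intro definable_R_intros ctsD(1)[OF u] ctsD(1)[OF v])
    fix c assume c: "c \<in> elts K"
    let ?w = "\<lambda>x. u x \<oplus> \<ominus> (c \<otimes> v x)"
    have w: "cts ?w" using c by (intro cts_plus u cts_uminus cts_times_const v) simp
    have less: "c \<prec> inverse_R (v x) \<otimes> u x \<longleftrightarrow> \<zero> \<prec> ?w x" "inverse_R (v x) \<otimes> u x \<prec> c \<longleftrightarrow> ?w x \<prec> \<zero>"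
      if x: "x \<in>\<^sub>M X" for x
    proof -
      have w_eq: "?w x \<oplus> c \<otimes> v x = u x" using c K[OF x] by (simp add: plus_assoc)
      have cv: "v x \<otimes> c = c \<otimes> v x" using c K[OF x] by (simp add: times_comm)
      have "c \<prec> inverse_R (v x) \<otimes> u x \<longleftrightarrow> c \<otimes> v x \<prec> u x"
        using times_less_cancel[OF pos[OF x] K(2)[OF x], of c "inverse_R (v x) \<otimes> u x"]
          inv[OF x] K[OF x] c by (simp add: vq[OF x] cv)
      also have "\<dots> \<longleftrightarrow> \<zero> \<oplus> c \<otimes> v x \<prec> ?w x \<oplus> c \<otimes> v x" unfolding w_eq using c K[OF x] by simp
      also have "\<dots> \<longleftrightarrow> \<zero> \<prec> ?w x" using c K[OF x] by (intro plus_less_cancel) simp_all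
      finally show "c \<prec> inverse_R (v x) \<otimes> u x \<longleftrightarrow> \<zero> \<prec> ?w x" .
      have "inverse_R (v x) \<otimes> u x \<prec> c \<longleftrightarrow> u x \<prec> c \<otimes> v x"
        using times_less_cancel[OF pos[OF x] K(2)[OF x], of "inverse_R (v x) \<otimes> u x" c]
          inv[OF x] K[OF x] c by (simp add: vq[OF x] cv)
      also have "\<dots> \<longleftrightarrow> ?w x \<oplus> c \<otimes> v x \<prec> \<zero> \<oplus> c \<otimes> v x" unfolding w_eq using c K[OF x] by simp
      also have "\<dots> \<longleftrightarrow> ?w x \<prec> \<zero>" using c K[OF x] by (intro plus_less_cancel) simp_all
      finally show "inverse_R (v x) \<otimes> u x \<prec> c \<longleftrightarrow> ?w x \<prec> \<zero>" .
    qed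
    show "open_in T {x \<in> elts X. c \<prec> inverse_R (v x) \<otimes> u x}"
      "open_in T {x \<in> elts X. inverse_R (v x) \<otimes> u x \<prec> c}"
      using ctsD(3,4)[OF w zero_closed] less by (simp_all cong: conj_cong)
  qed (use inv K in simp)
qed

end

section \<open>Sequences of reals indexed by the internal natural numbers\<close>

context real_line_model
begin

lemma definable_comp2:
  assumes "definable (\<lambda>e. P (e 0) (e (Suc 0)))" "definable_fun t" "definable_fun u"
  shows "definable (\<lambda>e. P (t e) (u e))"
proof -
  have "definable (\<lambda>e. P (e (Suc 0)) (e 0))"
    using definable_rename[OF assms(1), of "case_nat (Suc 0) (\<lambda>_. 0)"] by simp
  from definable_rename[OF this, of "case_nat 0 (\<lambda>_. i)" for i]
  have "definable (\<lambda>e. P (e i) (e 0))" for i by simp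
  then have *: "definable (\<lambda>e. P (e 0) (u (\<lambda>i. e (Suc i))))"
    using definable_subst[of "\<lambda>y e. P (e 0) y" "\<lambda>e. u (\<lambda>i. e (Suc i))"]
      definable_fun_rename[OF assms(3)] by simp
  show ?thesis by (rule definable_subst[of "\<lambda>x e. P x (u e)", OF * assms(2)])
qed

lemma definable_dist:
  "definable_fun t \<Longrightarrow> definable_fun u \<Longrightarrow> definable_fun (\<lambda>e. dist_R (t e) (u e))"
  unfolding dist_R_def by (intro definable_R_intros)

text \<open>These are the powers of 1/2, with internal exponents. They tend to 0 by completeness:
  their greatest lower bound s would satisfy 2s \<le> s.\<close>

lemma null_sequence:
  obtains \<epsilon> where "definable_fun (\<lambda>e. \<epsilon> (e 0))" "\<And>n. n \<in>\<^sub>M \<omega> \<Longrightarrow> \<epsilon> n \<in>\<^sub>M K"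
    "\<And>n. n \<in>\<^sub>M \<omega> \<Longrightarrow> \<zero> \<prec> \<epsilon> n" "\<And>r. r \<in>\<^sub>M K \<Longrightarrow> \<zero> \<prec> r \<Longrightarrow> \<exists>n\<in>elts \<omega>. \<epsilon> n \<preceq> r"
proof -
  \<comment> \<open>Recursing in the set of positive reals, which halving preserves, gives
    positivity of all terms at once.\<close>
  define P where "P = coll K (\<lambda>x. \<zero> \<prec> x)"
  have P: "x \<in>\<^sub>M P \<longleftrightarrow> x \<in>\<^sub>M K \<and> \<zero> \<prec> x" for x
    unfolding P_def by (rule mem_coll) (intro definable_R_intros)
  obtain \<epsilon> where \<epsilon>: "definable_fun (\<lambda>e. \<epsilon> (e 0))" "\<epsilon> emp = \<one>"
    "\<And>n. n \<in>\<^sub>M \<omega> \<Longrightarrow> \<epsilon> (succ n) = half (\<epsilon> n)" "\<And>n. n \<in>\<^sub>M \<omega> \<Longrightarrow> \<epsilon> n \<in>\<^sub>M P"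
  proof (rule omega_recursion[of half P \<one>])
    show "definable_fun (\<lambda>e. half (e 0))" by (intro definable_R_intros)
  qed (simp_all add: P half_pos)
  have \<epsilon>K: "\<epsilon> n \<in>\<^sub>M K" "\<zero> \<prec> \<epsilon> n" if "n \<in>\<^sub>M \<omega>" for n using \<epsilon>(4)[OF that] by (simp_all add: P)
  have "\<exists>n\<in>elts \<omega>. \<epsilon> n \<preceq> r" if r: "r \<in>\<^sub>M K" "\<zero> \<prec> r" for r
  proof (rule ccontr)
    assume "\<not> (\<exists>n\<in>elts \<omega>. \<epsilon> n \<preceq> r)"
    then have above: "r \<preceq> \<epsilon> n" if "n \<in>\<^sub>M \<omega>" for n
      using that r(1) \<epsilon>K(1)[OF that] not_le[of "\<epsilon> n" r] less_imp_le[of r "\<epsilon> n"] by auto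
    have "definable (\<lambda>e. \<forall>n\<in>elts \<omega>. e 0 \<preceq> \<epsilon> n)"
      by (intro definable_R_intros definable_fun_comp[OF \<epsilon>(1)])
    \<comment> \<open>The infimum of the sequence, taken as the supremum of its lower
      bounds.\<close>
    then obtain s where s: "s \<in>\<^sub>M K" "\<And>x. x \<in>\<^sub>M K \<Longrightarrow> \<forall>n\<in>elts \<omega>. x \<preceq> \<epsilon> n \<Longrightarrow> x \<preceq> s"
      "\<And>b. b \<in>\<^sub>M K \<Longrightarrow> (\<And>x. x \<in>\<^sub>M K \<Longrightarrow> \<forall>n\<in>elts \<omega>. x \<preceq> \<epsilon> n \<Longrightarrow> x \<preceq> b) \<Longrightarrow> s \<preceq> b"
      by (rule sup_exists[of _ r "\<epsilon> emp"]) (use above r \<epsilon>K in auto)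
    have s_le: "s \<preceq> \<epsilon> n" if "n \<in>\<^sub>M \<omega>" for n using that \<epsilon>K by (intro s(3)) auto
    have "s \<oplus> s \<preceq> \<epsilon> n" if n: "n \<in>\<^sub>M \<omega>" for n
    proof -
      have "s \<oplus> s \<preceq> half (\<epsilon> n) \<oplus> half (\<epsilon> n)"
        using s_le[of "succ n"] n s(1) \<epsilon>K[OF n] by (intro plus_le_mono) (simp_all add: \<epsilon>(3))
      then show ?thesis using \<epsilon>K[OF n] by simp
    qed
    then have "s \<oplus> s \<preceq> s" using s(1) by (intro s(2)) auto
    then have "s \<preceq> \<zero>" using s(1) plus_le_left_cancel[of s \<zero> s] by simp
    moreover have "r \<preceq> s" using above r(1) by (intro s(2)) auto
    ultimately show False using r s(1) not_less[of \<zero> r] le_trans[of r s \<zero>] by auto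
  qed
  then show ?thesis using that[of \<epsilon>] \<epsilon>(1) \<epsilon>K by blast
qed

text \<open>The sequence \<open>0, \<delta>, -\<delta>, 2\<delta>, -2\<delta>, \<dots>\<close>\<close>

lemma net_sequence:
  assumes \<delta>: "\<delta> \<in>\<^sub>M K" "\<zero> \<prec> \<delta>"
  obtains \<nu> where "definable_fun (\<lambda>e. \<nu> (e 0))" "\<And>n. n \<in>\<^sub>M \<omega> \<Longrightarrow> \<nu> n \<in>\<^sub>M K"
    "\<And>t. t \<in>\<^sub>M K \<Longrightarrow> \<exists>n\<in>elts \<omega>. \<nu> n \<preceq> t \<oplus> \<delta> \<and> t \<preceq> \<nu> n \<oplus> \<delta>"
proof -
  \<comment> \<open>Positive x go to -x, all others to \<delta> - x; so one step function serves
    both signs and plain recursion suffices.\<close>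
  let ?f = "\<lambda>x. if \<zero> \<prec> x then \<ominus> x else \<delta> \<oplus> \<ominus> x"
  obtain \<nu> where \<nu>: "definable_fun (\<lambda>e. \<nu> (e 0))" "\<nu> emp = \<zero>"
    "\<And>n. n \<in>\<^sub>M \<omega> \<Longrightarrow> \<nu> (succ n) = ?f (\<nu> n)" "\<And>n. n \<in>\<^sub>M \<omega> \<Longrightarrow> \<nu> n \<in>\<^sub>M K"
  proof (rule omega_recursion[of ?f K \<zero>])
    show "definable_fun (\<lambda>e. ?f (e 0))" by (intro definable_R_intros)
  qed (use \<delta> in simp_all)
  define N where "N x \<longleftrightarrow> (\<exists>n\<in>elts \<omega>. \<nu> n = x)" for x
  have NK: "x \<in>\<^sub>M K" if "N x" for x using that \<nu>(4) by (auto simp: N_def)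
  have N0: "N \<zero>" using \<nu>(2) emp_omega by (auto simp: N_def)
  have Nf: "N (?f x)" if x: "N x" for x
  proof -
    obtain n where "n \<in>\<^sub>M \<omega>" "\<nu> n = x" using x by (auto simp: N_def)
    then show ?thesis unfolding N_def using \<nu>(3)[of n] by (intro bexI[of _ "succ n"]) simp_all
  qed
  have N_uminus: "N (\<ominus> x)" if "N x" "\<zero> \<preceq> x" for x
    using Nf[OF that(1)] that N0 by (cases "x = \<zero>") (simp_all add: less_def)
  \<comment> \<open>Two steps lead from x > 0 through -x to x + \<delta>; from 0 a single step
    does.\<close>
  have N_plus: "N (x \<oplus> \<delta>)" if x: "N x" "\<zero> \<preceq> x" for x
  proof (cases "x = \<zero>")
    case True
    then show ?thesis using Nf[OF N0] \<delta> by simp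
  next
    case False
    then have "\<not> \<zero> \<prec> \<ominus> x"
      using x NK[OF x(1)] not_less[of \<zero> "\<ominus> x"] uminus_le_uminus[of x \<zero>] by simp
    then show ?thesis using Nf[OF N_uminus[OF x]] NK[OF x(1)] \<delta> by (simp add: plus_comm)
  qed
  \<comment> \<open>The Archimedean argument: otherwise the non-negative terms up to t would be
    closed under adding \<delta>, and with their supremum s also s - \<delta> would bound
    them.\<close>
  have cover: "\<exists>x. N x \<and> \<zero> \<preceq> x \<and> x \<preceq> t \<and> t \<prec> x \<oplus> \<delta>" if t: "t \<in>\<^sub>M K" "\<zero> \<preceq> t" for t
  proof (rule ccontr)
    assume *: "\<not> (\<exists>x. N x \<and> \<zero> \<preceq> x \<and> x \<preceq> t \<and> t \<prec> x \<oplus> \<delta>)"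
    have step: "N (x \<oplus> \<delta>) \<and> \<zero> \<preceq> x \<oplus> \<delta> \<and> x \<oplus> \<delta> \<preceq> t" if x: "N x" "\<zero> \<preceq> x" "x \<preceq> t" for x
      using * x NK[OF x(1)] t \<delta> N_plus[OF x(1,2)] not_less[of t "x \<oplus> \<delta>"]
        le_trans[OF x(2), of "x \<oplus> \<delta>"] less_imp_le[OF \<delta>(2)] by auto
    have "definable (\<lambda>e. N (e 0) \<and> \<zero> \<preceq> e 0 \<and> e 0 \<preceq> t)"
      unfolding N_def by (intro definable_R_intros definable_fun_comp[OF \<nu>(1)])
    then obtain s where s: "s \<in>\<^sub>M K" "\<And>x. x \<in>\<^sub>M K \<Longrightarrow> N x \<and> \<zero> \<preceq> x \<and> x \<preceq> t \<Longrightarrow> x \<preceq> s"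
      "\<And>b. b \<in>\<^sub>M K \<Longrightarrow> (\<And>x. x \<in>\<^sub>M K \<Longrightarrow> N x \<and> \<zero> \<preceq> x \<and> x \<preceq> t \<Longrightarrow> x \<preceq> b) \<Longrightarrow> s \<preceq> b"
      by (rule sup_exists[of _ \<zero> t]) (use N0 t in auto)
    obtain q where q: "q \<in>\<^sub>M K" "s = q \<oplus> \<delta>" using ex_diff'[OF \<delta>(1) s(1)] by auto
    have "s \<preceq> q"
    proof (rule s(3)[OF q(1)])
      fix x assume x: "x \<in>\<^sub>M K" "N x \<and> \<zero> \<preceq> x \<and> x \<preceq> t"
      then have "x \<oplus> \<delta> \<preceq> s" using step[of x] \<delta> by (intro s(2)) auto
      then show "x \<preceq> q" using q x \<delta> by simp
    qed
    then show False using q \<delta> not_le[of "q \<oplus> \<delta>" q] by simp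
  qed
  have "\<exists>x. N x \<and> x \<preceq> t \<oplus> \<delta> \<and> t \<preceq> x \<oplus> \<delta>" if t: "t \<in>\<^sub>M K" for t
  proof (cases "\<zero> \<preceq> t")
    case True
    then obtain x where x: "N x" "x \<preceq> t" "t \<prec> x \<oplus> \<delta>" using cover[OF t] by auto
    have "x \<preceq> t \<oplus> \<delta>"
      using le_trans[OF x(2), of "t \<oplus> \<delta>"] NK[OF x(1)] t \<delta> less_imp_le[OF \<delta>(2)] by simp
    then show ?thesis using x less_imp_le by blast
  next
    case False
    then have "\<zero> \<preceq> \<ominus> t" using t not_le[of \<zero> t] uminus_le_uminus[of \<zero> t] less_imp_le by simp
    then obtain x where x: "N x" "\<zero> \<preceq> x" "x \<preceq> \<ominus> t" "\<ominus> t \<prec> x \<oplus> \<delta>" using cover[of "\<ominus> t"] t by auto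
    note xK = NK[OF x(1)]
    have "t \<preceq> \<ominus> x" using uminus_le_uminus[of "\<ominus> t" x] x(3) xK t by simp
    then have 1: "t \<preceq> \<ominus> x \<oplus> \<delta>"
      using le_trans[of t "\<ominus> x" "\<ominus> x \<oplus> \<delta>"] xK t \<delta> less_imp_le[OF \<delta>(2)] by simp
    have "\<ominus> t \<oplus> (t \<oplus> \<ominus> x) \<preceq> x \<oplus> \<delta> \<oplus> (t \<oplus> \<ominus> x)"
      using x(4) xK t \<delta> less_imp_le by simp
    moreover have "\<ominus> t \<oplus> (t \<oplus> \<ominus> x) = \<ominus> x" using xK t by (simp flip: plus_assoc)
    moreover have "x \<oplus> \<delta> \<oplus> (t \<oplus> \<ominus> x) = (t \<oplus> \<delta>) \<oplus> (x \<oplus> \<ominus> x)"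
      using xK t \<delta> by (simp only: plus_ac plus_closed uminus_closed)
    ultimately have "\<ominus> x \<preceq> t \<oplus> \<delta>" using xK t \<delta> by simp
    then show ?thesis using 1 N_uminus[OF x(1,2)] by blast
  qed
  then show ?thesis using that[of \<nu>] \<nu>(1,4) unfolding N_def by blast
qed

end

context real_space_model
begin

text \<open>
  The zero set is that of \<open>d \<circ> \<phi>\<close>, where \<open>d t\<close> is the largest \<open>r \<le> 1\<close> such that \<open>P\<close> holds on the
  interval \<open>(t - r, t + r)\<close>; this \<open>d\<close> is 1-Lipschitz and vanishes exactly off \<open>P\<close>.
\<close>

lemma zero_set_closed_preimage:
  assumes \<phi>: "cts \<phi>" and P: "openR P" "definable (\<lambda>e. P (e 0))"
  shows "{x \<in> elts X. \<not> P (\<phi> x)} \<in> zero_sets R X T"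
proof -
  \<comment> \<open>The bound 1 keeps the supremum finite when \<open>P\<close> holds everywhere;
    radius 0 always qualifies because its interval is empty.\<close>
  define Q where "Q t r \<longleftrightarrow> \<zero> \<preceq> r \<and> r \<preceq> \<one> \<and> (\<forall>y\<in>elts K. t \<prec> y \<oplus> r \<and> y \<prec> t \<oplus> r \<longrightarrow> P y)" for t r
  define S where "S t s \<longleftrightarrow> s \<in>\<^sub>M K \<and> (\<forall>r\<in>elts K. Q t r \<longrightarrow> r \<preceq> s) \<and>
    (\<forall>b\<in>elts K. (\<forall>r\<in>elts K. Q t r \<longrightarrow> r \<preceq> b) \<longrightarrow> s \<preceq> b)" for t s
  define d where "d t = the1 (S t)" for t
  have d_def': "definable_fun (\<lambda>e. d (e 0))"
    unfolding d_def S_def Q_def by (intro definable_R_intros definable_comp[OF P(2)])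
  have Q0: "Q t \<zero>" if "t \<in>\<^sub>M K" for t
  proof -
    have "\<not> (t \<prec> y \<and> y \<prec> t)" if "y \<in>\<^sub>M K" for y
      using less_trans[of t y t] that \<open>t \<in>\<^sub>M K\<close> by auto
    then show ?thesis using that less_imp_le[OF zero_less_one] by (auto simp: Q_def)
  qed
  have S: "S t (d t)" if t: "t \<in>\<^sub>M K" for t
    unfolding d_def
  proof (rule the1I, rule ex_ex1I)
    have "definable (\<lambda>e. Q t (e 0))"
      unfolding Q_def by (intro definable_R_intros definable_comp[OF P(2)])
    then obtain s where "s \<in>\<^sub>M K" "\<And>x. x \<in>\<^sub>M K \<Longrightarrow> Q t x \<Longrightarrow> x \<preceq> s"
      "\<And>b. b \<in>\<^sub>M K \<Longrightarrow> (\<And>x. x \<in>\<^sub>M K \<Longrightarrow> Q t x \<Longrightarrow> x \<preceq> b) \<Longrightarrow> s \<preceq> b"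
      by (rule sup_exists[of _ \<zero> \<one>]) (use Q0[OF t] in \<open>auto simp: Q_def\<close>)
    then show "\<exists>s. S t s" unfolding S_def by auto
    show "s = s'" if "S t s" "S t s'" for s s'
      using that by (intro le_antisym) (auto simp: S_def)
  qed
  have dK: "d t \<in>\<^sub>M K" and d_upper: "\<And>r. r \<in>\<^sub>M K \<Longrightarrow> Q t r \<Longrightarrow> r \<preceq> d t"
    and d_least: "\<And>b. b \<in>\<^sub>M K \<Longrightarrow> (\<And>r. r \<in>\<^sub>M K \<Longrightarrow> Q t r \<Longrightarrow> r \<preceq> b) \<Longrightarrow> d t \<preceq> b" if "t \<in>\<^sub>M K" for t
    using S[OF that] by (auto simp: S_def)
  have d_nonneg: "\<zero> \<preceq> d t" if "t \<in>\<^sub>M K" for t using d_upper[OF that] Q0[OF that] by simp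
  have d_zero: "d t = \<zero> \<longleftrightarrow> \<not> P t" if t: "t \<in>\<^sub>M K" for t
  proof
    assume nP: "\<not> P t"
    have "d t \<preceq> \<zero>"
    proof (rule d_least[OF t])
      fix r assume r: "r \<in>\<^sub>M K" "Q t r"
      have "\<not> \<zero> \<prec> r"
      proof
        assume "\<zero> \<prec> r"
        then have "P t" using r t by (auto simp: Q_def)
        then show False using nP by simp
      qed
      then show "r \<preceq> \<zero>" using r not_less by simp
    qed simp
    then show "d t = \<zero>" using d_nonneg[OF t] dK[OF t] le_antisym by simp
  next
    assume d0: "d t = \<zero>"
    show "\<not> P t"
    proof
      assume "P t"
      then obtain r where r: "r \<in>\<^sub>M K" "\<zero> \<prec> r" "\<forall>y. y \<in>\<^sub>M K \<longrightarrow> t \<prec> y \<oplus> r \<longrightarrow> y \<prec> t \<oplus> r \<longrightarrow> P y"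
        using openR_ball[OF P(1) t] by blast
      obtain q where q: "q \<in>\<^sub>M K" "\<zero> \<prec> q" "q \<preceq> r" "q \<preceq> \<one>"
        using r le_total[of r \<one>] le_refl zero_less_one one_closed by metis
      have "P y" if y: "y \<in>\<^sub>M K" "t \<prec> y \<oplus> q" "y \<prec> t \<oplus> q" for y
        using less_le_trans[OF y(2), of "y \<oplus> r"] less_le_trans[OF y(3), of "t \<oplus> r"]
          y(1) t q(1,3) r(1) by (intro r(3)[rule_format]) simp_all
      then have "Q t q" using q less_imp_le by (auto simp: Q_def)
      then show False using d_upper[OF t q(1)] d0 q(1,2) not_le[of q \<zero>] by simp
    qed
  qed
  have lipschitz: "d t' \<preceq> d t \<oplus> h"
    if t: "t \<in>\<^sub>M K" "t' \<in>\<^sub>M K" and h: "h \<in>\<^sub>M K" and near: "t \<prec> t' \<oplus> h" "t' \<prec> t \<oplus> h" for t t' h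
  proof (rule d_least[OF t(2)])
    fix r assume r: "r \<in>\<^sub>M K" "Q t' r"
    show "r \<preceq> d t \<oplus> h"
    proof (cases "r \<preceq> h")
      case True
      have "h \<preceq> d t \<oplus> h" using plus_le_right_cancel[of \<zero> "d t" h] d_nonneg[OF t(1)] dK[OF t(1)] h by simp
      then show ?thesis using le_trans[OF True] r h dK[OF t(1)] by simp
    next
      case False
      \<comment> \<open>With q = r - h, the interval of radius q about t lies inside the interval of
        radius r about t'.\<close>
      then obtain q where q: "q \<in>\<^sub>M K" "\<zero> \<prec> q" "r = h \<oplus> q"
        using ex_diff_pos[of h r] not_le[of r h] r h by auto
      have h0: "\<zero> \<preceq> h"
      proof (rule ccontr)
        assume "\<not> \<zero> \<preceq> h"
        then have "h \<prec> \<zero>" using h not_le by simp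
        then have "t' \<oplus> h \<prec> t'" "t \<oplus> h \<prec> t"
          using t h plus_less_cancel(2)[of h \<zero> t] plus_less_cancel(2)[of h \<zero> t'] by simp_all
        then show False
          using near t h less_trans[of t "t' \<oplus> h" t'] less_trans[of t' "t \<oplus> h" t] less_trans[of t t' t]
          by simp
      qed
      have "q \<preceq> r" using q h h0 by (simp add: plus_comm[of h])
      moreover have "P y" if y: "y \<in>\<^sub>M K" "t \<prec> y \<oplus> q" "y \<prec> t \<oplus> q" for y
      proof -
        have "t' \<prec> y \<oplus> q \<oplus> h"
          by (rule less_trans[OF near(2)]) (use y t q h in simp_all)
        moreover have "y \<prec> t' \<oplus> h \<oplus> q"
          by (rule less_trans[OF y(3)]) (use y t q h near in simp_all)
        ultimately show ?thesis using r y t q h by (auto simp: Q_def plus_assoc plus_comm[of q h])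
      qed
      moreover have "r \<preceq> \<one>" using r by (simp add: Q_def)
      ultimately have "Q t q" using q r le_trans[of q r \<one>] less_imp_le by (auto simp: Q_def)
      then have "q \<preceq> d t" using d_upper[OF t(1) q(1)] by simp
      then show ?thesis using q h dK[OF t(1)] by (simp add: plus_comm[of h])
    qed
  qed (use dK[OF t(1)] h in simp)
  \<comment> \<open>The Lipschitz bound is not strict; working with r/2 makes room for strict
    inequalities.\<close>
  have nbhd: "\<exists>a b. a \<in>\<^sub>M K \<and> b \<in>\<^sub>M K \<and> a \<prec> t \<and> t \<prec> b \<and> (\<forall>y. y \<in>\<^sub>M K \<longrightarrow> a \<prec> y \<longrightarrow> y \<prec> b \<longrightarrow>
      d t \<prec> d y \<oplus> r \<and> d y \<prec> d t \<oplus> r)" if t: "t \<in>\<^sub>M K" and r: "r \<in>\<^sub>M K" "\<zero> \<prec> r" for t r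
  proof -
    have h: "half r \<in>\<^sub>M K" "\<zero> \<prec> half r" using r half_pos by simp_all
    have hr: "half r \<prec> r" using less_plus_iff[of "half r" "half r"] h r by simp
    obtain a where a: "a \<in>\<^sub>M K" "t = a \<oplus> half r" using ex_diff'[OF h(1) t] by auto
    have "d t \<prec> d y \<oplus> r \<and> d y \<prec> d t \<oplus> r" if y: "y \<in>\<^sub>M K" "a \<prec> y" "y \<prec> t \<oplus> half r" for y
    proof -
      have ty: "t \<prec> y \<oplus> half r" using a y h by simp
      show ?thesis
        using le_less_trans[OF lipschitz[OF t y(1) h(1) ty y(3)], of "d t \<oplus> r"]
          le_less_trans[OF lipschitz[OF y(1) t h(1) y(3) ty], of "d y \<oplus> r"]
          hr h r dK[OF t] dK[OF y(1)] by simp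
    qed
    moreover have "a \<prec> t" "t \<prec> t \<oplus> half r" using a h t by simp_all
    ultimately show ?thesis using a(1) h t by (intro exI[of _ a] exI[of _ "t \<oplus> half r"]) simp
  qed
  have above: "openR (\<lambda>t. c \<prec> d t)" if c: "c \<in>\<^sub>M K" for c
  proof (rule openRI)
    fix t assume t: "t \<in>\<^sub>M K" "c \<prec> d t"
    obtain r where r: "r \<in>\<^sub>M K" "\<zero> \<prec> r" "d t = c \<oplus> r" using ex_diff_pos[OF t(2) c dK[OF t(1)]] by auto
    have "c \<prec> d y" if "y \<in>\<^sub>M K" "d t \<prec> d y \<oplus> r" for y using that r c dK[OF that(1)] by simp
    then show "\<exists>a b. a \<in>\<^sub>M K \<and> b \<in>\<^sub>M K \<and> a \<prec> t \<and> t \<prec> b \<and>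
        (\<forall>y. y \<in>\<^sub>M K \<longrightarrow> a \<prec> y \<longrightarrow> y \<prec> b \<longrightarrow> c \<prec> d y)"
      using nbhd[OF t(1) r(1,2)] by meson
  qed
  have below: "openR (\<lambda>t. d t \<prec> c)" if c: "c \<in>\<^sub>M K" for c
  proof (rule openRI)
    fix t assume t: "t \<in>\<^sub>M K" "d t \<prec> c"
    obtain r where r: "r \<in>\<^sub>M K" "\<zero> \<prec> r" "c = d t \<oplus> r" using ex_diff_pos[OF t(2) dK[OF t(1)] c] by auto
    then show "\<exists>a b. a \<in>\<^sub>M K \<and> b \<in>\<^sub>M K \<and> a \<prec> t \<and> t \<prec> b \<and>
        (\<forall>y. y \<in>\<^sub>M K \<longrightarrow> a \<prec> y \<longrightarrow> y \<prec> b \<longrightarrow> d y \<prec> c)"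
      using nbhd[OF t(1) r(1,2)] by meson
  qed
  have "cts (\<lambda>x. d (\<phi> x))"
    unfolding cts_def
  proof (intro conjI ballI)
    show "definable_fun (\<lambda>e. d (\<phi> (e 0)))" by (rule definable_fun_comp[OF d_def' ctsD(1)[OF \<phi>]])
    show "open_in T {x \<in> elts X. c \<prec> d (\<phi> x)}" if "c \<in> elts K" for c
      using that by (intro cts_open[OF \<phi>] above definable_R_intros d_def') simp
    show "open_in T {x \<in> elts X. d (\<phi> x) \<prec> c}" if "c \<in> elts K" for c
      using that by (intro cts_open[OF \<phi>] below definable_R_intros d_def') simp
  qed (use dK ctsD(2)[OF \<phi>] in simp)
  moreover have "{x \<in> elts X. \<not> P (\<phi> x)} = {x \<in> elts X. d (\<phi> x) = \<zero>}"
    using d_zero ctsD(2)[OF \<phi>] by auto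
  ultimately show ?thesis unfolding zero_sets_iff by blast
qed

section \<open>Strong zero-dimensionality\<close>

definition zero_sets_separated :: bool where
  "zero_sets_separated \<longleftrightarrow> (\<forall>Z1\<in>zero_sets R X T. \<forall>Z2\<in>zero_sets R X T. Z1 \<inter> Z2 = {} \<longrightarrow>
     (\<exists>U. clopen_in X T U \<and> Z1 \<subseteq> U \<and> U \<subseteq> elts X - Z2))"

text \<open>A co-zero set is the preimage of the open set of non-zero reals, and disjointness of the
  zero sets says that the two co-zero sets cover the space. The hypothesis is applied to two
  functions only, so obtaining the families involves no choice.\<close>

lemma zero_sets_separated_if_A_fun:
  assumes A: "C_fun R X T \<subseteq> A_fun R X T" shows zero_sets_separated
  unfolding zero_sets_separated_def
proof (intro ballI impI)
  fix Z1 Z2 assume Z: "Z1 \<in> zero_sets R X T" "Z2 \<in> zero_sets R X T" "Z1 \<inter> Z2 = {}"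
  have cozero: "\<exists>F. countable_clopen_family X T F \<and> elts X - Z = \<Union> (elts ` elts F)"
    if Z: "Z \<in> zero_sets R X T" for Z
  proof -
    obtain f where f: "f \<in> C_fun R X T" "Z = {x \<in> elts X. app f x = \<zero>}"
      using Z by (auto simp: zero_sets_def)
    have "definable (\<lambda>e. e 0 \<prec> \<zero> \<or> \<zero> \<prec> e 0)" by (intro definable_R_intros)
    \<comment> \<open>The non-zero reals, written as two rays so that openness follows from the
      rules for rays.\<close>
    from separation_definable[OF this] obtain S where "elts S = {t \<in> elts K. t \<prec> \<zero> \<or> \<zero> \<prec> t}"
      by metis
    then have S: "t \<in>\<^sub>M S \<longleftrightarrow> t \<in>\<^sub>M K \<and> (t \<prec> \<zero> \<or> \<zero> \<prec> t)" for t by (simp add: set_eq_iff)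
    have "openR (\<lambda>t. t \<in>\<^sub>M S) \<longleftrightarrow> openR (\<lambda>t. t \<prec> \<zero> \<or> \<zero> \<prec> t)" by (rule openR_cong) (simp add: S)
    then have "open_real R S"
      using openR_disj[OF openR_less openR_greater, of \<zero> \<zero>] S by (auto simp: open_real_iff)
    then obtain F where F: "countable_clopen_family X T F" "preimage X f S = \<Union> (elts ` elts F)"
      using A f(1) unfolding A_fun_def by blast
    have "t \<in>\<^sub>M S \<longleftrightarrow> t \<noteq> \<zero>" if "t \<in>\<^sub>M K" for t
      using that le_total[of t \<zero>] by (auto simp: S less_def)
    moreover have "app f x \<in>\<^sub>M K" if "x \<in>\<^sub>M X" for x
      using f(1) that funs_ap[of f X K x] by (simp add: C_fun_def)
    ultimately have "preimage X f S = elts X - Z" unfolding f(2) preimage_def by auto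
    then show ?thesis using F by metis
  qed
  obtain F where F: "countable_clopen_family X T F" "elts X - Z2 = \<Union> (elts ` elts F)"
    using cozero[OF Z(2)] by blast
  obtain G where G: "countable_clopen_family X T G" "elts X - Z1 = \<Union> (elts ` elts G)"
    using cozero[OF Z(1)] by blast
  have "Z1 \<subseteq> elts X" using Z(1) by (auto simp: zero_sets_def)
  show "\<exists>U. clopen_in X T U \<and> Z1 \<subseteq> U \<and> U \<subseteq> elts X - Z2"
  proof (rule clopen_separation[OF F(1) G(1)])
    show "elts a \<inter> Z2 = {}" if "a \<in>\<^sub>M F" for a using F(2) that by auto
    show "elts b \<inter> Z1 = {}" if "b \<in>\<^sub>M G" for b using G(2) that by auto
    show "(\<exists>a\<in>elts F. x \<in>\<^sub>M a) \<or> (\<exists>b\<in>elts G. x \<in>\<^sub>M b)" if "x \<in>\<^sub>M X" for x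
    proof -
      have "x \<in> elts X - Z2 \<or> x \<in> elts X - Z1" using that Z(3) by auto
      then show ?thesis unfolding F(2) G(2) by auto
    qed
  qed fact
qed

text \<open>
  The only use of choice: from the finite sets of separating clopen sets supplied by \<open>CMC\<close> take
  the unions, which are again separating.
\<close>

lemma CMC_clopen_sequence:
  assumes CMC zero_sets_separated and \<phi>: "cts \<phi>"
    and P1: "definable (\<lambda>e. P1 (e 0) (e (Suc 0)))" "\<And>n. n \<in>\<^sub>M \<omega> \<Longrightarrow> openR (P1 n)"
    and P2: "definable (\<lambda>e. P2 (e 0) (e (Suc 0)))" "\<And>n. n \<in>\<^sub>M \<omega> \<Longrightarrow> openR (P2 n)"
    and P12: "\<And>n t. n \<in>\<^sub>M \<omega> \<Longrightarrow> t \<in>\<^sub>M K \<Longrightarrow> P1 n t \<or> P2 n t"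
  shows "\<exists>F. countable_clopen_family X T F \<and>
    (\<forall>n\<in>elts \<omega>. \<exists>U\<in>elts F. \<forall>x\<in>elts X. \<not> P1 n (\<phi> x) \<longrightarrow> x \<in>\<^sub>M U) \<and>
    (\<forall>U\<in>elts F. \<exists>n\<in>elts \<omega>. \<forall>x\<in>elts U. P2 n (\<phi> x))"
proof -
  \<comment> \<open>Clopenness is spelled out by a complement \<open>V\<close> in \<open>T\<close>,
    which keeps the condition first-order.\<close>
  define Q where "Q n U \<longleftrightarrow> (\<exists>V\<in>elts T. \<forall>x. x \<in>\<^sub>M V \<longleftrightarrow> x \<in>\<^sub>M X \<and> \<not> x \<in>\<^sub>M U) \<and>
    (\<forall>x\<in>elts X. \<not> P1 n (\<phi> x) \<longrightarrow> x \<in>\<^sub>M U) \<and> (\<forall>x\<in>elts U. P2 n (\<phi> x))" for n U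
  \<comment> \<open>All separators of the n-th pair instead of a selected one; being a
    \<open>coll\<close>, this set is definable in n.\<close>
  define G where "G n = coll T (Q n)" for n
  have Q: "definable (\<lambda>e. Q n (e 0))" for n
    unfolding Q_def
    by (intro definable_R_intros definable_comp2[OF P1(1)] definable_comp2[OF P2(1)]
        definable_fun_comp[OF ctsD(1)[OF \<phi>]])
  have G: "U \<in>\<^sub>M G n \<longleftrightarrow> U \<in>\<^sub>M T \<and> Q n U" for n U unfolding G_def by (rule mem_coll[OF Q])
  have clopen: "clopen_in X T (elts U)" if U: "U \<in>\<^sub>M G n" for n U
  proof -
    have "open_in T (elts U)" using U by (auto simp: G open_in_def)
    moreover obtain V where "V \<in>\<^sub>M T" "\<forall>x. x \<in>\<^sub>M V \<longleftrightarrow> x \<in>\<^sub>M X \<and> \<not> x \<in>\<^sub>M U"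
      using U by (auto simp: G Q_def)
    then have "open_in T (elts X - elts U)"
      unfolding open_in_def by (intro bexI[of _ V]) (simp_all add: set_eq_iff)
    ultimately show ?thesis by (simp add: clopen_in_def)
  qed
  have G_nonempty: "elts (G n) \<noteq> {}" if n: "n \<in>\<^sub>M \<omega>" for n
  proof -
    let ?Z1 = "{x \<in> elts X. \<not> P1 n (\<phi> x)}" and ?Z2 = "{x \<in> elts X. \<not> P2 n (\<phi> x)}"
    have "definable (\<lambda>e. P1 n (e 0))" "definable (\<lambda>e. P2 n (e 0))"
      by (intro definable_R_intros definable_comp2[OF P1(1)] definable_comp2[OF P2(1)])+
    then have "?Z1 \<in> zero_sets R X T" "?Z2 \<in> zero_sets R X T"
      using zero_set_closed_preimage[OF \<phi>] P1(2) P2(2) n by auto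
    moreover have "?Z1 \<inter> ?Z2 = {}" using P12[OF n] ctsD(2)[OF \<phi>] by auto
    ultimately obtain A where A: "clopen_in X T A" "?Z1 \<subseteq> A" "A \<subseteq> elts X - ?Z2"
      using assms(2) unfolding zero_sets_separated_def by meson
    obtain U V where UV: "U \<in>\<^sub>M T" "V \<in>\<^sub>M T" "elts U = A" "elts V = elts X - A"
      using A(1) by (auto simp: clopen_in_def open_in_def)
    have mU: "x \<in>\<^sub>M U \<longleftrightarrow> x \<in> A" and mV: "x \<in>\<^sub>M V \<longleftrightarrow> x \<in>\<^sub>M X \<and> x \<notin> A" for x
      using UV(3,4) by (simp_all flip: mem_elts)
    have "Q n U"
      unfolding Q_def using A(2,3) UV(2) by (intro conjI bexI[of _ V]) (auto simp: mU mV)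
    then show ?thesis using G UV(1) by auto
  qed
  have G_fun: "definable_fun (\<lambda>e. G (e 0))"
    unfolding G_def Q_def
    by (intro definable_R_intros definable_comp2[OF P1(1)] definable_comp2[OF P2(1)]
        definable_fun_comp[OF ctsD(1)[OF \<phi>]])
  have "G n \<in>\<^sub>M pow T" for n by (auto simp: G)
  then obtain A where A: "A \<in> funs \<omega> (pow T)" "\<forall>n\<in>elts \<omega>. app A n = G n"
    using funs_definable[OF G_fun, of \<omega> "pow T"] by blast
  then obtain c where c: "multiple_choice_function \<omega> A c"
    using \<open>CMC\<close> denumerable_omega G_nonempty unfolding CMC_def by (metis mem_elts)
  then obtain W where W: "c \<in> funs \<omega> W" by (auto simp: multiple_choice_function_def)
  have cn: "elts (ap c n) \<noteq> {}" "finite_set (ap c n)" "elts (ap c n) \<subseteq> elts (G n)"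
    if n: "n \<in>\<^sub>M \<omega>" for n
    using c[unfolded multiple_choice_function_def, THEN conjunct2, THEN bspec, of n] A(2) n
      funs_ap(3)[OF W n] by simp_all
  have U_fun: "definable_fun (\<lambda>e. UnM (ap c (e 0)))" by (intro definable_R_intros)
  \<comment> \<open>Replacement collects the unions into a set of the model, countable as an image
    of \<omega>.\<close>
  obtain F where F: "elts F = (\<lambda>n. UnM (ap c n)) ` elts \<omega>" using image_definable[OF U_fun] by metis
  have "clopen_in X T (elts (UnM (ap c n)))" if n: "n \<in>\<^sub>M \<omega>" for n
    using cn(3)[OF n] by (intro clopen_in_finite_union[OF cn(2)[OF n]] clopen[of _ n]) auto
  then have "countable_clopen_family X T F"
    unfolding countable_clopen_family_def using countable_image_omega[OF U_fun F] F by auto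
  moreover have "\<exists>U\<in>elts F. \<forall>x\<in>elts X. \<not> P1 n (\<phi> x) \<longrightarrow> x \<in>\<^sub>M U" if n: "n \<in>\<^sub>M \<omega>" for n
  \<comment> \<open>Here a single separator suffices, so non-emptiness of \<open>ap c n\<close> is
    used; the upper inclusion further below uses that all members are separators.\<close>
  proof (intro bexI[of _ "UnM (ap c n)"] ballI impI)
    fix x assume x: "x \<in> elts X" "\<not> P1 n (\<phi> x)"
    obtain U where U: "U \<in> elts (ap c n)" using cn(1)[OF n] by blast
    then have "Q n U" using cn(3)[OF n] G by auto
    then show "x \<in>\<^sub>M UnM (ap c n)" using x U by (auto simp: Q_def intro!: bexI[of _ U])
  qed (use n F in simp)
  moreover have "\<exists>n\<in>elts \<omega>. \<forall>x\<in>elts U. P2 n (\<phi> x)" if U: "U \<in> elts F" for U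
  proof -
    obtain n where n: "n \<in>\<^sub>M \<omega>" "U = UnM (ap c n)" using U unfolding F by auto
    have "P2 n (\<phi> x)" if x: "x \<in>\<^sub>M U" for x
    proof -
      obtain V where V: "V \<in> elts (ap c n)" "x \<in>\<^sub>M V" using x n(2) by auto
      then have "Q n V" using cn(3)[OF n(1)] G by auto
      then show ?thesis using V by (auto simp: Q_def)
    qed
    then show ?thesis using n(1) by (intro bexI[of _ n]) simp_all
  qed
  ultimately show ?thesis by (intro exI[of _ F]) simp
qed

lemma A_fun_if_zero_sets_separated:
  assumes CMC zero_sets_separated "f \<in> C_fun R X T" shows "f \<in> A_fun R X T"
proof -
  have f_funs: "f \<in> funs X K" using assms(3) by (simp add: C_fun_def)
  have \<phi>: "cts (ap f)" by (rule C_fun_cts) fact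
  have "\<exists>F. countable_clopen_family X T F \<and> preimage X f S = \<Union> (elts ` elts F)"
    if S: "open_real R S" for S
  proof -
    obtain \<epsilon> where \<epsilon>: "definable_fun (\<lambda>e. \<epsilon> (e 0))" "\<And>n. n \<in>\<^sub>M \<omega> \<Longrightarrow> \<epsilon> n \<in>\<^sub>M K"
      "\<And>n. n \<in>\<^sub>M \<omega> \<Longrightarrow> \<zero> \<prec> \<epsilon> n" "\<And>r. r \<in>\<^sub>M K \<Longrightarrow> \<zero> \<prec> r \<Longrightarrow> \<exists>n\<in>elts \<omega>. \<epsilon> n \<preceq> r"
      using null_sequence by metis
    define C where "C = coll K (\<lambda>y. \<not> y \<in>\<^sub>M S)"
    have C: "y \<in>\<^sub>M C \<longleftrightarrow> y \<in>\<^sub>M K \<and> \<not> y \<in>\<^sub>M S" for y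
      unfolding C_def by (rule mem_coll) (intro definable_intros)
    \<comment> \<open>\<open>?P1 n\<close> says that t is closer than \<open>\<epsilon> n\<close> to
      the complement of \<open>S\<close>. The sets where it fails lie in \<open>S\<close> and
      exhaust it as \<open>\<epsilon> n\<close> tends to 0.\<close>
    let ?P1 = "\<lambda>n t. \<exists>y\<in>elts C. t \<prec> y \<oplus> \<epsilon> n \<and> y \<prec> t \<oplus> \<epsilon> n"
    let ?P2 = "\<lambda>n t. t \<in>\<^sub>M S"
    have "\<exists>F. countable_clopen_family X T F \<and>
      (\<forall>n\<in>elts \<omega>. \<exists>U\<in>elts F. \<forall>x\<in>elts X. \<not> ?P1 n (ap f x) \<longrightarrow> x \<in>\<^sub>M U) \<and>
      (\<forall>U\<in>elts F. \<exists>n\<in>elts \<omega>. \<forall>x\<in>elts U. ?P2 n (ap f x))"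
    proof (rule CMC_clopen_sequence[OF assms(1,2) \<phi>])
      show "definable (\<lambda>e. ?P1 (e 0) (e (Suc 0)))"
        by (intro definable_R_intros definable_fun_comp[OF \<epsilon>(1)])
      show "definable (\<lambda>e. ?P2 (e 0) (e (Suc 0)))" by (intro definable_R_intros)
      show "openR (?P1 n)" if "n \<in>\<^sub>M \<omega>" for n
        using that by (intro openR_bex openR_conj openR_less openR_less_plus) (simp_all add: C \<epsilon>(2))
      show "openR (?P2 n)" for n using S by (simp add: open_real_iff)
      show "?P1 n t \<or> ?P2 n t" if "n \<in>\<^sub>M \<omega>" "t \<in>\<^sub>M K" for n t
        using that \<epsilon>(2,3)[OF that(1)] by (cases "t \<in>\<^sub>M S") (auto simp: C intro!: bexI[of _ t])
    qed
    then obtain F where F: "countable_clopen_family X T F"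
      "\<And>n. n \<in>\<^sub>M \<omega> \<Longrightarrow> \<exists>U\<in>elts F. \<forall>x\<in>elts X. \<not> ?P1 n (ap f x) \<longrightarrow> x \<in>\<^sub>M U"
      "\<And>U x. U \<in>\<^sub>M F \<Longrightarrow> x \<in>\<^sub>M U \<Longrightarrow> ap f x \<in>\<^sub>M S"
      unfolding Ball_def mem_elts by metis
    have "x \<in> preimage X f S \<longleftrightarrow> x \<in> \<Union> (elts ` elts F)" for x
    proof
      assume "x \<in> preimage X f S"
      then have x: "x \<in>\<^sub>M X" "ap f x \<in>\<^sub>M S" using funs_ap(3)[OF f_funs] by (auto simp: preimage_def)
      then have xK: "ap f x \<in>\<^sub>M K" using funs_ap(2)[OF f_funs] by simp
      obtain r where r: "r \<in>\<^sub>M K" "\<zero> \<prec> r"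
        "\<forall>y. y \<in>\<^sub>M K \<longrightarrow> ap f x \<prec> y \<oplus> r \<longrightarrow> y \<prec> ap f x \<oplus> r \<longrightarrow> y \<in>\<^sub>M S"
        using openR_ball[of "\<lambda>t. t \<in>\<^sub>M S" "ap f x"] S xK x(2) unfolding open_real_iff by blast
      obtain n where n: "n \<in>\<^sub>M \<omega>" "\<epsilon> n \<preceq> r" using \<epsilon>(4)[OF r(1,2)] by auto
      have "\<not> ?P1 n (ap f x)"
      proof
        assume "?P1 n (ap f x)"
        then obtain y where y: "y \<in>\<^sub>M K" "\<not> y \<in>\<^sub>M S" "ap f x \<prec> y \<oplus> \<epsilon> n" "y \<prec> ap f x \<oplus> \<epsilon> n"
          by (auto simp: C)
        have "ap f x \<prec> y \<oplus> r" "y \<prec> ap f x \<oplus> r"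
          using less_le_trans[OF y(3), of "y \<oplus> r"] less_le_trans[OF y(4), of "ap f x \<oplus> r"]
            y(1) xK r(1) n \<epsilon>(2) by simp_all
        then show False using r(3) y by blast
      qed
      then show "x \<in> \<Union> (elts ` elts F)" using F(2)[OF n(1)] x(1) by auto
    next
      assume "x \<in> \<Union> (elts ` elts F)"
      then obtain U where U: "U \<in>\<^sub>M F" "x \<in>\<^sub>M U" by auto
      then have "x \<in>\<^sub>M X"
        using F(1) clopen_in_subset[of "elts U"] by (auto simp: countable_clopen_family_def)
      then show "x \<in> preimage X f S" using F(3)[OF U] funs_ap(3)[OF f_funs] by (simp add: preimage_def)
    qed
    then show ?thesis using F(1) by blast
  qed
  then show ?thesis using assms(3) by (simp add: A_fun_def)
qed

section \<open>Oscillation and countable clopen covers\<close>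

lemma bounded_osc_iff:
  assumes f: "f \<in> funs X K" and A: "elts A \<subseteq> elts X" and r: "r \<in>\<^sub>M K" "\<zero> \<preceq> r"
  shows "(\<exists>s. is_osc R f A s \<and> s \<preceq> r) \<longleftrightarrow>
    (\<forall>x\<in>elts A. \<forall>y\<in>elts A. dist_R (ap f x) (ap f y) \<preceq> r)"
proof -
  define D where "D = {absdiff R (app f x) (app f y) | x y. x \<in>\<^sub>M A \<and> y \<in>\<^sub>M A}"
  have fK: "ap f x \<in>\<^sub>M K" "app f x = ap f x" if "x \<in>\<^sub>M A" for x
    using funs_ap[OF f, of x] that A by auto
  have D: "d \<in> D \<longleftrightarrow> (\<exists>x\<in>elts A. \<exists>y\<in>elts A. d = dist_R (ap f x) (ap f y))" for d
  proof -
    have "absdiff R (app f x) (app f y) = dist_R (ap f x) (ap f y)" if "x \<in>\<^sub>M A" "y \<in>\<^sub>M A" for x y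
      using fK[OF that(1)] fK[OF that(2)] by (simp add: absdiff_eq_dist)
    then show ?thesis unfolding D_def mem_Collect_eq by (metis mem_elts)
  qed
  have osc: "is_osc R f A s \<longleftrightarrow> upper_bound R D s \<and> \<zero> \<preceq> s \<and>
      (\<forall>b. upper_bound R D b \<and> \<zero> \<preceq> b \<longrightarrow> s \<preceq> b)" for s
    by (simp add: is_osc_def D_def Let_def)
  have ub: "upper_bound R D b \<longleftrightarrow>
      b \<in>\<^sub>M K \<and> (\<forall>x\<in>elts A. \<forall>y\<in>elts A. dist_R (ap f x) (ap f y) \<preceq> b)" for b
    unfolding upper_bound_def Ball_def[of D] D by auto
  show ?thesis
  proof
    assume "\<exists>s. is_osc R f A s \<and> s \<preceq> r"
    then obtain s where "upper_bound R D s" "s \<preceq> r" by (auto simp: osc)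
    then show "\<forall>x\<in>elts A. \<forall>y\<in>elts A. dist_R (ap f x) (ap f y) \<preceq> r"
      using r fK le_trans[of _ s r] by (simp add: ub)
  next
    assume *: "\<forall>x\<in>elts A. \<forall>y\<in>elts A. dist_R (ap f x) (ap f y) \<preceq> r"
    \<comment> \<open>Adding 0 to the distances makes the set non-empty even for empty
      \<open>A\<close> and matches the supremum in [0, \<infinity>].\<close>
    let ?P = "\<lambda>d. d = \<zero> \<or> (\<exists>x\<in>elts A. \<exists>y\<in>elts A. d = dist_R (ap f x) (ap f y))"
    have "definable (\<lambda>e. ?P (e 0))" by (intro definable_R_intros definable_dist)
    then obtain s where s: "s \<in>\<^sub>M K" "\<And>x. x \<in>\<^sub>M K \<Longrightarrow> ?P x \<Longrightarrow> x \<preceq> s"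
      "\<And>b. b \<in>\<^sub>M K \<Longrightarrow> (\<And>x. x \<in>\<^sub>M K \<Longrightarrow> ?P x \<Longrightarrow> x \<preceq> b) \<Longrightarrow> s \<preceq> b"
      by (rule sup_exists[of ?P \<zero> r]) (use * r in auto)
    have "is_osc R f A s"
      unfolding osc
    proof (intro conjI allI impI)
      show "upper_bound R D s" unfolding ub using s(1) by (auto intro!: s(2) simp: fK)
      show "s \<preceq> b" if "upper_bound R D b \<and> \<zero> \<preceq> b" for b
        using that unfolding ub by (intro s(3)) auto
    qed (use s(2)[of \<zero>] in simp)
    moreover have "s \<preceq> r" using * r by (intro s(3)) auto
    ultimately show "\<exists>s. is_osc R f A s \<and> s \<preceq> r" by blast
  qed
qed

lemma U_fun_iff:
  assumes f: "f \<in> C_fun R X T"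
  shows "f \<in> U_fun R X T \<longleftrightarrow> (\<forall>r\<in>elts K. \<zero> \<prec> r \<longrightarrow>
    (\<exists>F. countable_clopen_family X T F \<and> \<Union> (elts ` elts F) = elts X \<and>
      (\<forall>A\<in>elts F. \<forall>x\<in>elts A. \<forall>y\<in>elts A. dist_R (ap f x) (ap f y) \<preceq> r)))"
proof -
  have f_funs: "f \<in> funs X K" using f by (simp add: C_fun_def)
  have "(\<forall>A\<in>elts F. \<exists>s. is_osc R f A s \<and> s \<preceq> r) \<longleftrightarrow>
      (\<forall>A\<in>elts F. \<forall>x\<in>elts A. \<forall>y\<in>elts A. dist_R (ap f x) (ap f y) \<preceq> r)"
    if "countable_clopen_family X T F" "r \<in>\<^sub>M K" "\<zero> \<prec> r" for F r
  proof (rule ball_cong[OF refl])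
    fix A assume "A \<in> elts F"
    then have "elts A \<subseteq> elts X"
      using that(1) clopen_in_subset[of "elts A"] by (simp add: countable_clopen_family_def)
    then show "(\<exists>s. is_osc R f A s \<and> s \<preceq> r) \<longleftrightarrow>
      (\<forall>x\<in>elts A. \<forall>y\<in>elts A. dist_R (ap f x) (ap f y) \<preceq> r)"
      using bounded_osc_iff[OF f_funs] that less_imp_le by blast
  qed
  then show ?thesis unfolding U_fun_def using f by (simp cong: conj_cong imp_cong)
qed

lemma U_fun_if_zero_sets_separated:
  assumes CMC zero_sets_separated and f: "f \<in> C_fun R X T" shows "f \<in> U_fun R X T"
  unfolding U_fun_iff[OF f]
proof (intro ballI impI)
  fix r assume r: "r \<in> elts K" "\<zero> \<prec> r"
  \<comment> \<open>Members of the cover will lie in preimages of balls of radius h, whose diameter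
    is at most 2h = r; \<delta> = h/2 leaves a gap between the closed and the open balls.\<close>
  define h where "h = half r"
  define \<delta> where "\<delta> = half h"
  have h: "h \<in>\<^sub>M K" "\<zero> \<prec> h" "h \<oplus> h = r" using r half_pos by (simp_all add: h_def)
  have \<delta>: "\<delta> \<in>\<^sub>M K" "\<zero> \<prec> \<delta>" "\<delta> \<oplus> \<delta> = h" using h half_pos by (simp_all add: \<delta>_def)
  have \<phi>: "cts (ap f)" by (rule C_fun_cts) fact
  have fK: "ap f x \<in>\<^sub>M K" if "x \<in>\<^sub>M X" for x using ctsD(2)[OF \<phi> that] .
  obtain \<nu> where \<nu>: "definable_fun (\<lambda>e. \<nu> (e 0))" "\<And>n. n \<in>\<^sub>M \<omega> \<Longrightarrow> \<nu> n \<in>\<^sub>M K"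
    "\<And>t. t \<in>\<^sub>M K \<Longrightarrow> \<exists>n\<in>elts \<omega>. \<nu> n \<preceq> t \<oplus> \<delta> \<and> t \<preceq> \<nu> n \<oplus> \<delta>"
    using net_sequence[OF \<delta>(1,2)] by metis
  \<comment> \<open>Distance from \<open>\<nu> n\<close> greater than \<delta>, respectively less
    than h; as \<delta> < h, every t satisfies one of them.\<close>
  let ?P1 = "\<lambda>n t. t \<oplus> \<delta> \<prec> \<nu> n \<or> \<nu> n \<oplus> \<delta> \<prec> t"
  let ?P2 = "\<lambda>n t. \<nu> n \<prec> t \<oplus> h \<and> t \<prec> \<nu> n \<oplus> h"
  have "\<exists>F. countable_clopen_family X T F \<and>
    (\<forall>n\<in>elts \<omega>. \<exists>U\<in>elts F. \<forall>x\<in>elts X. \<not> ?P1 n (ap f x) \<longrightarrow> x \<in>\<^sub>M U) \<and>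
    (\<forall>U\<in>elts F. \<exists>n\<in>elts \<omega>. \<forall>x\<in>elts U. ?P2 n (ap f x))"
  proof (rule CMC_clopen_sequence[OF assms(1,2) \<phi>])
    show "definable (\<lambda>e. ?P1 (e 0) (e (Suc 0)))" "definable (\<lambda>e. ?P2 (e 0) (e (Suc 0)))"
      by (intro definable_R_intros definable_fun_comp[OF \<nu>(1)])+
    show "openR (?P1 n)" "openR (?P2 n)" if "n \<in>\<^sub>M \<omega>" for n
      using \<nu>(2)[OF that] \<delta>(1) h(1)
      by (intro openR_disj openR_conj openR_less openR_greater openR_less_plus; simp)+
    show "?P1 n t \<or> ?P2 n t" if n: "n \<in>\<^sub>M \<omega>" and t: "t \<in>\<^sub>M K" for n t
    proof (rule disjCI)
      note nK = \<nu>(2)[OF n]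
      assume "\<not> ?P2 n t"
      then consider "t \<oplus> h \<preceq> \<nu> n" | "\<nu> n \<oplus> h \<preceq> t"
        using t nK h(1) not_less[of "\<nu> n" "t \<oplus> h"] not_less[of t "\<nu> n \<oplus> h"] by auto
      then show "?P1 n t"
      proof cases
        case 1
        have "t \<oplus> \<delta> \<prec> t \<oplus> h" using \<delta> t less_plus_iff[of \<delta> \<delta>] h(1) by simp
        then show ?thesis using less_le_trans[of "t \<oplus> \<delta>" "t \<oplus> h" "\<nu> n"] 1 t nK \<delta>(1) h(1) by simp
      next
        case 2
        have "\<nu> n \<oplus> \<delta> \<prec> \<nu> n \<oplus> h" using \<delta> nK less_plus_iff[of \<delta> \<delta>] h(1) by simp
        then show ?thesis using less_le_trans[of "\<nu> n \<oplus> \<delta>" "\<nu> n \<oplus> h" t] 2 t nK \<delta>(1) h(1) by simp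
      qed
    qed
  qed
  then obtain F where F: "countable_clopen_family X T F"
    "\<forall>n\<in>elts \<omega>. \<exists>U\<in>elts F. \<forall>x\<in>elts X. \<not> ?P1 n (ap f x) \<longrightarrow> x \<in>\<^sub>M U"
    "\<forall>U\<in>elts F. \<exists>n\<in>elts \<omega>. \<forall>x\<in>elts U. ?P2 n (ap f x)"
    by blast
  have FX: "x \<in>\<^sub>M X" if "U \<in>\<^sub>M F" "x \<in>\<^sub>M U" for U x
    using F(1) that clopen_in_subset[of "elts U"] by (auto simp: countable_clopen_family_def)
  have "\<exists>U\<in>elts F. x \<in>\<^sub>M U" if x: "x \<in>\<^sub>M X" for x
  proof -
    obtain n where n: "n \<in>\<^sub>M \<omega>" "\<nu> n \<preceq> ap f x \<oplus> \<delta>" "ap f x \<preceq> \<nu> n \<oplus> \<delta>"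
      using \<nu>(3)[OF fK[OF x]] by auto
    then have "\<not> ?P1 n (ap f x)"
      using fK[OF x] \<nu>(2)[OF n(1)] \<delta>(1) not_less[of "ap f x \<oplus> \<delta>" "\<nu> n"]
        not_less[of "\<nu> n \<oplus> \<delta>" "ap f x"] by simp
    moreover have "\<exists>U\<in>elts F. \<forall>x\<in>elts X. \<not> ?P1 n (ap f x) \<longrightarrow> x \<in>\<^sub>M U" using F(2) n(1) by simp
    ultimately show ?thesis using x by auto
  qed
  then have "\<Union> (elts ` elts F) = elts X" using FX by (simp add: set_eq_iff) (metis mem_elts)
  moreover have "dist_R (ap f x) (ap f y) \<preceq> r" if A: "A \<in>\<^sub>M F" and x: "x \<in>\<^sub>M A" and y: "y \<in>\<^sub>M A" for A x y
  proof -
    obtain n where n: "n \<in>\<^sub>M \<omega>" "?P2 n (ap f x)" "?P2 n (ap f y)"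
      using bspec[OF F(3), of A] A x y by auto
    note K = fK[OF FX[OF A x]] fK[OF FX[OF A y]] \<nu>(2)[OF n(1)]
    have le: "s \<preceq> t \<oplus> r" if "s \<prec> \<nu> n \<oplus> h" "\<nu> n \<prec> t \<oplus> h" "s \<in>\<^sub>M K" "t \<in>\<^sub>M K" for s t
    proof -
      have "s \<prec> t \<oplus> h \<oplus> h" by (rule less_trans[OF that(1)]) (use that K h in simp_all)
      then show ?thesis using that h by (simp add: plus_assoc less_imp_le)
    qed
    show ?thesis using n K r by (simp add: dist_le_iff le)
  qed
  ultimately show "\<exists>F. countable_clopen_family X T F \<and> \<Union> (elts ` elts F) = elts X \<and>
      (\<forall>A\<in>elts F. \<forall>x\<in>elts A. \<forall>y\<in>elts A. dist_R (ap f x) (ap f y) \<preceq> r)"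
    using F(1) by (intro exI[of _ F]) simp
qed

text \<open>
  For disjoint zero sets \<open>Z(\<phi>)\<close>, \<open>Z(\<psi>)\<close> apply the hypothesis to \<open>\<bar>\<phi>\<bar> / (\<bar>\<phi>\<bar> + \<bar>\<psi>\<bar>)\<close>: no set on which
  this function oscillates by at most 1/2 meets both.
\<close>

lemma zero_sets_separated_if_U_fun:
  assumes U: "C_fun R X T \<subseteq> U_fun R X T" shows zero_sets_separated
  unfolding zero_sets_separated_def
proof (intro ballI impI)
  fix Z1 Z2 assume Z: "Z1 \<in> zero_sets R X T" "Z2 \<in> zero_sets R X T" "Z1 \<inter> Z2 = {}"
  obtain \<phi> where \<phi>: "cts \<phi>" "Z1 = {x \<in> elts X. \<phi> x = \<zero>}" using Z(1) zero_sets_iff by auto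
  obtain \<psi> where \<psi>: "cts \<psi>" "Z2 = {x \<in> elts X. \<psi> x = \<zero>}" using Z(2) zero_sets_iff by auto
  define u where "u x = dist_R (\<phi> x) \<zero>" for x
  define v where "v x = dist_R (\<psi> x) \<zero>" for x
  have u: "cts u" and v: "cts v" unfolding u_def v_def using cts_abs \<phi>(1) \<psi>(1) by blast+
  have abs_zero: "dist_R t \<zero> = \<zero> \<longleftrightarrow> t = \<zero>" if t: "t \<in>\<^sub>M K" for t
  proof -
    have "\<ominus> t = \<zero> \<Longrightarrow> t = \<zero>" using uminus_uminus[OF t] by simp
    then show ?thesis using t by (auto simp: dist_R_def)
  qed
  have uK: "u x \<in>\<^sub>M K" "\<zero> \<preceq> u x" "u x = \<zero> \<longleftrightarrow> x \<in> Z1" if "x \<in>\<^sub>M X" for x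
    using ctsD(2)[OF \<phi>(1) that] that by (simp_all add: u_def dist_nonneg abs_zero \<phi>(2))
  have vK: "v x \<in>\<^sub>M K" "\<zero> \<preceq> v x" "v x = \<zero> \<longleftrightarrow> x \<in> Z2" if "x \<in>\<^sub>M X" for x
    using ctsD(2)[OF \<psi>(1) that] that by (simp_all add: v_def dist_nonneg abs_zero \<psi>(2))
  have pos: "\<zero> \<prec> u x \<oplus> v x" if x: "x \<in>\<^sub>M X" for x
  proof -
    have "u x \<noteq> \<zero> \<or> v x \<noteq> \<zero>" using uK(3)[OF x] vK(3)[OF x] Z(3) by blast
    then have "\<zero> \<prec> u x \<or> \<zero> \<prec> v x" using uK(2)[OF x] vK(2)[OF x] by (auto simp: less_def)
    then show ?thesis
      using uK[OF x] vK[OF x] plus_less_le_mono[of \<zero> "u x" \<zero> "v x"] plus_less_le_mono[of \<zero> "v x" \<zero> "u x"]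
      by (auto simp: plus_comm[of "u x"])
  qed
  have "cts (\<lambda>x. inverse_R (u x \<oplus> v x) \<otimes> u x)" by (rule cts_divide[OF u cts_plus[OF u v] pos])
  then obtain f where f: "f \<in> C_fun R X T" "\<forall>x\<in>elts X. ap f x = inverse_R (u x \<oplus> v x) \<otimes> u x"
    using cts_C_fun by blast
  have inv: "inverse_R (u x \<oplus> v x) \<in>\<^sub>M K" "(u x \<oplus> v x) \<otimes> inverse_R (u x \<oplus> v x) = \<one>"
    if x: "x \<in>\<^sub>M X" for x
  proof -
    have "u x \<oplus> v x \<noteq> \<zero>" using pos[OF x] by auto
    then show "inverse_R (u x \<oplus> v x) \<in>\<^sub>M K" "(u x \<oplus> v x) \<otimes> inverse_R (u x \<oplus> v x) = \<one>"
      using inverse_closed times_inverse uK[OF x] vK[OF x] by simp_all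
  qed
  have f1: "ap f x = \<zero>" if "x \<in> Z1" "x \<in>\<^sub>M X" for x
    using that f(2) uK[OF that(2)] inv[OF that(2)] by simp
  have f2: "ap f x = \<one>" if "x \<in> Z2" "x \<in>\<^sub>M X" for x
    using that f(2) uK[OF that(2)] vK[OF that(2)] inv[OF that(2)] by (simp add: times_comm)
  have "f \<in> U_fun R X T" using U f(1) by auto
  then have "\<forall>r\<in>elts K. \<zero> \<prec> r \<longrightarrow>
    (\<exists>F. countable_clopen_family X T F \<and> \<Union> (elts ` elts F) = elts X \<and>
      (\<forall>A\<in>elts F. \<forall>x\<in>elts A. \<forall>y\<in>elts A. dist_R (ap f x) (ap f y) \<preceq> r))"
    using U_fun_iff[OF f(1)] by simp
  \<comment> \<open>The quotient is 0 on \<open>Z1\<close> and 1 on \<open>Z2\<close>, so a bound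
    below 1 is required; 1/2 is one.\<close>
  moreover have "half \<one> \<in> elts K" "\<zero> \<prec> half \<one>" using half_pos by simp_all
  ultimately obtain F where F: "countable_clopen_family X T F" "\<Union> (elts ` elts F) = elts X"
    and osc: "\<forall>A\<in>elts F. \<forall>x\<in>elts A. \<forall>y\<in>elts A. dist_R (ap f x) (ap f y) \<preceq> half \<one>"
    by blast
  have FX: "x \<in>\<^sub>M X" if "A \<in>\<^sub>M F" "x \<in>\<^sub>M A" for A x using F(2) that by auto
  have disj: "elts A \<inter> Z1 = {} \<or> elts A \<inter> Z2 = {}" if A: "A \<in>\<^sub>M F" for A
  proof (rule ccontr)
    assume "\<not> ?thesis"
    then obtain x y where xy: "x \<in>\<^sub>M A" "x \<in> Z1" "y \<in>\<^sub>M A" "y \<in> Z2" by auto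
    then have "dist_R \<one> \<zero> \<preceq> half \<one>"
      using osc A f1[OF xy(2) FX[OF A xy(1)]] f2[OF xy(4) FX[OF A xy(3)]] by (metis mem_elts)
    then have "\<one> \<preceq> half \<one>" by (simp add: dist_le_iff)
    moreover have "half \<one> \<prec> half \<one> \<oplus> half \<one>"
      using half_pos[OF zero_less_one] less_plus_iff[of "half \<one>" "half \<one>"] by simp
    then have "half \<one> \<prec> \<one>" by simp
    ultimately show False using not_le[of \<one> "half \<one>"] by simp
  qed
  \<comment> \<open>\<open>Z1\<close> and \<open>Z2\<close> are HOL sets, so missing them is
    expressed by \<open>\<phi>\<close> and \<open>\<psi>\<close> having no zero; separation can then
    form the two subfamilies.\<close>
  have Z_def: "definable (\<lambda>e. \<forall>x\<in>elts (e 0). \<phi> x \<noteq> \<zero>)" "definable (\<lambda>e. \<forall>x\<in>elts (e 0). \<psi> x \<noteq> \<zero>)"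
    by (intro definable_R_intros definable_fun_comp[OF ctsD(1)[OF \<phi>(1)]]
        definable_fun_comp[OF ctsD(1)[OF \<psi>(1)]])+
  obtain G where G: "elts G = {A \<in> elts F. \<forall>x\<in>elts A. \<psi> x \<noteq> \<zero>}"
    using separation_definable[OF Z_def(2)] by metis
  obtain H where H: "elts H = {A \<in> elts F. \<forall>x\<in>elts A. \<phi> x \<noteq> \<zero>}"
    using separation_definable[OF Z_def(1)] by metis
  have mG: "A \<in>\<^sub>M G \<longleftrightarrow> A \<in>\<^sub>M F \<and> elts A \<inter> Z2 = {}" for A
    using FX[of A] G \<psi>(2) by (auto simp: set_eq_iff)
  have mH: "A \<in>\<^sub>M H \<longleftrightarrow> A \<in>\<^sub>M F \<and> elts A \<inter> Z1 = {}" for A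
    using FX[of A] H \<phi>(2) by (auto simp: set_eq_iff)
  have "countable_clopen_family X T G" "countable_clopen_family X T H"
    using F(1) countable_subset[of F G] countable_subset[of F H] mG mH
    by (auto simp: countable_clopen_family_def subset_iff)
  then show "\<exists>U. clopen_in X T U \<and> Z1 \<subseteq> U \<and> U \<subseteq> elts X - Z2"
  proof (rule clopen_separation)
    show "(\<exists>a\<in>elts G. x \<in>\<^sub>M a) \<or> (\<exists>b\<in>elts H. x \<in>\<^sub>M b)" if x: "x \<in>\<^sub>M X" for x
    proof -
      have "x \<in> \<Union> (elts ` elts F)" using F(2) x by simp
      then obtain A where "A \<in>\<^sub>M F" "x \<in>\<^sub>M A" by auto
      then show ?thesis using disj[of A] mG mH by (metis mem_elts)
    qed
  qed (use mG mH \<phi>(2) in auto)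
qed

end

theorem proposition3p2:
  fixes E :: "'m \<Rightarrow> 'm \<Rightarrow> bool" and R :: "'m field_data" and X T :: 'm
  assumes "ZF_model E"
    and "set_structure.real_line E R"
    and "set_structure.completely_regular E R X T"
  shows
    "(set_structure.A_fun E R X T = set_structure.C_fun E R X T \<longrightarrow>
        set_structure.strongly_zero_dimensional E R X T) \<and>
     (set_structure.CMC E \<longrightarrow>
        (set_structure.strongly_zero_dimensional E R X T \<longleftrightarrow>
         set_structure.A_fun E R X T = set_structure.C_fun E R X T)) \<and>
     (set_structure.CMC E \<longrightarrow>
        (set_structure.strongly_zero_dimensional E R X T \<longleftrightarrow>
         set_structure.U_fun E R X T = set_structure.C_fun E R X T))"
proof -
  interpret ZF_model E by fact
  interpret real_space_model E R X T
    using assms(2,3) by unfold_locales (simp_all add: completely_regular_def)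
  \<comment> \<open>Complete regularity is given, so strong zero-dimensionality amounts to its
    separation clause.\<close>
  have szd: "strongly_zero_dimensional R X T \<longleftrightarrow> zero_sets_separated"
    using assms(3) by (simp add: strongly_zero_dimensional_def zero_sets_separated_def)
  have "A_fun R X T \<subseteq> C_fun R X T" "U_fun R X T \<subseteq> C_fun R X T"
    by (auto simp: A_fun_def U_fun_def)
  then show ?thesis
    unfolding szd using zero_sets_separated_if_A_fun A_fun_if_zero_sets_separated
      zero_sets_separated_if_U_fun U_fun_if_zero_sets_separated by blast
qed

end
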